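(* Fix $r>0$ and an integer $d\ge0$. Let $C_n=[0,n^{1/2})^2$ be the torus with the Euclidean toroidal metric $D$, and let $V_1,\dots,V_n$ be independent uniform points in $C_n$. Let $M_i:=\#\{j\ne i: D(V_i,V_j)\le r\}$ and $W_d:=\sum_{i=1}^n\mathbf{1}\{M_i\ne d\}$, with $\mu:=\mathbb{E}W_d$ and $\sigma^2:=\mathrm{Var}(W_d)$. Then, as $n\to\infty$, \[ d_{\mathrm{TV}}\big(\mathcal{L}(W_d),\mathrm{TP}(\mu,\sigma^2)\big)=O(1/\sigma),\qquad d_{\mathrm{loc}}\big(\mathcal{L}(W_d),\mathrm{TP}(\mu,\sigma^2)\big)=O\big((\log\sigma)^{3/2}/\sigma^2\big). \]
   Context: $\mathrm{TP}(\mu,\sigma^2)$ is the law of $Z$ with $Z-s\sim\mathrm{Po}(\sigma^2+\gamma)$, $s=\lfloor\mu-\sigma^2\rfloor$, $\gamma=\mu-\sigma^2-s$. $d_{\mathrm{TV}}$ is total variation distance and $d_{\mathrm{loc}}(\mathcal{L}(X),\mathcal{L}(Y))=\sup_{a\in\mathbb{Z}}|\mathbb{P}(X=a)-\mathbb{P}(Y=a)|$. It is assumed $\pi r^2<n$. (Here $\sigma^2$ is of strict order $n$.) *)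

theory Defs
  imports "HOL-Probability.Probability" "HOL-Library.Landau_Symbols"
begin

definition side :: "nat \<Rightarrow> real" where
  "side n = sqrt (real n)"

definition torus_box :: "real \<Rightarrow> (real \<times> real) set" where
  "torus_box L = {0..<L} \<times> {0..<L}"

definition torus_dist :: "real \<Rightarrow> real \<times> real \<Rightarrow> real \<times> real \<Rightarrow> real" where
  "torus_dist L x y =
     sqrt ((min \<bar>fst x - fst y\<bar> (L - \<bar>fst x - fst y\<bar>))\<^sup>2 +
           (min \<bar>snd x - snd y\<bar> (L - \<bar>snd x - snd y\<bar>))\<^sup>2)"

definition pts_space :: "nat \<Rightarrow> (nat \<Rightarrow> real \<times> real) measure" where
  "pts_space n = PiM {..<n} (\<lambda>_. uniform_measure lborel (torus_box (side n)))"

definition Mdeg :: "nat \<Rightarrow> real \<Rightarrow> (nat \<Rightarrow> real \<times> real) \<Rightarrow> nat \<Rightarrow> nat" where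
  "Mdeg n r V i = card {j \<in> {..<n}. j \<noteq> i \<and> torus_dist (side n) (V i) (V j) \<le> r}"

definition Wd :: "nat \<Rightarrow> real \<Rightarrow> nat \<Rightarrow> (nat \<Rightarrow> real \<times> real) \<Rightarrow> nat" where
  "Wd n r d V = card {i \<in> {..<n}. Mdeg n r V i \<noteq> d}"

definition W_pmf :: "nat \<Rightarrow> real \<Rightarrow> nat \<Rightarrow> int \<Rightarrow> real" where
  "W_pmf n r d a = measure (pts_space n) {V \<in> space (pts_space n). int (Wd n r d V) = a}"

definition W_mean :: "nat \<Rightarrow> real \<Rightarrow> nat \<Rightarrow> real" where
  "W_mean n r d = (\<integral>V. real (Wd n r d V) \<partial>pts_space n)"

definition W_var :: "nat \<Rightarrow> real \<Rightarrow> nat \<Rightarrow> real" where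
  "W_var n r d = (\<integral>V. (real (Wd n r d V) - W_mean n r d)\<^sup>2 \<partial>pts_space n)"

text \<open>Translated Poisson TP(mu, sigma^2): Z - s ~ Po(sigma^2 + gamma),
  s = floor(mu - sigma^2), gamma = mu - sigma^2 - s.\<close>
definition TP_pmf :: "real \<Rightarrow> real \<Rightarrow> int \<Rightarrow> real" where
  "TP_pmf mu s2 a =
    (let s = \<lfloor>mu - s2\<rfloor>; \<gamma> = mu - s2 - of_int s; lam = s2 + \<gamma> in
     if a \<ge> s then exp (- lam) * lam ^ nat (a - s) / fact (nat (a - s)) else 0)"

definition d_TV :: "(int \<Rightarrow> real) \<Rightarrow> (int \<Rightarrow> real) \<Rightarrow> real" where
  "d_TV p q = (SUP A. \<bar>(\<Sum>\<^sub>\<infinity>a\<in>A. p a) - (\<Sum>\<^sub>\<infinity>a\<in>A. q a)\<bar>)"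

definition d_loc :: "(int \<Rightarrow> real) \<Rightarrow> (int \<Rightarrow> real) \<Rightarrow> real" where
  "d_loc p q = (SUP a. \<bar>p a - q a\<bar>)"

end

(*
The proof compares characteristic functions. Realise the hybrid configurations needed below as index
subsets of one i.i.d. family of 4n points. Resampling the points one by one writes Cov(W, e^{itW})
as a sum of n products of discrete derivatives, which are bounded because only boundedly many vertices
of degree d see a given point. Resampling a second time decorrelates each product from e^{itW}, since
second differences vanish unless two points are close, which has probability O(1/n). The upshot is
E[(W - mu) e^{itW}] = (e^{it} - 1) sigma^2 E e^{itW} up to an error O(n t^2 e^{-cnt^2}).

The Gaussian factor comes from flips: linearly many disjoint blocks contain d + 3 points arranged so
that moving one of them, without changing the law of the configuration, changes W by exactly one and
nothing else. Averaging over these moves produces |cos(t/2)| to the power of the number of such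
blocks, and that number is concentrated around its mean by bounded differences.

The characteristic function of the translated Poisson law solves the same equation without the error.
Integrating the quotient of the two functions bounds their difference; Fourier inversion gives the
local distance, even at rate 1/sigma^2 without the logarithm, and Bessel's inequality for the
difference and for its centred derivative gives the total variation distance.
*)
theory Submission
  imports Defs
begin

subsection \<open>Fourier series on the integers\<close>

text \<open>Dividing by the translated Poisson transform, exponentially small for t near pi, is
  harmless only if the error of the equation decays like a Gaussian on the whole period. Hence each
  error term is brought to the form E[H e^{itW}] with H unaffected by flips: W is counted over an
  index set E, H is built from differences of counts at a few indices outside E, and a block may be
  flipped only if all points in it, out of the whole family, have indices in E. The rare event that
  two points are close must contribute its factor 1/n in addition to the Gaussian factor. It depends
  on at most four points, and deleting these from the family raises the number of good blocks by at
  most four, so independence separates the two factors. The size 4n is made up of the n points, n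
  copies for the first resampling, and 2n copies of those 2n for the second. The lower bound on the
  variance requires no computation of moments: the Gaussian bound on the characteristic function at
  a single t of order n^(-1/2) forces it.\<close>

lemma one_plus_power_mult_exp_le:
  fixes x c :: real
  assumes "x \<ge> 0" "c > 0" "m > 0"
  shows "(1 + x) ^ m * exp (- (c * x)) \<le> (1 + real m / c) ^ m"
proof -
  \<comment> \<open>Each of the m factors absorbs the share \<open>exp (c * x / m)\<close> of the
    exponential.\<close>
  have "1 + x \<le> (1 + real m / c) * (1 + c * x / real m)"
    using assms by (simp add: field_simps)
  also have "\<dots> \<le> (1 + real m / c) * exp (c * x / real m)"
    using assms by (intro mult_left_mono exp_ge_add_one_self) auto
  finally have "(1 + x) ^ m \<le> ((1 + real m / c) * exp (c * x / real m)) ^ m"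
    using assms by (intro power_mono) auto
  also have "\<dots> = (1 + real m / c) ^ m * exp (c * x)"
    using assms by (simp add: power_mult_distrib exp_of_nat_mult [symmetric])
  finally show ?thesis
    by (simp add: exp_minus field_simps)
qed

lemma cmod_cis_minus_1: "cmod (cis t - 1) \<le> \<bar>t\<bar>"
  using iexp_approx1 [of t 0] by (simp add: cis_conv_exp mult.commute)

lemma cmod_cis_minus_linear: "cmod (cis t - 1 - \<i> * t) \<le> t\<^sup>2 / 2"
  using iexp_approx1 [of t 1] by (simp add: cis_conv_exp mult.commute power2_eq_square algebra_simps)

text \<open>For |x| \<le> 2 the third-order Taylor remainder is at most x^2/3, which lowers the
  coefficient 1/2 to 1/6.\<close>

lemma cos_le_one_minus_square:
  fixes x :: real
  assumes "\<bar>x\<bar> \<le> 2"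
  shows "cos x \<le> 1 - x\<^sup>2 / 6"
proof -
  have "cmod (iexp x - (\<Sum>k\<le>2. (\<i> * x) ^ k / fact k)) \<le> \<bar>x\<bar> ^ 3 / 6"
    using iexp_approx1 [of x 2] by (simp add: eval_nat_numeral)
  also have "(\<Sum>k\<le>2. (\<i> * x) ^ k / fact k) = 1 + \<i> * x - complex_of_real (x\<^sup>2 / 2)"
    by (simp add: eval_nat_numeral field_simps)
  finally have "\<bar>Re (iexp x - (1 + \<i> * x - complex_of_real (x\<^sup>2 / 2)))\<bar> \<le> \<bar>x\<bar> ^ 3 / 6"
    using abs_Re_le_cmod order_trans by blast
  then have "\<bar>cos x - (1 - x\<^sup>2 / 2)\<bar> \<le> \<bar>x\<bar> ^ 3 / 6"
    by (simp add: Re_exp)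
  moreover have "\<bar>x\<bar> ^ 3 \<le> 2 * x\<^sup>2"
  proof -
    have "\<bar>x\<bar> ^ 3 = \<bar>x\<bar> * x\<^sup>2" by (simp add: power3_eq_cube power2_eq_square)
    also have "\<dots> \<le> 2 * x\<^sup>2" by (intro mult_right_mono assms) auto
    finally show ?thesis .
  qed
  ultimately show ?thesis by linarith
qed

lemma cis_int_pi_cancel: "cis (real_of_int m * pi) = cis (- (real_of_int m * pi))"
proof -
  have "cis (real_of_int m * pi) = cis (- (real_of_int m * pi)) * cis (2 * pi * real_of_int m)"
    by (simp add: cis_mult algebra_simps)
  also have "cis (2 * pi * real_of_int m) = 1"
    by (simp add: cis_multiple_2pi)
  finally show ?thesis by simp
qed

lemma has_integral_cis_int:
  "((\<lambda>t. cis (real_of_int m * t)) has_integral (if m = 0 then 2 * pi else 0)) {-pi..pi}"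
proof (cases "m = 0")
  case True
  then show ?thesis
    using has_integral_const_real [of "1::complex" "-pi" pi] by (simp add: scaleR_conv_of_real)
next
  case False
  define F where "F = (\<lambda>t. cis (real_of_int m * t) / (\<i> * of_int m))"
  have "((\<lambda>t. cis (real_of_int m * t)) has_integral (F pi - F (-pi))) {-pi..pi}"
  proof (rule fundamental_theorem_of_calculus)
    fix t :: real
    have "((\<lambda>t. exp (\<i> * (of_int m * of_real t)) / (\<i> * of_int m)) has_vector_derivative
            exp (\<i> * (of_int m * of_real t))) (at t within {-pi..pi})"
      using False
      by (auto intro!: derivative_eq_intros has_vector_derivative_real_field
            simp: mult.commute mult.left_commute)
    then show "(F has_vector_derivative cis (real_of_int m * t)) (at t within {-pi..pi})"
      by (simp add: F_def cis_conv_exp)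
  qed simp
  moreover have "F pi = F (-pi)"
    using cis_int_pi_cancel [of m] by (simp add: F_def)
  ultimately show ?thesis using False by simp
qed

lemma uniform_limit_cis_series:
  fixes u :: "nat \<Rightarrow> real" and s :: int
  assumes "summable (\<lambda>k. \<bar>u k\<bar>)"
    and "\<And>t. (\<lambda>k. u k * cis (real_of_int (s + int k) * t)) sums f t"
  shows "uniform_limit {-pi..pi} (\<lambda>N t. \<Sum>k<N. u k * cis (real_of_int (s + int k) * t)) f sequentially"
proof -
  have "uniform_limit {-pi..pi} (\<lambda>N t. \<Sum>k<N. u k * cis (real_of_int (s + int k) * t))
     (\<lambda>t. \<Sum>k. u k * cis (real_of_int (s + int k) * t)) sequentially"
    by (rule Weierstrass_m_test [OF _ assms(1)]) (simp add: norm_mult)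
  then show ?thesis using assms(2) by (simp add: sums_iff)
qed

text \<open>Uniform convergence moves the integral inside the series, and orthogonality leaves one
  coefficient. The offset \<open>s\<close> lets the same statement serve a law on {0..n} and a
  translated Poisson law.\<close>

lemma has_integral_cis_series:
  fixes u :: "nat \<Rightarrow> real" and s b :: int
  assumes "summable (\<lambda>k. \<bar>u k\<bar>)"
    and f: "\<And>t. (\<lambda>k. u k * cis (real_of_int (s + int k) * t)) sums f t"
  shows "continuous_on {-pi..pi} f"
    and "((\<lambda>t. f t * cis (- (real_of_int b * t))) has_integral
           (2 * pi * (if b \<ge> s then u (nat (b - s)) else 0))) {-pi..pi}"
proof -
  note ul = uniform_limit_cis_series [OF assms]
  show "continuous_on {-pi..pi} f"
    by (rule uniform_limit_theorem [OF _ ul])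
       (auto intro!: always_eventually continuous_intros)
  define g where "g = (\<lambda>N t. (\<Sum>k<N. u k * cis (real_of_int (s + int k) * t)) * cis (- (real_of_int b * t)))"
  have ul2: "uniform_limit {-pi..pi} g (\<lambda>t. f t * cis (- (real_of_int b * t))) sequentially"
    unfolding g_def
  proof (rule uniform_lim_mult [OF ul uniform_limit_const])
    show "bounded (f ` {-pi..pi})"
      using \<open>continuous_on {-pi..pi} f\<close> by (intro compact_imp_bounded compact_continuous_image) auto
    show "bounded ((\<lambda>t. cis (- (real_of_int b * t))) ` {-pi..pi})"
      by (auto simp: bounded_iff)
  qed
  obtain I J where IJ: "\<And>N. (g N has_integral I N) {-pi..pi}"
     "((\<lambda>t. f t * cis (- (real_of_int b * t))) has_integral J) {-pi..pi}" "I \<longlonglongrightarrow> J"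
    by (rule uniform_limit_integral [OF ul2]) (auto simp: g_def intro!: continuous_intros)
  have gN: "(g N has_integral (\<Sum>k<N. u k * (if s + int k - b = 0 then 2 * pi else 0))) {-pi..pi}" for N
  proof -
    have "g N = (\<lambda>t. \<Sum>k<N. u k * cis (real_of_int (s + int k - b) * t))"
      unfolding g_def sum_distrib_right mult.assoc cis_mult
      by (intro ext sum.cong refl) (simp add: algebra_simps)
    moreover have "((\<lambda>t. of_real (u k) * cis (real_of_int (s + int k - b) * t)) has_integral
        of_real (u k) * complex_of_real (if s + int k - b = 0 then 2 * pi else 0)) {-pi..pi}" for k
      by (rule has_integral_mult_right) (use has_integral_cis_int [of "s + int k - b"] in \<open>simp\<close>)
    ultimately show ?thesis
      by (auto intro!: has_integral_sum)
  qed
  have IN: "I N = (\<Sum>k<N. u k * (if s + int k - b = 0 then 2 * pi else 0))" for N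
    using has_integral_unique [OF IJ(1) gN] by simp
  define R where "R = 2 * pi * (if b \<ge> s then u (nat (b - s)) else 0)"
  have "I N = R" if "N > nat (b - s)" for N
  proof (cases "b \<ge> s")
    case True
    have "(\<Sum>k<N. u k * (if s + int k - b = 0 then 2 * pi else 0))
        = (\<Sum>k<N. if k = nat (b - s) then 2 * pi * u k else 0)"
      using True by (intro sum.cong) auto
    then show ?thesis using True that by (simp add: IN R_def)
  next
    case False
    then show ?thesis by (auto simp: IN R_def)
  qed
  then have "I \<longlonglongrightarrow> R"
    by (intro tendsto_eventually) (auto simp: eventually_sequentially intro!: exI [of _ "Suc (nat (b - s))"])
  then have "J = R" using IJ(3) LIMSEQ_unique by blast
  then show "((\<lambda>t. f t * cis (- (real_of_int b * t))) has_integral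
           (2 * pi * (if b \<ge> s then u (nat (b - s)) else 0))) {-pi..pi}"
    using IJ(2) by (simp add: R_def)
qed

text \<open>Expand the integral of |f - P|^2 \<ge> 0, with P the partial Fourier sum over F: the
  cross term and the square of P both integrate to 2 pi times the sum of the squared
  coefficients.\<close>

lemma bessel_inequality:
  fixes f :: "real \<Rightarrow> complex" and c :: "int \<Rightarrow> real"
  assumes cont: "continuous_on {-pi..pi} f" and "finite F"
    and coeff: "\<And>a. a \<in> F \<Longrightarrow> ((\<lambda>t. f t * cis (- (real_of_int a * t))) has_integral
                    complex_of_real (2 * pi * c a)) {-pi..pi}"
  shows "2 * pi * (\<Sum>a\<in>F. (c a)\<^sup>2) \<le> integral {-pi..pi} (\<lambda>t. (cmod (f t))\<^sup>2)"
proof -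
  define P where "P = (\<lambda>t. \<Sum>a\<in>F. c a * cis (real_of_int a * t))"
  have contP: "continuous_on {-pi..pi} P"
    unfolding P_def by (auto intro!: continuous_intros)
  have fP: "((\<lambda>t. f t * cnj (P t)) has_integral of_real (2 * pi * (\<Sum>a\<in>F. (c a)\<^sup>2))) {-pi..pi}"
  proof -
    have "((\<lambda>t. \<Sum>a\<in>F. c a * (f t * cis (- (real_of_int a * t)))) has_integral
        (\<Sum>a\<in>F. c a * complex_of_real (2 * pi * c a))) {-pi..pi}"
      by (intro has_integral_sum has_integral_mult_right coeff \<open>finite F\<close>)
    moreover have "(\<lambda>t. \<Sum>a\<in>F. c a * (f t * cis (- (real_of_int a * t)))) = (\<lambda>t. f t * cnj (P t))"
      by (auto simp: P_def sum_distrib_left cis_cnj algebra_simps)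
    moreover have "(\<Sum>a\<in>F. c a * complex_of_real (2 * pi * c a)) = of_real (2 * pi * (\<Sum>a\<in>F. (c a)\<^sup>2))"
      by (simp add: sum_distrib_left power2_eq_square algebra_simps)
    ultimately show ?thesis by simp
  qed
  have PP: "((\<lambda>t. P t * cnj (P t)) has_integral of_real (2 * pi * (\<Sum>a\<in>F. (c a)\<^sup>2))) {-pi..pi}"
  proof -
    have *: "((\<lambda>t. P t * cis (- (real_of_int a * t))) has_integral (2 * pi * c a)) {-pi..pi}"
      if "a \<in> F" for a
    proof -
      have "((\<lambda>t. \<Sum>a'\<in>F. c a' * cis (real_of_int (a' - a) * t)) has_integral
          (\<Sum>a'\<in>F. c a' * complex_of_real (if a' - a = 0 then 2 * pi else 0))) {-pi..pi}"
        by (intro has_integral_sum has_integral_mult_right has_integral_cis_int \<open>finite F\<close>)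
      moreover have "(\<Sum>a'\<in>F. c a' * complex_of_real (if a' - a = 0 then 2 * pi else 0)) = 
          (\<Sum>a'\<in>F. if a' = a then complex_of_real (2 * pi * c a') else 0)"
        by (intro sum.cong) auto
      moreover have "(\<lambda>t. \<Sum>a'\<in>F. c a' * cis (real_of_int (a' - a) * t)) = (\<lambda>t. P t * cis (- (real_of_int a * t)))"
        unfolding P_def sum_distrib_right mult.assoc cis_mult
        by (intro ext sum.cong refl) (simp add: algebra_simps)
      ultimately show ?thesis using that \<open>finite F\<close> by simp
    qed
    have "((\<lambda>t. \<Sum>a\<in>F. c a * (P t * cis (- (real_of_int a * t)))) has_integral
        (\<Sum>a\<in>F. c a * complex_of_real (2 * pi * c a))) {-pi..pi}"
      by (intro has_integral_sum has_integral_mult_right * \<open>finite F\<close>)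
    moreover have "(\<lambda>t. \<Sum>a\<in>F. c a * (P t * cis (- (real_of_int a * t)))) = (\<lambda>t. P t * cnj (P t))"
      by (auto simp: P_def sum_distrib_left cis_cnj algebra_simps)
    moreover have "(\<Sum>a\<in>F. c a * complex_of_real (2 * pi * c a)) = of_real (2 * pi * (\<Sum>a\<in>F. (c a)\<^sup>2))"
      by (simp add: sum_distrib_left power2_eq_square algebra_simps)
    ultimately show ?thesis by simp
  qed
  have ff: "((\<lambda>t. (cmod (f t))\<^sup>2) has_integral (integral {-pi..pi} (\<lambda>t. (cmod (f t))\<^sup>2))) {-pi..pi}"
    by (intro integrable_integral integrable_continuous_real continuous_intros cont)
  let ?S = "\<Sum>a\<in>F. (c a)\<^sup>2"
  have "((\<lambda>t. (cmod (f t))\<^sup>2 - 2 * Re (f t * cnj (P t)) + Re (P t * cnj (P t))) has_integral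
      (integral {-pi..pi} (\<lambda>t. (cmod (f t))\<^sup>2) - 2 * (2 * pi * ?S) + 2 * pi * ?S)) {-pi..pi}"
    by (intro has_integral_add has_integral_diff has_integral_mult_right ff
          has_integral_Re [OF fP, unfolded Re_complex_of_real]
          has_integral_Re [OF PP, unfolded Re_complex_of_real])
  moreover have "(cmod (f t))\<^sup>2 - 2 * Re (f t * cnj (P t)) + Re (P t * cnj (P t)) \<ge> 0" for t
  proof -
    have "(cmod (f t))\<^sup>2 - 2 * Re (f t * cnj (P t)) + Re (P t * cnj (P t)) = (cmod (f t - P t))\<^sup>2"
      unfolding cmod_power2 by (simp add: power2_eq_square algebra_simps)
    then show ?thesis by simp
  qed
  ultimately have "integral {-pi..pi} (\<lambda>t. (cmod (f t))\<^sup>2) - 2 * (2 * pi * ?S) + 2 * pi * ?S \<ge> 0"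
    by (rule has_integral_nonneg)
  then show ?thesis by simp
qed

text \<open>1/x^2 \<le> 1/(x - 1/2) - 1/(x + 1/2) for x \<ge> 1, and the right-hand side
  telescopes.\<close>

lemma sum_inverse_squares_le:
  fixes v :: real
  assumes "v \<ge> 1"
  shows "(\<Sum>k<M. 1 / (v + real k)\<^sup>2) \<le> 2 / v"
proof -
  have "(\<Sum>k<M. 1 / (v + real k)\<^sup>2) \<le> 1 / (v - 1/2) - 1 / (v + real M - 1/2)"
  proof (induction M)
    case (Suc M)
    define x where "x = v + real M"
    have x: "x \<ge> 1" using assms by (simp add: x_def)
    have "1 / x\<^sup>2 \<le> 1 / (x\<^sup>2 - 1/4)"
      using one_le_power [OF x, of 2] by (intro divide_left_mono mult_pos_pos) auto
    also have "\<dots> = 1 / (x - 1/2) - 1 / (x + 1/2)"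
    proof -
      have "x\<^sup>2 - 1/4 = (x - 1/2) * (x + 1/2)"
        by (simp add: power2_eq_square algebra_simps)
      then show ?thesis using x by (simp add: diff_frac_eq)
    qed
    finally show ?case using Suc by (simp add: x_def algebra_simps)
  qed simp
  also have "\<dots> \<le> 1 / (v - 1/2)" using assms by simp
  also have "\<dots> \<le> 2 / v" using assms by (simp add: field_simps)
  finally show ?thesis .
qed

text \<open>Lattice analogue of the integral of 1/(v^2 + x^2), uniform in the centre m. Cutting the
  integers at the ceiling of m gives two rays whose k-th points are at distance at least k from m;
  each ray contributes 4/v.\<close>

lemma sum_lattice_cauchy_weight_le:
  fixes v m :: real and F :: "int set"
  assumes "v \<ge> 1" "finite F"
  shows "(\<Sum>a\<in>F. 1 / (v\<^sup>2 + (of_int a - m)\<^sup>2)) \<le> 8 / v"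
proof -
  define c where "c = \<lceil>m\<rceil>"
  define g where "g = (\<lambda>a::int. 1 / (v\<^sup>2 + (of_int a - m)\<^sup>2))"
  have g0: "g a \<ge> 0" for a by (simp add: g_def)
  have sq: "1 / (v\<^sup>2 + y\<^sup>2) \<le> 2 * (1 / (v + real k)\<^sup>2)" if "\<bar>y\<bar> \<ge> real k" for y k
  proof -
    have "(v + real k)\<^sup>2 \<le> (v + \<bar>y\<bar>)\<^sup>2" using that assms by (intro power_mono) auto
    also have "\<dots> \<le> 2 * (v\<^sup>2 + y\<^sup>2)"
      using sum_squares_bound [of v "\<bar>y\<bar>"] by (simp add: power2_sum)
    finally have *: "(v + real k)\<^sup>2 \<le> 2 * (v\<^sup>2 + y\<^sup>2)" .
    have "v + real k > 0" using assms by simp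
    then have "(v + real k)\<^sup>2 > 0" "v\<^sup>2 + y\<^sup>2 > 0" using * assms by (auto intro: add_pos_nonneg)
    with * show ?thesis by (simp add: field_simps)
  qed
  define M where "M = (\<Sum>a\<in>F. nat \<bar>a - c\<bar>) + 1"
  have sub: "F \<subseteq> (\<lambda>k. c + int k) ` {..<M} \<union> (\<lambda>k. c - 1 - int k) ` {..<M}"
  proof
    fix a assume a: "a \<in> F"
    have "nat \<bar>a - c\<bar> \<le> (\<Sum>a\<in>F. nat \<bar>a - c\<bar>)"
      by (rule member_le_sum) (use a assms in auto)
    then have lt: "nat \<bar>a - c\<bar> < M" by (simp add: M_def)
    show "a \<in> (\<lambda>k. c + int k) ` {..<M} \<union> (\<lambda>k. c - 1 - int k) ` {..<M}"
    proof (cases "a \<ge> c")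
      case True
      then show ?thesis using lt by (intro UnI1 image_eqI [of _ _ "nat (a - c)"]) auto
    next
      case False
      then show ?thesis using lt by (intro UnI2 image_eqI [of _ _ "nat (c - 1 - a)"]) auto
    qed
  qed
  have "sum g F \<le> sum g ((\<lambda>k. c + int k) ` {..<M} \<union> (\<lambda>k. c - 1 - int k) ` {..<M})"
    by (rule sum_mono2 [OF _ sub]) (use g0 in auto)
  also have "\<dots> \<le> sum g ((\<lambda>k. c + int k) ` {..<M}) + sum g ((\<lambda>k. c - 1 - int k) ` {..<M})"
    using sum_nonneg [of "(\<lambda>k. c + int k) ` {..<M} \<inter> (\<lambda>k. c - 1 - int k) ` {..<M}" g] g0
    by (subst sum_Un) auto
  also have "\<dots> = (\<Sum>k<M. g (c + int k)) + (\<Sum>k<M. g (c - 1 - int k))"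
    by (simp add: sum.reindex inj_on_def)
  also have "\<dots> \<le> (\<Sum>k<M. 2 * (1 / (v + real k)\<^sup>2)) + (\<Sum>k<M. 2 * (1 / (v + real k)\<^sup>2))"
    unfolding g_def
  proof (intro add_mono sum_mono sq)
    fix k
    have c: "of_int c \<ge> m" "of_int c < m + 1" unfolding c_def by linarith+
    show "\<bar>real_of_int (c + int k) - m\<bar> \<ge> real k" using c by simp
    show "\<bar>real_of_int (c - 1 - int k) - m\<bar> \<ge> real k" using c by simp
  qed
  also have "\<dots> \<le> 8 / v"
    using sum_inverse_squares_le [OF assms(1), of M] unfolding sum_distrib_left [symmetric] by simp
  finally show ?thesis by (simp add: g_def)
qed

subsection \<open>Comparison with the translated Poisson law\<close>

text \<open>Interface between the probabilistic and the Fourier part. Both estimates are required on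
  all of [-pi, pi], because inversion on the integers integrates over the full period; c and K are
  kept apart from n so that the conclusions are uniform in n.\<close>

locale tp_comparison =
  fixes p :: "int \<Rightarrow> real" and n :: nat and \<mu> \<sigma>2 c K :: real
  assumes n: "n \<ge> 1" and c: "c > 0" and K: "K \<ge> 1"
    and supp: "\<And>a. a \<notin> {0..int n} \<Longrightarrow> p a = 0"
    and p_sum: "(\<Sum>a\<in>{0..int n}. p a) = 1"
    and var_lower: "c * n \<le> \<sigma>2" and var_upper: "\<sigma>2 \<le> K * n"
    and cf_bound: "\<And>t. \<bar>t\<bar> \<le> pi \<Longrightarrow>
        cmod (\<Sum>a\<in>{0..int n}. p a * cis (of_int a * t)) \<le> K * exp (- (c * n * t\<^sup>2))"
    and ode: "\<And>t. \<bar>t\<bar> \<le> pi \<Longrightarrow>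
        cmod ((\<Sum>a\<in>{0..int n}. (of_int a - \<mu>) * p a * cis (of_int a * t))
           - (cis t - 1) * \<sigma>2 * (\<Sum>a\<in>{0..int n}. p a * cis (of_int a * t)))
          \<le> K * n * t\<^sup>2 * exp (- (c * n * t\<^sup>2))"
begin

definition "offs = \<lfloor>\<mu> - \<sigma>2\<rfloor>"
text \<open>Equal to \<sigma>2 + \<gamma>, since \<gamma> = \<mu> - \<sigma>2 - offs. The translated
  law thus has mean exactly \<mu>, and its variance \<open>lam\<close> exceeds \<sigma>2 by less
  than 1.\<close>

definition "lam = \<mu> - of_int offs"
definition "pois k = exp (- lam) * lam ^ k / fact k"
definition "\<phi> t = (\<Sum>a\<in>{0..int n}. p a * cis (of_int a * t))"
text \<open>The centred derivative: up to the factor \<i>, this is \<phi>' - \<i> \<mu>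
  \<phi>.\<close>

definition "\<phi>D t = (\<Sum>a\<in>{0..int n}. (of_int a - \<mu>) * p a * cis (of_int a * t))"
definition "\<psi> t = cis (of_int offs * t) * exp (lam * (cis t - 1))"

lemma lam_bounds: "\<sigma>2 \<le> lam" "lam < \<sigma>2 + 1" "0 < lam" "c * n \<le> lam"
proof -
  show "\<sigma>2 \<le> lam" "lam < \<sigma>2 + 1" unfolding lam_def offs_def by linarith+
  have "0 < c * n" using c n by simp
  then show "0 < lam" "c * n \<le> lam" using var_lower \<open>\<sigma>2 \<le> lam\<close> by linarith+
qed

lemma TP_pmf_eq: "TP_pmf \<mu> \<sigma>2 a = (if a \<ge> offs then pois (nat (a - offs)) else 0)"
  by (simp add: TP_pmf_def Let_def offs_def lam_def pois_def)

lemma pois_nonneg: "pois k \<ge> 0"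
  using lam_bounds by (simp add: pois_def)

lemma pois_Suc: "real (Suc k) * pois (Suc k) = lam * pois k"
  by (simp add: pois_def field_simps del: of_nat_Suc)

lemma pois_sums: "pois sums 1"
proof -
  have "(\<lambda>k. lam ^ k /\<^sub>R fact k) sums exp lam" by (rule exp_converges)
  then have "(\<lambda>k. exp (- lam) * (lam ^ k /\<^sub>R fact k)) sums (exp (- lam) * exp lam)" by (rule sums_mult)
  then show ?thesis by (simp add: pois_def [abs_def] exp_minus field_simps)
qed

lemma pois_cis_sums: "(\<lambda>k. pois k * cis (real_of_int (offs + int k) * t)) sums \<psi> t"
proof -
  have "(\<lambda>k. (lam * cis t) ^ k /\<^sub>R fact k) sums exp (lam * cis t)" by (rule exp_converges)
  then have "(\<lambda>k. exp (- lam) * cis (of_int offs * t) * ((lam * cis t) ^ k /\<^sub>R fact k))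
      sums (exp (- lam) * cis (of_int offs * t) * exp (lam * cis t))" by (rule sums_mult)
  moreover have "exp (- complex_of_real lam) * cis (of_int offs * t) * exp (lam * cis t) = \<psi> t"
    by (simp add: \<psi>_def algebra_simps flip: exp_add)
  moreover have "(exp (- lam) * cis (of_int offs * t) * ((lam * cis t) ^ k /\<^sub>R fact k))
      = pois k * cis (real_of_int (offs + int k) * t)" for k
    by (simp add: pois_def power_mult_distrib Complex.DeMoivre scaleR_conv_of_real cis_mult [symmetric]
          exp_of_real [symmetric] distrib_right divide_inverse)
  ultimately show ?thesis by (simp flip: exp_of_real)
qed

text \<open>The recursion k pois(k) = lam pois(k - 1) on the Fourier side: shifting the index gives
  lam cis(t) \<psi>, and subtracting lam \<psi> centres it because offs + k - \<mu> = k - lam. So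
  \<psi> solves the equation without error.\<close>

lemma pois_cis_centred_sums:
  "(\<lambda>k. (real_of_int (offs + int k) - \<mu>) * pois k * cis (real_of_int (offs + int k) * t))
     sums (lam * (cis t - 1) * \<psi> t)"
proof -
  let ?e = "\<lambda>k. cis (real_of_int (offs + int k) * t)"
  have "(\<lambda>k. lam * cis t * (pois k * ?e k)) sums (lam * cis t * \<psi> t)"
    by (rule sums_mult [OF pois_cis_sums])
  also have "(\<lambda>k. lam * cis t * (pois k * ?e k)) = (\<lambda>k. real (Suc k) * pois (Suc k) * ?e (Suc k))"
  proof
    fix k
    have "?e (Suc k) = cis t * ?e k" by (simp add: cis_mult algebra_simps)
    then show "lam * cis t * (pois k * ?e k) = real (Suc k) * pois (Suc k) * ?e (Suc k)"
      using arg_cong [OF pois_Suc [of k], of complex_of_real] by simp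
  qed
  finally have "(\<lambda>k. real k * pois k * ?e k) sums (lam * cis t * \<psi> t)"
    by (subst (asm) sums_Suc_iff) simp
  from sums_diff [OF this sums_mult [OF pois_cis_sums, of lam t]]
  show ?thesis by (simp add: lam_def algebra_simps)
qed

lemma summable_pois: "summable (\<lambda>k. \<bar>pois k\<bar>)"
  using pois_sums pois_nonneg by (simp add: sums_iff)

lemma summable_pois_centred: "summable (\<lambda>k. \<bar>(real_of_int (offs + int k) - \<mu>) * pois k\<bar>)"
proof -
  have "summable (\<lambda>k. lam * pois k)" using pois_sums by (simp add: sums_iff summable_mult)
  then have "summable (\<lambda>k. real (Suc k) * pois (Suc k))" by (simp only: pois_Suc)
  then have *: "summable (\<lambda>k. real k * pois k)" by (subst (asm) summable_Suc_iff)
  have "summable (\<lambda>k. real k * pois k + lam * pois k)"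
    using * pois_sums by (intro summable_add summable_mult) (auto simp: sums_iff)
  then show ?thesis
  proof (rule summable_comparison_test' [where N = 0])
    fix k
    have "\<bar>real_of_int (offs + int k) - \<mu>\<bar> \<le> real k + lam"
      using lam_bounds by (simp add: lam_def)
    from mult_right_mono [OF this pois_nonneg [of k]]
    have "\<bar>real_of_int (offs + int k) - \<mu>\<bar> * \<bar>pois k\<bar> \<le> (real k + lam) * pois k"
      using pois_nonneg [of k] by simp
    then show "norm \<bar>(real_of_int (offs + int k) - \<mu>) * pois k\<bar> \<le> real k * pois k + lam * pois k"
      unfolding real_norm_def abs_idempotent abs_mult distrib_right .
  qed
qed

section \<open>Differences of the transforms and their Fourier coefficients\<close>

definition "\<delta> t = \<phi> t - \<psi> t"
definition "\<eta> t = \<phi>D t - lam * (cis t - 1) * \<psi> t"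

lemma finite_cis_sums:
  fixes u :: "int \<Rightarrow> real"
  assumes "\<And>a. a \<notin> {0..int n} \<Longrightarrow> u a = 0"
  shows "(\<lambda>k. u (int k) * cis (real_of_int (0 + int k) * t)) sums
          (\<Sum>a\<in>{0..int n}. u a * cis (of_int a * t))"
proof -
  have "(\<lambda>k. u (int k) * cis (real_of_int (0 + int k) * t)) sums
          (\<Sum>k\<in>{0..n}. u (int k) * cis (real_of_int (0 + int k) * t))"
    by (rule sums_finite) (use assms in auto)
  also have "(\<Sum>k\<in>{0..n}. u (int k) * cis (real_of_int (0 + int k) * t)) =
      (\<Sum>a\<in>int ` {0..n}. u a * cis (of_int a * t))"
    by (subst sum.reindex) auto
  also have "int ` {0..n} = {0..int n}"
    using image_int_atLeastAtMost [of 0 n] by simp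
  finally show ?thesis .
qed

lemma summable_finite_abs:
  fixes u :: "int \<Rightarrow> real"
  assumes "\<And>a. a \<notin> {0..int n} \<Longrightarrow> u a = 0"
  shows "summable (\<lambda>k. \<bar>u (int k)\<bar>)"
  by (rule summable_finite [of "{0..n}"]) (use assms in auto)

lemma chi_coeff:
  "continuous_on {-pi..pi} \<delta>"
  "((\<lambda>t. \<delta> t * cis (- (real_of_int a * t))) has_integral
      complex_of_real (2 * pi * (p a - TP_pmf \<mu> \<sigma>2 a))) {-pi..pi}"
proof -
  have sums1: "(\<lambda>k. complex_of_real (p (int k)) * cis (real_of_int (0 + int k) * t)) sums \<phi> t" for t
    unfolding \<phi>_def by (rule finite_cis_sums [OF supp])
  note 1 = has_integral_cis_series [OF summable_finite_abs sums1, OF supp]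
  note 2 = has_integral_cis_series [OF summable_pois pois_cis_sums]
  show "continuous_on {-pi..pi} \<delta>" unfolding \<delta>_def
    by (intro continuous_intros 1(1) 2(1)) auto
  have 3: "(if a \<ge> 0 then p (int (nat (a - 0))) else 0) = p a" using supp [of a] by auto
  have "((\<lambda>t. \<phi> t * cis (- (real_of_int a * t)) - \<psi> t * cis (- (real_of_int a * t))) has_integral
     (complex_of_real (2 * pi * p a) - complex_of_real (2 * pi * TP_pmf \<mu> \<sigma>2 a))) {-pi..pi}"
    using 1(2) [of a] 2(2) [of a] 3 unfolding TP_pmf_eq
    by (intro has_integral_diff) (auto split: if_splits)
  then show "((\<lambda>t. \<delta> t * cis (- (real_of_int a * t))) has_integral
      complex_of_real (2 * pi * (p a - TP_pmf \<mu> \<sigma>2 a))) {-pi..pi}"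
    by (simp add: \<delta>_def algebra_simps)
qed

text \<open>The weight a - \<mu> on the coefficients is what turns Bessel's inequality for \<eta>
  into a second-moment bound on the difference of the two laws.\<close>

lemma eta_coeff:
  "continuous_on {-pi..pi} \<eta>"
  "((\<lambda>t. \<eta> t * cis (- (real_of_int a * t))) has_integral
      complex_of_real (2 * pi * ((of_int a - \<mu>) * (p a - TP_pmf \<mu> \<sigma>2 a)))) {-pi..pi}"
proof -
  have sup': "\<And>a. a \<notin> {0..int n} \<Longrightarrow> (of_int a - \<mu>) * p a = 0" using supp by auto
  have sums1: "(\<lambda>k. complex_of_real ((of_int (int k) - \<mu>) * p (int k)) * cis (real_of_int (0 + int k) * t)) sums \<phi>D t" for t
    using finite_cis_sums [of "\<lambda>a. (of_int a - \<mu>) * p a" t] sup' by (simp add: \<phi>D_def)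
  have sums2: "(\<lambda>k. complex_of_real ((real_of_int (offs + int k) - \<mu>) * pois k) * cis (real_of_int (offs + int k) * t))
     sums (lam * (cis t - 1) * \<psi> t)" for t
    using pois_cis_centred_sums [of t] by simp
  note 1 = has_integral_cis_series [OF summable_finite_abs sums1, OF sup']
  note 2 = has_integral_cis_series [OF summable_pois_centred sums2]
  show "continuous_on {-pi..pi} \<eta>" unfolding \<eta>_def
    by (intro continuous_intros 1(1) 2(1)) auto
  have 3: "complex_of_real (2 * pi * ((of_int a - \<mu>) * p a)) = 2 * pi *
      (if a \<ge> 0 then ((of_int (int (nat (a - 0))) - \<mu>) * p (int (nat (a - 0)))) else 0)" using supp [of a] by auto
  have 4: "complex_of_real (2 * pi * ((of_int a - \<mu>) * TP_pmf \<mu> \<sigma>2 a)) = 2 * pi *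
      (if a \<ge> offs then ((real_of_int (offs + int (nat (a - offs))) - \<mu>) * pois (nat (a - offs))) else 0)"
    by (auto simp: TP_pmf_eq)
  have "((\<lambda>t. \<phi>D t * cis (- (real_of_int a * t)) - lam * (cis t - 1) * \<psi> t * cis (- (real_of_int a * t))) has_integral
     (complex_of_real (2 * pi * ((of_int a - \<mu>) * p a)) -
      complex_of_real (2 * pi * ((of_int a - \<mu>) * TP_pmf \<mu> \<sigma>2 a)))) {-pi..pi}"
    unfolding 3 4 by (intro has_integral_diff 1(2) 2(2))
  then show "((\<lambda>t. \<eta> t * cis (- (real_of_int a * t))) has_integral
      complex_of_real (2 * pi * ((of_int a - \<mu>) * (p a - TP_pmf \<mu> \<sigma>2 a)))) {-pi..pi}"
    by (simp add: \<eta>_def algebra_simps)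
qed

lemma cmod_psi: "cmod (\<psi> t) = exp (- (lam * (1 - cos t)))"
  by (simp add: \<psi>_def norm_mult algebra_simps)

lemma psi_nz: "\<psi> t \<noteq> 0"
  by (simp add: \<psi>_def)

lemma psi_deriv: "(\<psi> has_vector_derivative \<i> * (\<mu> + lam * (cis t - 1)) * \<psi> t) (at t within S)"
proof -
  have "((\<lambda>t. exp (\<i> * (of_int offs * of_real t)) * exp (lam * (exp (\<i> * of_real t) - 1))) has_vector_derivative
     \<i> * (\<mu> + lam * (cis t - 1)) * \<psi> t) (at t within S)"
    by (auto intro!: derivative_eq_intros has_vector_derivative_real_field
        simp: \<psi>_def lam_def cis_conv_exp algebra_simps)
  then show ?thesis by (simp add: \<psi>_def [abs_def] cis_conv_exp)
qed

lemma phi_deriv: "(\<phi> has_vector_derivative \<i> * (\<mu> * \<phi> t + \<phi>D t)) (at t within S)"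
proof -
  have "((\<lambda>t. \<Sum>a\<in>{0..int n}. p a * exp (\<i> * (of_int a * of_real t))) has_vector_derivative
     (\<Sum>a\<in>{0..int n}. p a * (\<i> * of_int a * exp (\<i> * (of_int a * of_real t))))) (at t within S)"
    by (auto intro!: derivative_eq_intros has_vector_derivative_real_field has_vector_derivative_sum)
  also have "(\<Sum>a\<in>{0..int n}. p a * (\<i> * of_int a * exp (\<i> * (of_int a * of_real t))))
     = \<i> * (\<mu> * \<phi> t + \<phi>D t)"
    by (simp add: \<phi>_def \<phi>D_def sum_distrib_left cis_conv_exp algebra_simps flip: sum.distrib)
  finally show ?thesis by (simp add: \<phi>_def [abs_def] cis_conv_exp)
qed

text \<open>The defect of \<phi> in the equation solved by \<psi>; it is formed with
  \<open>lam\<close>, whereas the hypothesis \<open>ode\<close> speaks of \<sigma>2.\<close>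

definition "err t = \<phi>D t - lam * (cis t - 1) * \<phi> t"

lemma err_bound:
  fixes t :: real
  assumes "\<bar>t\<bar> \<le> pi"
  shows "cmod (err t) \<le> K * (n * t\<^sup>2 + \<bar>t\<bar>) * exp (- (c * n * t\<^sup>2))"
proof -
  \<comment> \<open>Passing from \<sigma>2 to \<open>lam\<close> costs at most 1 times |t| |\<phi>|;
    this is where the summand |t| beside n t^2 comes from.\<close>
  have "err t = (\<phi>D t - (cis t - 1) * \<sigma>2 * \<phi> t) - (lam - \<sigma>2) * (cis t - 1) * \<phi> t"
    by (simp add: err_def algebra_simps)
  also have "cmod \<dots> \<le> K * n * t\<^sup>2 * exp (- (c * n * t\<^sup>2)) + 1 * \<bar>t\<bar> * (K * exp (- (c * n * t\<^sup>2)))"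
  proof (rule order_trans [OF norm_triangle_ineq4], rule add_mono)
    show "cmod (\<phi>D t - (cis t - 1) * \<sigma>2 * \<phi> t) \<le> K * n * t\<^sup>2 * exp (- (c * n * t\<^sup>2))"
      using ode [OF assms] by (simp add: \<phi>D_def \<phi>_def)
    have "cmod (complex_of_real lam - complex_of_real \<sigma>2) \<le> 1"
      using lam_bounds by (simp flip: of_real_diff)
    then show "cmod ((lam - \<sigma>2) * (cis t - 1) * \<phi> t) \<le> 1 * \<bar>t\<bar> * (K * exp (- (c * n * t\<^sup>2)))"
      using cf_bound [OF assms] cmod_cis_minus_1 [of t] unfolding norm_mult
      by (intro mult_mono) (auto simp: \<phi>_def)
  qed
  finally show ?thesis by (simp add: algebra_simps)
qed

text \<open>\<psi> acts as an integrating factor: the drift \<mu> + lam (cis t - 1) is common to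
  both derivatives and cancels, so only the defect survives.\<close>

lemma ratio_deriv: "((\<lambda>t. \<phi> t / \<psi> t) has_vector_derivative \<i> * err t / \<psi> t) (at t within S)"
proof -
  have "((inverse \<circ> \<psi>) has_vector_derivative
      (\<i> * (\<mu> + lam * (cis t - 1)) * \<psi> t) * (- (inverse (\<psi> t) ^ Suc (Suc 0)))) (at t within S)"
    by (rule field_vector_diff_chain_within [OF psi_deriv DERIV_inverse [OF psi_nz]])
  from has_vector_derivative_mult [OF phi_deriv this]
  have "((\<lambda>t. \<phi> t / \<psi> t) has_vector_derivative
      \<phi> t * ((\<i> * (\<mu> + lam * (cis t - 1)) * \<psi> t) * (- (inverse (\<psi> t) ^ Suc (Suc 0))))
      + \<i> * (\<mu> * \<phi> t + \<phi>D t) * inverse (\<psi> t)) (at t within S)"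
    by (simp only: o_def divide_inverse)
  moreover have "\<phi> t * ((\<i> * (\<mu> + lam * (cis t - 1)) * \<psi> t) * (- (inverse (\<psi> t) ^ Suc (Suc 0))))
      + \<i> * (\<mu> * \<phi> t + \<phi>D t) * inverse (\<psi> t) = \<i> * err t / \<psi> t"
    using psi_nz [of t] by (simp add: err_def field_simps)
  ultimately show ?thesis by simp
qed

lemma half_angle_gap:
  fixes s t :: real
  assumes "\<bar>s\<bar> \<le> \<bar>t\<bar> / 2" "\<bar>t\<bar> \<le> pi"
  shows "cos s - cos t \<ge> t\<^sup>2 / 32"
proof -
  define u where "u = \<bar>t\<bar> / 2"
  have u: "0 \<le> u" "u \<le> pi / 2" "\<bar>s\<bar> \<le> u" using assms by (auto simp: u_def)
  have "cos \<bar>s\<bar> \<ge> cos u" using u by (intro cos_monotone_0_pi_le) auto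
  \<comment> \<open>With t = 2u up to sign, the double angle formula factorises the gap. The factor
    1 + 2 cos u is at least 1 because u \<le> pi/2.\<close>
  moreover have "cos u - cos t = (1 - cos u) * (1 + 2 * cos u)"
  proof -
    have "cos t = 2 * (cos u)\<^sup>2 - 1" using cos_double_cos [of u] by (simp add: u_def)
    then show ?thesis by (simp add: power2_eq_square algebra_simps)
  qed
  moreover have "cos u \<ge> 0" using u by (intro cos_ge_zero) auto
  then have "(1 - cos u) * (1 + 2 * cos u) \<ge> (1 - cos u) * 1"
    by (intro mult_left_mono) auto
  moreover have "1 - cos u \<ge> u\<^sup>2 / 8"
  proof -
    have "cos u \<le> 1 - u\<^sup>2 / 6" by (rule cos_le_one_minus_square) (use u pi_less_4 in auto)
    then show ?thesis using zero_le_power2 [of u] by linarith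
  qed
  moreover have "u\<^sup>2 / 8 = t\<^sup>2 / 32" by (simp add: u_def power2_eq_square)
  ultimately show ?thesis by simp
qed

text \<open>This makes the division by the small \<psi> harmless. If |s| \<le> |t|/2, then
  |\<psi>(t)| is much smaller than |\<psi>(s)| and supplies the decay. Otherwise the ratio is at
  most 1 by monotonicity of the cosine, and the Gaussian factor at s is already comparable to the
  one at t.\<close>

lemma psi_ratio:
  fixes s t :: real
  assumes "\<bar>s\<bar> \<le> \<bar>t\<bar>" "\<bar>t\<bar> \<le> pi"
  shows "exp (- (c * n * s\<^sup>2)) * (cmod (\<psi> t) / cmod (\<psi> s)) \<le> exp (- (c / 32 * (n * t\<^sup>2)))"
proof (cases "\<bar>s\<bar> \<le> \<bar>t\<bar> / 2")
  case True
  have "c * n * (t\<^sup>2 / 32) \<le> lam * (cos s - cos t)"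
    using lam_bounds half_angle_gap [OF True assms(2)] c by (intro mult_mono) auto
  moreover have "c * n * s\<^sup>2 \<ge> 0" using c by simp
  ultimately show ?thesis unfolding cmod_psi
    by (simp add: algebra_simps flip: exp_diff exp_add)
next
  case False
  have "cos \<bar>t\<bar> \<le> cos \<bar>s\<bar>" using assms by (intro cos_monotone_0_pi_le) auto
  then have "lam * (1 - cos s) \<le> lam * (1 - cos t)"
    using lam_bounds by simp
  moreover have "c / 32 * (n * t\<^sup>2) \<le> c * n * s\<^sup>2"
  proof -
    have "\<bar>t\<bar>\<^sup>2 \<le> (2 * \<bar>s\<bar>)\<^sup>2" using False by (intro power_mono) auto
    then have "t\<^sup>2 \<le> 4 * s\<^sup>2" by (simp add: power2_eq_square)
    then have "t\<^sup>2 / 32 \<le> s\<^sup>2" using zero_le_power2 [of s] by linarith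
    from mult_left_mono [OF this, of "c * n"] show ?thesis using c by simp
  qed
  ultimately show ?thesis unfolding cmod_psi
    by (simp flip: exp_diff exp_add)
qed

lemma chi_bound_aux:
  fixes t :: real
  assumes "\<bar>t\<bar> \<le> pi"
  shows "cmod (\<delta> t) \<le> \<bar>t\<bar> * (K * (n * t\<^sup>2 + \<bar>t\<bar>)) * exp (- (c / 32 * (n * t\<^sup>2)))"
proof -
  \<comment> \<open>\<open>B\<close> bounds the derivative of the quotient along the whole segment
    from 0 to t; its denominator disappears when the increment of the quotient is multiplied by
    |\<psi>(t)|.\<close>
  define B where "B = K * (n * t\<^sup>2 + \<bar>t\<bar>) * exp (- (c / 32 * (n * t\<^sup>2))) / cmod (\<psi> t)"
  have "cmod (\<phi> t / \<psi> t - \<phi> 0 / \<psi> 0) \<le> B * norm (t - 0)"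
  proof (rule differentiable_bound [where f' = "\<lambda>t h. h *\<^sub>R (\<i> * err t / \<psi> t)"])
    show "convex (closed_segment 0 t)" by simp
    show "((\<lambda>t. \<phi> t / \<psi> t) has_derivative (\<lambda>h. h *\<^sub>R (\<i> * err x / \<psi> x))) (at x within closed_segment 0 t)" for x
      using ratio_deriv [of x] by (simp add: has_vector_derivative_def)
    fix s assume "s \<in> closed_segment 0 t"
    then have s: "\<bar>s\<bar> \<le> \<bar>t\<bar>" by (auto simp: closed_segment_eq_real_ivl split: if_splits)
    have "s\<^sup>2 \<le> t\<^sup>2" using s by (simp add: abs_le_square_iff)
    then have le: "n * s\<^sup>2 + \<bar>s\<bar> \<le> n * t\<^sup>2 + \<bar>t\<bar>" using s by (intro add_mono mult_left_mono) auto
    have "cmod (err s) * cmod (\<psi> t) / cmod (\<psi> s) \<le>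
        K * (n * s\<^sup>2 + \<bar>s\<bar>) * exp (- (c * n * s\<^sup>2)) * cmod (\<psi> t) / cmod (\<psi> s)"
      using err_bound [of s] s assms by (intro divide_right_mono mult_right_mono) auto
    also have "\<dots> = K * (n * s\<^sup>2 + \<bar>s\<bar>) * (exp (- (c * n * s\<^sup>2)) * (cmod (\<psi> t) / cmod (\<psi> s)))" by simp
    also have "\<dots> \<le> K * (n * t\<^sup>2 + \<bar>t\<bar>) * exp (- (c / 32 * (n * t\<^sup>2)))"
      using K le psi_ratio [OF s assms] by (intro mult_mono) auto
    finally have *: "cmod (err s) / cmod (\<psi> s) \<le> B"
      using psi_nz [of t] by (simp add: B_def field_simps)
    show "onorm (\<lambda>h. h *\<^sub>R (\<i> * err s / \<psi> s)) \<le> B"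
    proof (intro onorm_le)
      fix h :: real
      from mult_right_mono [OF *, of "\<bar>h\<bar>"]
      show "norm (h *\<^sub>R (\<i> * err s / \<psi> s)) \<le> B * norm h"
        by (simp add: norm_mult norm_divide mult.commute)
    qed
  qed auto
  moreover have "\<phi> 0 / \<psi> 0 = 1" using p_sum by (simp add: \<phi>_def \<psi>_def flip: of_real_sum)
  moreover have "\<phi> t / \<psi> t - 1 = \<delta> t / \<psi> t" using psi_nz [of t] by (simp add: \<delta>_def field_simps)
  ultimately have "cmod (\<delta> t) / cmod (\<psi> t) \<le> B * \<bar>t\<bar>" by (simp add: norm_divide)
  then show ?thesis using psi_nz [of t] by (simp add: B_def field_simps)
qed

text \<open>The constant that trades the exponential of rate c/32 for a fourth power. It and the two
  constants after it depend on c and K only, which keeps the final bounds uniform in n.\<close>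

definition "B4 = (1 + 4 / (c / 32)) ^ 4"
definition "C1 = 2 * K * B4"
definition "C2 = (K + 1) * C1 + 2 * K * B4"

lemma B4_pos: "B4 > 0"
  unfolding B4_def using c by (intro zero_less_power add_pos_pos) auto

lemma C1_pos: "C1 > 0" and C2_pos: "C2 > 0"
proof -
  show "C1 > 0" using K B4_pos by (simp add: C1_def)
  then show "C2 > 0" using K B4_pos by (simp add: C2_def add_pos_pos)
qed

lemma decay:
  fixes t y :: real
  assumes "y \<ge> 0" "y = n * t\<^sup>2"
  shows "(1 + y) ^ 4 * exp (- (c / 32 * y)) \<le> B4"
  using one_plus_power_mult_exp_le [of y "c / 32" 4] assms c by (simp add: B4_def)

text \<open>On the scale y = n t^2, both |t| n t^2 and t^2 are at most (1 + y)^2 / sqrt n, and the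
  exponential pays for the powers of 1 + y. The weight is squared since \<open>eta_bound\<close>
  spends one factor 1 + y on the multiplier lam (cis t - 1), which is of order n |t| \<le> sqrt n (1
  + y).\<close>

lemma chi_bound:
  fixes t :: real
  assumes "\<bar>t\<bar> \<le> pi"
  shows "cmod (\<delta> t) \<le> C1 / sqrt n / (1 + n * t\<^sup>2)\<^sup>2"
proof -
  define y where "y = n * t\<^sup>2"
  define v where "v = sqrt n"
  have v: "v \<ge> 1" "v\<^sup>2 = n" using n by (auto simp: v_def)
  have y: "y \<ge> 0" by (simp add: y_def)
  have vt: "v * \<bar>t\<bar> \<le> 1 + y"
  proof -
    have "2 * (v * \<bar>t\<bar>) \<le> 1 + (v * \<bar>t\<bar>)\<^sup>2" using sum_squares_bound [of 1 "v * \<bar>t\<bar>"] by simp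
    also have "(v * \<bar>t\<bar>)\<^sup>2 = y" by (simp add: y_def power_mult_distrib v)
    finally show ?thesis using y by linarith
  qed
  have a1: "\<bar>t\<bar> * (n * t\<^sup>2) * v \<le> (1 + y)\<^sup>2"
    using mult_mono [OF vt, of y "1 + y"] y v by (simp add: y_def power2_eq_square algebra_simps)
  have a2: "\<bar>t\<bar> * \<bar>t\<bar> * v \<le> (1 + y)\<^sup>2"
  proof -
    have "\<bar>t\<bar> * \<bar>t\<bar> * v \<le> \<bar>t\<bar> * \<bar>t\<bar> * (v * v)" using v by (intro mult_left_mono) auto
    also have "\<dots> = y" using v by (simp add: y_def power2_eq_square)
    also have "\<dots> \<le> (1 + y)\<^sup>2" using y by (simp add: power2_eq_square algebra_simps)
    finally show ?thesis .
  qed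
  have "cmod (\<delta> t) * v * (1 + y)\<^sup>2 \<le>
     \<bar>t\<bar> * (K * (n * t\<^sup>2 + \<bar>t\<bar>)) * exp (- (c / 32 * y)) * v * (1 + y)\<^sup>2"
    using chi_bound_aux [OF assms] v by (intro mult_right_mono) (auto simp: y_def)
  also have "\<dots> = K * (\<bar>t\<bar> * (n * t\<^sup>2) * v + \<bar>t\<bar> * \<bar>t\<bar> * v) * (exp (- (c / 32 * y)) * (1 + y)\<^sup>2)"
    by (simp add: algebra_simps)
  also have "\<dots> \<le> K * ((1 + y)\<^sup>2 + (1 + y)\<^sup>2) * (exp (- (c / 32 * y)) * (1 + y)\<^sup>2)"
    using a1 a2 K by (intro mult_right_mono mult_left_mono add_mono) auto
  also have "\<dots> = 2 * K * ((1 + y) ^ 4 * exp (- (c / 32 * y)))"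
    by (simp add: power2_eq_square power4_eq_xxxx algebra_simps)
  also have "\<dots> \<le> 2 * K * B4"
    using decay [OF y] K by (intro mult_left_mono) (auto simp: y_def)
  finally have "cmod (\<delta> t) * v * (1 + y)\<^sup>2 \<le> C1" by (simp add: C1_def)
  moreover have "v * (1 + y)\<^sup>2 > 0" using y v by (intro mult_pos_pos zero_less_power) auto
  ultimately have "cmod (\<delta> t) \<le> C1 / (v * (1 + y)\<^sup>2)"
    by (simp add: pos_le_divide_eq mult.assoc)
  then show ?thesis by (simp add: y_def v_def)
qed

lemma eta_bound:
  fixes t :: real
  assumes "\<bar>t\<bar> \<le> pi"
  shows "cmod (\<eta> t) \<le> C2 / (1 + n * t\<^sup>2)"
proof -
  define y where "y = n * t\<^sup>2"
  define v where "v = sqrt n"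
  have v: "v \<ge> 1" "v\<^sup>2 = n" using n by (auto simp: v_def)
  have y: "y \<ge> 0" by (simp add: y_def)
  have vt: "v * \<bar>t\<bar> \<le> 1 + y"
  proof -
    have "2 * (v * \<bar>t\<bar>) \<le> 1 + (v * \<bar>t\<bar>)\<^sup>2" using sum_squares_bound [of 1 "v * \<bar>t\<bar>"] by simp
    also have "(v * \<bar>t\<bar>)\<^sup>2 = y" by (simp add: y_def power_mult_distrib v)
    finally show ?thesis using y by linarith
  qed
  have tv: "\<bar>t\<bar> \<le> 1 + y" using vt mult_right_mono [OF v(1), of "\<bar>t\<bar>"] by simp
  have lam: "lam \<le> (K + 1) * n" using lam_bounds(2) var_upper n by (simp add: algebra_simps)
  \<comment> \<open>An exact identity, so the bound on \<delta> is reused and only the defect is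
    new.\<close>
  have "\<eta> t = lam * (cis t - 1) * \<delta> t + err t"
    by (simp add: \<eta>_def \<delta>_def err_def algebra_simps)
  also have "cmod \<dots> \<le> (K + 1) * n * \<bar>t\<bar> * (C1 / v / (1 + y)\<^sup>2) + K * (y + \<bar>t\<bar>) * exp (- (c * n * t\<^sup>2))"
  proof (rule order_trans [OF norm_triangle_ineq], rule add_mono)
    show "cmod (lam * (cis t - 1) * \<delta> t) \<le> (K + 1) * n * \<bar>t\<bar> * (C1 / v / (1 + y)\<^sup>2)"
      unfolding norm_mult using lam lam_bounds cmod_cis_minus_1 [of t] chi_bound [OF assms] K
      by (intro mult_mono) (auto simp: y_def v_def)
  qed (use err_bound [OF assms] in \<open>simp add: y_def\<close>)
  finally have 1: "cmod (\<eta> t) \<le> (K + 1) * n * \<bar>t\<bar> * (C1 / v / (1 + y)\<^sup>2) + K * (y + \<bar>t\<bar>) * exp (- (c * n * t\<^sup>2))" .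
  have "(K + 1) * n * \<bar>t\<bar> * (C1 / v / (1 + y)\<^sup>2) = (K + 1) * C1 * (v * \<bar>t\<bar>) / (1 + y)\<^sup>2"
  proof -
    have "real n / v = v" using v by (simp add: field_simps power2_eq_square)
    then have "(K + 1) * C1 * (real n / v * \<bar>t\<bar>) / (1 + y)\<^sup>2 = (K + 1) * C1 * (v * \<bar>t\<bar>) / (1 + y)\<^sup>2"
      by simp
    then show ?thesis by (simp add: mult_ac)
  qed
  also have "\<dots> \<le> (K + 1) * C1 * (1 + y) / (1 + y)\<^sup>2"
    using vt K C1_pos by (intro divide_right_mono mult_left_mono) auto
  also have "\<dots> = (K + 1) * C1 / (1 + y)" using y by (simp add: power2_eq_square)
  finally have 2: "(K + 1) * n * \<bar>t\<bar> * (C1 / v / (1 + y)\<^sup>2) \<le> (K + 1) * C1 / (1 + y)" .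
  have "K * (y + \<bar>t\<bar>) * exp (- (c * n * t\<^sup>2)) * (1 + y) \<le> K * (2 * (1 + y)) * exp (- (c / 32 * y)) * (1 + y)"
  proof -
    have "c / 32 * y \<le> c * y" using c y by (intro mult_right_mono) auto
    then have "exp (- (c * n * t\<^sup>2)) \<le> exp (- (c / 32 * y))" by (simp add: y_def)
    then show ?thesis using K tv y by (intro mult_right_mono mult_mono mult_left_mono) auto
  qed
  also have "\<dots> = 2 * K * ((1 + y)\<^sup>2 * exp (- (c / 32 * y)))"
    by (simp add: power2_eq_square algebra_simps)
  also have "\<dots> \<le> 2 * K * ((1 + y) ^ 4 * exp (- (c / 32 * y)))"
    using K y by (intro mult_left_mono mult_right_mono power_increasing) auto
  also have "\<dots> \<le> 2 * K * B4"
    using decay [OF y] K by (intro mult_left_mono) (auto simp: y_def)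
  finally have "K * (y + \<bar>t\<bar>) * exp (- (c * n * t\<^sup>2)) \<le> 2 * K * B4 / (1 + y)"
    using y by (simp add: field_simps)
  with 1 2 have "cmod (\<eta> t) \<le> (K + 1) * C1 / (1 + y) + 2 * K * B4 / (1 + y)" by linarith
  then show ?thesis by (simp add: C2_def y_def add_divide_distrib)
qed

lemma divide_weight_square_le:
  fixes t :: real
  assumes "X \<ge> 0"
  shows "X / (1 + n * t\<^sup>2)\<^sup>2 \<le> X / (1 + n * t\<^sup>2)"
proof -
  have "1 + n * t\<^sup>2 \<ge> 1" by simp
  then have "(1 + n * t\<^sup>2)\<^sup>2 \<ge> 1 + n * t\<^sup>2" "1 + n * t\<^sup>2 > 0"
    using self_le_power [of "1 + n * t\<^sup>2" 2] by linarith+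
  then show ?thesis using assms by (intro divide_left_mono mult_pos_pos) auto
qed

lemma integral_cauchy_weight:
  obtains I where "((\<lambda>t. 1 / (1 + n * t\<^sup>2)) has_integral I) {-pi..pi}" "I \<le> pi / sqrt n"
proof
  define v where "v = sqrt n"
  have v: "v \<ge> 1" "v\<^sup>2 = n" using n by (auto simp: v_def)
  show "((\<lambda>t. 1 / (1 + n * t\<^sup>2)) has_integral (arctan (v * pi) / v - arctan (v * - pi) / v)) {-pi..pi}"
  proof (rule fundamental_theorem_of_calculus)
    fix t :: real
    have "((\<lambda>t. arctan (v * t) / v) has_real_derivative 1 / (1 + n * t\<^sup>2)) (at t within {-pi..pi})"
      using v by (auto intro!: derivative_eq_intros simp: power_mult_distrib divide_inverse)
    then show "((\<lambda>t. arctan (v * t) / v) has_vector_derivative 1 / (1 + n * t\<^sup>2)) (at t within {-pi..pi})"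
      by (simp add: has_real_derivative_iff_has_vector_derivative)
  qed simp
  have "arctan (v * pi) \<le> pi / 2" using arctan_ubound [of "v * pi"] by simp
  then show "arctan (v * pi) / v - arctan (v * - pi) / v \<le> pi / sqrt n"
    using v by (simp add: arctan_minus v_def field_simps)
qed

lemma local_bound: "\<bar>p a - TP_pmf \<mu> \<sigma>2 a\<bar> \<le> C1 / n"
proof -
  obtain I where I: "((\<lambda>t. 1 / (1 + n * t\<^sup>2)) has_integral I) {-pi..pi}" "I \<le> pi / sqrt n"
    by (rule integral_cauchy_weight)
  have "cmod (complex_of_real (2 * pi * (p a - TP_pmf \<mu> \<sigma>2 a))) \<le> C1 / sqrt n * I"
  proof -
    have "cmod (integral {-pi..pi} (\<lambda>t. \<delta> t * cis (- (real_of_int a * t)))) \<le>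
       integral {-pi..pi} (\<lambda>t. C1 / sqrt n * (1 / (1 + n * t\<^sup>2)))"
    proof (rule integral_norm_bound_integral)
      show "(\<lambda>t. C1 / sqrt n * (1 / (1 + n * t\<^sup>2))) integrable_on {-pi..pi}"
        using has_integral_mult_right [OF I(1)] by (rule has_integral_integrable)
      fix t assume "t \<in> {-pi..pi}"
      then have "cmod (\<delta> t) \<le> C1 / sqrt n / (1 + n * t\<^sup>2)\<^sup>2" by (intro chi_bound) auto
      also have "\<dots> \<le> C1 / sqrt n / (1 + n * t\<^sup>2)"
        using C1_pos by (intro divide_weight_square_le) auto
      finally show "cmod (\<delta> t * cis (- (real_of_int a * t))) \<le> C1 / sqrt n * (1 / (1 + n * t\<^sup>2))"
        by (simp add: norm_mult)
    qed (use chi_coeff(2) [of a] in blast)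
    then show ?thesis
      using integral_unique [OF chi_coeff(2) [of a]] integral_unique [OF has_integral_mult_right [OF I(1), of "C1 / sqrt n"]] by simp
  qed
  also have "\<dots> \<le> C1 / sqrt n * (pi / sqrt n)" using I(2) C1_pos by (intro mult_left_mono) auto
  also have "\<dots> = pi * (C1 / n)" by simp
  finally have "2 * pi * \<bar>p a - TP_pmf \<mu> \<sigma>2 a\<bar> \<le> pi * (C1 / n)"
    by (simp only: norm_of_real abs_mult) simp
  then have "pi * (2 * \<bar>p a - TP_pmf \<mu> \<sigma>2 a\<bar>) \<le> pi * (C1 / n)" by (simp only: mult_ac)
  then have "2 * \<bar>p a - TP_pmf \<mu> \<sigma>2 a\<bar> \<le> C1 / n" by (rule mult_left_le_imp_le) simp
  then show ?thesis by (rule order_trans [rotated]) simp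
qed

lemma square_sum_bounds:
  fixes f :: "real \<Rightarrow> complex"
  assumes "finite F" "\<And>t::real. \<bar>t\<bar> \<le> pi \<Longrightarrow> cmod (f t) \<le> B / (1 + n * t\<^sup>2)"
    "continuous_on {-pi..pi} f" "B \<ge> 0"
    "\<And>a. a \<in> F \<Longrightarrow> ((\<lambda>t. f t * cis (- (real_of_int a * t))) has_integral
                    complex_of_real (2 * pi * u a)) {-pi..pi}"
  shows "(\<Sum>a\<in>F. (u a)\<^sup>2) \<le> B\<^sup>2 / sqrt n"
proof -
  obtain I where I: "((\<lambda>t. 1 / (1 + n * t\<^sup>2)) has_integral I) {-pi..pi}" "I \<le> pi / sqrt n"
    by (rule integral_cauchy_weight)
  have "2 * pi * (\<Sum>a\<in>F. (u a)\<^sup>2) \<le> integral {-pi..pi} (\<lambda>t. (cmod (f t))\<^sup>2)"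
    by (rule bessel_inequality) (use assms in auto)
  also have "\<dots> \<le> integral {-pi..pi} (\<lambda>t. B\<^sup>2 * (1 / (1 + n * t\<^sup>2)))"
  proof (rule integral_le)
    show "(\<lambda>t. (cmod (f t))\<^sup>2) integrable_on {-pi..pi}"
      by (intro integrable_continuous_real continuous_intros assms)
    show "(\<lambda>t. B\<^sup>2 * (1 / (1 + n * t\<^sup>2))) integrable_on {-pi..pi}"
      using has_integral_mult_right [OF I(1)] by (rule has_integral_integrable)
    fix t assume "t \<in> {-pi..pi}"
    then have "(cmod (f t))\<^sup>2 \<le> (B / (1 + n * t\<^sup>2))\<^sup>2" using assms(2) [of t] by (intro power_mono) auto
    also have "\<dots> = B\<^sup>2 / (1 + n * t\<^sup>2)\<^sup>2" by (simp add: power_divide)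
    also have "\<dots> \<le> B\<^sup>2 / (1 + n * t\<^sup>2)"
      by (intro divide_weight_square_le) auto
    finally show "(cmod (f t))\<^sup>2 \<le> B\<^sup>2 * (1 / (1 + n * t\<^sup>2))" by simp
  qed
  also have "\<dots> = B\<^sup>2 * I" by (rule integral_unique [OF has_integral_mult_right [OF I(1)]])
  also have "\<dots> \<le> B\<^sup>2 * (pi / sqrt n)" using I(2) by (intro mult_left_mono) auto
  also have "\<dots> = pi * (B\<^sup>2 / sqrt n)" by simp
  finally have "2 * pi * (\<Sum>a\<in>F. (u a)\<^sup>2) \<le> pi * (B\<^sup>2 / sqrt n)" .
  then have "pi * (2 * (\<Sum>a\<in>F. (u a)\<^sup>2)) \<le> pi * (B\<^sup>2 / sqrt n)" by (simp only: mult_ac)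
  then have "2 * (\<Sum>a\<in>F. (u a)\<^sup>2) \<le> B\<^sup>2 / sqrt n" by (rule mult_left_le_imp_le) simp
  then show ?thesis using sum_nonneg [of F "\<lambda>a. (u a)\<^sup>2"] by simp
qed

text \<open>Cauchy-Schwarz with the weight n + (a - \<mu>)^2. The bounds on \<delta> and \<eta>
  control the two parts of the weighted square sum, each of order n^(-1/2); the reciprocal weights
  sum to order n^(-1/2) as well.\<close>

lemma l1_bound:
  assumes "finite F"
  shows "(\<Sum>a\<in>F. \<bar>p a - TP_pmf \<mu> \<sigma>2 a\<bar>) \<le> sqrt (8 * (C1\<^sup>2 + C2\<^sup>2)) / sqrt n"
proof -
  define e where "e = (\<lambda>a. p a - TP_pmf \<mu> \<sigma>2 a)"
  define v where "v = sqrt n"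
  have v: "v \<ge> 1" "v\<^sup>2 = n" using n by (auto simp: v_def)
  define w where "w = (\<lambda>a::int. v\<^sup>2 + (of_int a - \<mu>)\<^sup>2)"
  have w: "w a > 0" for a using v n by (auto simp: w_def intro!: add_pos_nonneg)
  have S1: "(\<Sum>a\<in>F. (e a)\<^sup>2) \<le> (C1 / v)\<^sup>2 / v"
    unfolding v_def
  proof (rule square_sum_bounds [OF assms])
    fix t :: real assume "\<bar>t\<bar> \<le> pi"
    then have "cmod (\<delta> t) \<le> C1 / sqrt n / (1 + n * t\<^sup>2)\<^sup>2" by (intro chi_bound) auto
    also have "\<dots> \<le> C1 / sqrt n / (1 + n * t\<^sup>2)"
      using C1_pos by (intro divide_weight_square_le) auto
    finally show "cmod (\<delta> t) \<le> C1 / sqrt n / (1 + n * t\<^sup>2)" .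
  qed (use chi_coeff C1_pos in \<open>auto simp: e_def\<close>)
  have S2: "(\<Sum>a\<in>F. ((of_int a - \<mu>) * e a)\<^sup>2) \<le> C2\<^sup>2 / v"
    unfolding v_def
    by (rule square_sum_bounds [OF assms eta_bound]) (use eta_coeff C2_pos in \<open>auto simp: e_def\<close>)
  have "(\<Sum>a\<in>F. w a * (e a)\<^sup>2) = v\<^sup>2 * (\<Sum>a\<in>F. (e a)\<^sup>2) + (\<Sum>a\<in>F. ((of_int a - \<mu>) * e a)\<^sup>2)"
    unfolding w_def sum_distrib_left power_mult_distrib distrib_right sum.distrib ..
  also have "\<dots> \<le> v\<^sup>2 * ((C1 / v)\<^sup>2 / v) + C2\<^sup>2 / v"
    using S1 S2 by (intro add_mono mult_left_mono) auto
  also have "\<dots> = (C1\<^sup>2 + C2\<^sup>2) / v"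
    using v n by (simp add: power_divide add_divide_distrib)
  finally have S3: "(\<Sum>a\<in>F. w a * (e a)\<^sup>2) \<le> (C1\<^sup>2 + C2\<^sup>2) / v" .
  have S4: "(\<Sum>a\<in>F. 1 / w a) \<le> 8 / v"
    unfolding w_def by (rule sum_lattice_cauchy_weight_le [OF v(1) assms])
  have "(\<Sum>a\<in>F. \<bar>e a\<bar>) = (\<Sum>a\<in>F. \<bar>1 / sqrt (w a)\<bar> * \<bar>sqrt (w a) * e a\<bar>)"
    using w by (intro sum.cong) (auto simp: abs_mult less_imp_neq [symmetric] less_imp_le)
  also have "\<dots> \<le> L2_set (\<lambda>a. 1 / sqrt (w a)) F * L2_set (\<lambda>a. sqrt (w a) * e a) F"
    by (rule L2_set_mult_ineq)
  also have "L2_set (\<lambda>a. 1 / sqrt (w a)) F = sqrt (\<Sum>a\<in>F. 1 / w a)"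
    using w by (simp add: L2_set_def power_divide less_imp_le)
  also have "L2_set (\<lambda>a. sqrt (w a) * e a) F = sqrt (\<Sum>a\<in>F. w a * (e a)\<^sup>2)"
    using w by (simp add: L2_set_def power_mult_distrib less_imp_le)
  also have "sqrt (\<Sum>a\<in>F. 1 / w a) * sqrt (\<Sum>a\<in>F. w a * (e a)\<^sup>2) \<le>
      sqrt (8 / v) * sqrt ((C1\<^sup>2 + C2\<^sup>2) / v)"
    using S3 S4 v by (intro mult_mono real_sqrt_le_mono) (auto intro!: sum_nonneg simp: less_imp_le [OF w])
  also have "\<dots> = sqrt (8 * (C1\<^sup>2 + C2\<^sup>2)) / v"
    using v by (simp add: real_sqrt_mult [symmetric] real_sqrt_divide)
  finally show ?thesis by (simp add: e_def v_def)
qed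

lemma d_loc_le: "\<bar>d_loc p (TP_pmf \<mu> \<sigma>2)\<bar> \<le> C1 / n"
  unfolding d_loc_def by (rule cSup_abs_le) (use local_bound in auto)

lemma summable_on_finite_l1:
  fixes f :: "int \<Rightarrow> real"
  assumes "\<And>F. finite F \<Longrightarrow> (\<Sum>a\<in>F. \<bar>f a\<bar>) \<le> B"
  shows "(\<lambda>a. \<bar>f a\<bar>) summable_on A" "f summable_on A" "\<bar>infsum f A\<bar> \<le> B"
proof -
  show *: "(\<lambda>a. \<bar>f a\<bar>) summable_on A"
    by (rule nonneg_bdd_above_summable_on) (use assms in \<open>auto simp: bdd_above_def\<close>)
  then show "f summable_on A" using abs_summable_summable [of f A] by simp
  have "\<bar>infsum f A\<bar> \<le> infsum (\<lambda>a. \<bar>f a\<bar>) A"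
    using norm_infsum_bound [of f A] * by simp
  also have "\<dots> \<le> B"
    by (rule infsum_le_finite_sums) (use * assms in auto)
  finally show "\<bar>infsum f A\<bar> \<le> B" .
qed

lemma d_TV_le: "\<bar>d_TV p (TP_pmf \<mu> \<sigma>2)\<bar> \<le> sqrt (8 * (C1\<^sup>2 + C2\<^sup>2)) / sqrt n"
proof -
  have main: "\<bar>infsum p A - infsum (TP_pmf \<mu> \<sigma>2) A\<bar> \<le> sqrt (8 * (C1\<^sup>2 + C2\<^sup>2)) / sqrt n" for A
  proof -
  have p: "p summable_on A"
  proof -
    have "(\<Sum>a\<in>F. \<bar>p a\<bar>) \<le> (\<Sum>a\<in>{0..int n}. \<bar>p a\<bar>)" if "finite F" for F
    proof -
      have "(\<Sum>a\<in>F. \<bar>p a\<bar>) = (\<Sum>a\<in>F \<inter> {0..int n}. \<bar>p a\<bar>)"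
        using that supp by (intro sum.mono_neutral_right) auto
      also have "\<dots> \<le> (\<Sum>a\<in>{0..int n}. \<bar>p a\<bar>)" by (intro sum_mono2) auto
      finally show ?thesis .
    qed
    then show ?thesis by (rule summable_on_finite_l1(2))
  qed
  have l1: "(\<Sum>a\<in>F. \<bar>TP_pmf \<mu> \<sigma>2 a - p a\<bar>) \<le> sqrt (8 * (C1\<^sup>2 + C2\<^sup>2)) / sqrt n" if "finite F" for F
    using l1_bound [OF that] by (simp add: abs_minus_commute)
  \<comment> \<open>Writing the translated Poisson masses as p plus a difference makes both parts
    summable: p by its finite support, the difference by the l1 bound.\<close>
  have "infsum (\<lambda>a. p a + (TP_pmf \<mu> \<sigma>2 a - p a)) A = infsum p A + infsum (\<lambda>a. TP_pmf \<mu> \<sigma>2 a - p a) A"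
    by (rule infsum_add [OF p summable_on_finite_l1(2) [OF l1]])
  then show "\<bar>infsum p A - infsum (TP_pmf \<mu> \<sigma>2) A\<bar> \<le> sqrt (8 * (C1\<^sup>2 + C2\<^sup>2)) / sqrt n"
    using summable_on_finite_l1(3) [OF l1, of A] by simp
  qed
  then show ?thesis unfolding d_TV_def by (intro cSup_abs_le) auto
qed

end

subsection \<open>Degree counts in geometric graphs on the torus\<close>

text \<open>The vertex i may lie outside X, so that the degree of a new vertex is expressible before
  its insertion.\<close>

definition gdeg :: "('i \<Rightarrow> 'i \<Rightarrow> bool) \<Rightarrow> 'i set \<Rightarrow> 'i \<Rightarrow> nat" where
  "gdeg E X i = card {j \<in> X. j \<noteq> i \<and> E i j}"

definition gcount :: "('i \<Rightarrow> 'i \<Rightarrow> bool) \<Rightarrow> nat \<Rightarrow> 'i set \<Rightarrow> real" where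
  "gcount E d X = real (card {i \<in> X. gdeg E X i \<noteq> d})"

lemma gcount_sum: "finite X \<Longrightarrow> gcount E d X = (\<Sum>i\<in>X. of_bool (gdeg E X i \<noteq> d))"
  by (simp add: gcount_def sum.If_cases of_bool_def Int_def)

lemma gdeg_insert:
  assumes "finite X" "k \<notin> X"
  shows "gdeg E (insert k X) i = gdeg E X i + of_bool (k \<noteq> i \<and> E i k)"
proof -
  have "{j \<in> insert k X. j \<noteq> i \<and> E i j} =
      (if k \<noteq> i \<and> E i k then insert k {j \<in> X. j \<noteq> i \<and> E i j} else {j \<in> X. j \<noteq> i \<and> E i j})"
    by auto
  then show ?thesis using assms by (simp add: gdeg_def)
qed

lemma gcount_insert:
  assumes "finite X" "k \<notin> X"
  shows "gcount E d (insert k X) = of_bool (gdeg E X k \<noteq> d) +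
           (\<Sum>i\<in>X. of_bool (gdeg E X i + of_bool (E i k) \<noteq> d))"
proof -
  have "gcount E d (insert k X) = of_bool (gdeg E (insert k X) k \<noteq> d) +
      (\<Sum>i\<in>X. of_bool (gdeg E (insert k X) i \<noteq> d))"
    using assms by (simp add: gcount_sum)
  also have "(\<Sum>i\<in>X. of_bool (gdeg E (insert k X) i \<noteq> d)) =
      (\<Sum>i\<in>X. of_bool (gdeg E X i + of_bool (E i k) \<noteq> d) :: real)"
    using assms by (intro sum.cong) (auto simp: gdeg_insert)
  finally show ?thesis using assms by (simp add: gdeg_insert)
qed

text \<open>Every i in S sees at most one of j and k, so the mixed difference of its indicator
  vanishes; j and k do not see each other, so their own indicators do not change either.\<close>

lemma gcount_second_difference:
  assumes "finite S" "j \<notin> S" "k \<notin> S" "j \<noteq> k" "\<not> E j k" "\<not> E k j"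
    and far: "\<And>i. i \<in> S \<Longrightarrow> \<not> (E i j \<and> E i k)"
  shows "gcount E d (insert k (insert j S)) - gcount E d (insert k S)
       = gcount E d (insert j S) - gcount E d S"
proof -
  have "(\<Sum>i\<in>S. of_bool (gdeg E (insert j S) i + of_bool (E i k) \<noteq> d)) -
        (\<Sum>i\<in>S. of_bool (gdeg E S i + of_bool (E i k) \<noteq> d)) =
        (\<Sum>i\<in>S. of_bool (gdeg E S i + of_bool (E i j) \<noteq> d)) -
        (\<Sum>i\<in>S. of_bool (gdeg E S i \<noteq> d) :: real)"
    unfolding sum_subtractf [symmetric]
  proof (rule sum.cong [OF refl])
    fix i assume i: "i \<in> S"
    then have "i \<noteq> j" using assms by auto
    then show "of_bool (gdeg E (insert j S) i + of_bool (E i k) \<noteq> d) - of_bool (gdeg E S i + of_bool (E i k) \<noteq> d)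
       = (of_bool (gdeg E S i + of_bool (E i j) \<noteq> d) - of_bool (gdeg E S i \<noteq> d) :: real)"
      using far [OF i] assms by (cases "E i j"; cases "E i k") (auto simp: gdeg_insert)
  qed
  then show ?thesis
    using assms by (simp add: gcount_insert gcount_sum [of S] gdeg_insert)
qed

lemma gcount_split:
  assumes "finite X"
    and sep: "\<And>i j. i \<in> X - P \<Longrightarrow> j \<in> X \<inter> P \<Longrightarrow> \<not> E i j \<and> \<not> E j i"
  shows "gcount E d X = gcount E d (X - P) + gcount E d (X \<inter> P)"
proof -
  have "gdeg E X i = gdeg E (X - P) i" if "i \<in> X - P" for i
  proof -
    have "{j \<in> X. j \<noteq> i \<and> E i j} = {j \<in> X - P. j \<noteq> i \<and> E i j}" using sep that by blast
    then show ?thesis by (simp add: gdeg_def)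
  qed
  moreover have "gdeg E X i = gdeg E (X \<inter> P) i" if "i \<in> X \<inter> P" for i
  proof -
    have "{j \<in> X. j \<noteq> i \<and> E i j} = {j \<in> X \<inter> P. j \<noteq> i \<and> E i j}" using sep that by blast
    then show ?thesis by (simp add: gdeg_def)
  qed
  moreover have "gcount E d X = (\<Sum>i\<in>(X - P) \<union> (X \<inter> P). of_bool (gdeg E X i \<noteq> d))"
    using assms by (simp add: gcount_sum Un_Diff_Int)
  ultimately show ?thesis
    using assms by (subst (asm) sum.union_disjoint) (auto simp: gcount_sum intro!: sum.cong)
qed

lemma gcount_cong:
  assumes "\<And>i j. i \<in> X \<Longrightarrow> j \<in> X \<Longrightarrow> E i j = E' i j"
  shows "gcount E d X = gcount E' d X"
proof -
  have "gdeg E X i = gdeg E' X i" if "i \<in> X" for i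
    unfolding gdeg_def using assms that by (intro arg_cong [of _ _ card]) auto
  then have "{i \<in> X. gdeg E X i \<noteq> d} = {i \<in> X. gdeg E' X i \<noteq> d}" by auto
  then show ?thesis by (simp add: gcount_def)
qed

text \<open>Inserting u can alter only the status of u itself and of neighbours whose degree is at
  most d. The map f sorts these into cells that are cliques, and a clique of vertices of degree at
  most d has at most d + 1 members. This gives a bound independent of the number of points.\<close>

lemma gcount_insert_diff_le:
  fixes f :: "'i \<Rightarrow> 'c"
  assumes "finite X" "u \<notin> X" "finite C"
    and cells: "\<And>i. i \<in> X \<Longrightarrow> E i u \<Longrightarrow> f i \<in> C"
    and clique: "\<And>i i'. i \<in> X \<Longrightarrow> i' \<in> X \<Longrightarrow> E i u \<Longrightarrow> E i' u \<Longrightarrow> f i = f i' \<Longrightarrow> E i i'"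
  shows "\<bar>gcount E d (insert u X) - gcount E d X\<bar> \<le> 1 + real (card C * (d + 1))"
proof -
  \<comment> \<open>A vertex of degree above d stays different from d after gaining a neighbour, so
    only these indices contribute to the difference.\<close>
  define Q where "Q = {i \<in> X. E i u \<and> gdeg E X i \<le> d}"
  have finQ: "finite Q" using assms by (simp add: Q_def)
  have "card Q = card (\<Union>c\<in>C. {i \<in> Q. f i = c})"
    using cells by (intro arg_cong [of _ _ card]) (auto simp: Q_def)
  also have "\<dots> \<le> (\<Sum>c\<in>C. card {i \<in> Q. f i = c})"
    by (rule card_UN_le) fact
  also have "\<dots> \<le> (\<Sum>c\<in>C. d + 1)"
  proof (rule sum_mono)
    fix c
    show "card {i \<in> Q. f i = c} \<le> d + 1"
    proof (cases "{i \<in> Q. f i = c} = {}")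
      case True
      show ?thesis unfolding True by simp
    next
      case False
      then obtain i where i: "i \<in> Q" "f i = c" by auto
      have "card ({i \<in> Q. f i = c} - {i}) \<le> card {j \<in> X. j \<noteq> i \<and> E i j}"
        using assms i by (intro card_mono) (auto simp: Q_def intro!: clique)
      also have "\<dots> \<le> d" using i by (simp add: Q_def gdeg_def)
      finally show ?thesis using finQ i by (simp add: card_Diff_singleton)
    qed
  qed
  finally have cardQ: "card Q \<le> card C * (d + 1)" by simp
  have "gcount E d (insert u X) - gcount E d X = of_bool (gdeg E X u \<noteq> d) +
      (\<Sum>i\<in>X. of_bool (gdeg E X i + of_bool (E i u) \<noteq> d) - of_bool (gdeg E X i \<noteq> d))"
    using assms by (simp add: gcount_insert gcount_sum [of X] sum_subtractf)
  also have "(\<Sum>i\<in>X. of_bool (gdeg E X i + of_bool (E i u) \<noteq> d) - of_bool (gdeg E X i \<noteq> d)) =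
      (\<Sum>i\<in>Q. of_bool (gdeg E X i + of_bool (E i u) \<noteq> d) - of_bool (gdeg E X i \<noteq> d) :: real)"
    using assms by (intro sum.mono_neutral_right) (auto simp: Q_def split: if_splits)
  also have "\<bar>of_bool (gdeg E X u \<noteq> d) + \<dots>\<bar> \<le> 1 + real (card Q)"
  proof (rule order_trans [OF abs_triangle_ineq], rule add_mono)
    have "\<bar>\<Sum>i\<in>Q. of_bool (gdeg E X i + of_bool (E i u) \<noteq> d) - of_bool (gdeg E X i \<noteq> d) :: real\<bar>
       \<le> (\<Sum>i\<in>Q. 1)"
      by (rule order_trans [OF sum_abs sum_mono]) (auto simp: of_bool_def)
    then show "\<bar>\<Sum>i\<in>Q. of_bool (gdeg E X i + of_bool (E i u) \<noteq> d) - of_bool (gdeg E X i \<noteq> d) :: real\<bar>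
       \<le> real (card Q)" by simp
  qed auto
  finally show ?thesis using cardQ by (simp only: of_nat_le_iff [symmetric, where 'a = real])
qed

section \<open>The toroidal metric and local estimates for the degree count\<close>

definition circ :: "real \<Rightarrow> real \<Rightarrow> real \<Rightarrow> real" where
  "circ L a b = min \<bar>a - b\<bar> (L - \<bar>a - b\<bar>)"

lemma torus_dist_circ:
  "torus_dist L x y = sqrt ((circ L (fst x) (fst y))\<^sup>2 + (circ L (snd x) (snd y))\<^sup>2)"
  by (simp add: torus_dist_def circ_def)

lemma torus_dist_commute: "torus_dist L x y = torus_dist L y x"
  by (simp add: torus_dist_def abs_minus_commute)

lemma circ_le_torus_dist:
  "circ L (fst x) (fst y) \<le> torus_dist L x y" "circ L (snd x) (snd y) \<le> torus_dist L x y"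
  by (auto simp: torus_dist_circ intro!: real_le_rsqrt)

lemma circ_nonneg: "a \<in> {0..<L} \<Longrightarrow> b \<in> {0..<L} \<Longrightarrow> circ L a b \<ge> 0"
  by (auto simp: circ_def min_def abs_if)

lemma circ_triangle:
  "a \<in> {0..<L} \<Longrightarrow> b \<in> {0..<L} \<Longrightarrow> c \<in> {0..<L} \<Longrightarrow> circ L a b \<le> circ L c a + circ L c b"
  by (auto simp: circ_def min_def abs_if)

text \<open>A square neighbourhood in place of a disc: it contains every pair with a common
  neighbour, and its area is that of a few rectangles.\<close>

definition near :: "real \<Rightarrow> real \<Rightarrow> real \<times> real \<Rightarrow> real \<times> real \<Rightarrow> bool" where
  "near L r x y \<longleftrightarrow> circ L (fst x) (fst y) \<le> 2 * r \<and> circ L (snd x) (snd y) \<le> 2 * r"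

lemma torus_dist_le_imp_near: "r \<ge> 0 \<Longrightarrow> torus_dist L x y \<le> r \<Longrightarrow> near L r x y"
  using circ_le_torus_dist [of L x y] by (simp add: near_def)

lemma near_if_common_neighbour:
  assumes "x \<in> torus_box L" "y \<in> torus_box L" "z \<in> torus_box L"
    and "torus_dist L z x \<le> r" "torus_dist L z y \<le> r"
  shows "near L r x y"
proof -
  have "circ L (fst x) (fst y) \<le> circ L (fst z) (fst x) + circ L (fst z) (fst y)"
       "circ L (snd x) (snd y) \<le> circ L (snd z) (snd x) + circ L (snd z) (snd y)"
    using assms by (auto intro!: circ_triangle simp: torus_box_def mem_Times_iff)
  then show ?thesis
    using assms(4,5) circ_le_torus_dist [of L z x] circ_le_torus_dist [of L z y] by (simp add: near_def)
qed

lemma torus_dist_leI: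
  assumes "x \<in> torus_box L" "y \<in> torus_box L"
    and "circ L (fst x) (fst y) \<le> a" "circ L (snd x) (snd y) \<le> b" "a\<^sup>2 + b\<^sup>2 \<le> r\<^sup>2" "r \<ge> 0"
  shows "torus_dist L x y \<le> r"
proof -
  have "0 \<le> circ L (fst x) (fst y)" "0 \<le> circ L (snd x) (snd y)"
    using assms by (auto intro!: circ_nonneg simp: torus_box_def mem_Times_iff)
  then have "(circ L (fst x) (fst y))\<^sup>2 \<le> a\<^sup>2" "(circ L (snd x) (snd y))\<^sup>2 \<le> b\<^sup>2"
    using assms by (auto intro!: power_mono)
  then show ?thesis unfolding torus_dist_circ
    using assms by (intro real_le_lsqrt) auto
qed

text \<open>Signed displacement from a to b along the shorter arc: a chart of the circle round a
  that never underestimates distances, so closeness in the chart implies closeness on the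
  torus.\<close>

definition sdiff :: "real \<Rightarrow> real \<Rightarrow> real \<Rightarrow> real" where
  "sdiff L a b = (if b - a > L / 2 then b - a - L else if b - a < - (L / 2) then b - a + L else b - a)"

lemma abs_sdiff: "a \<in> {0..<L} \<Longrightarrow> b \<in> {0..<L} \<Longrightarrow> \<bar>sdiff L a b\<bar> = circ L b a"
  by (auto simp: circ_def sdiff_def min_def abs_if)

lemma circ_le_sdiff:
  "a \<in> {0..<L} \<Longrightarrow> b \<in> {0..<L} \<Longrightarrow> c \<in> {0..<L} \<Longrightarrow> circ L b c \<le> \<bar>sdiff L a b - sdiff L a c\<bar>"
  by (auto simp: circ_def sdiff_def min_def abs_if)

lemma floor_half_grid:
  fixes u r :: real
  assumes "r > 0" "\<bar>u\<bar> \<le> r"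
  shows "\<lfloor>2 * u / r\<rfloor> \<in> {-2..2}"
  using assms by (auto simp: le_floor_iff floor_le_iff abs_if field_simps split: if_splits)

lemma floor_eq_imp_close:
  fixes u v r :: real
  assumes "r > 0" "\<lfloor>2 * u / r\<rfloor> = \<lfloor>2 * v / r\<rfloor>"
  shows "\<bar>u - v\<bar> \<le> r / 2"
proof -
  have "\<bar>2 * u / r - 2 * v / r\<bar> < 1" using assms(2) by linarith
  then have "\<bar>2 * (u - v) / r\<bar> < 1" by (simp add: diff_divide_distrib right_diff_distrib)
  then have "\<bar>2 * u - 2 * v\<bar> < r" using assms(1) by (simp add: abs_divide right_diff_distrib)
  then show ?thesis by (auto simp: abs_if split: if_splits)
qed

definition wcount :: "real \<Rightarrow> real \<Rightarrow> nat \<Rightarrow> (nat \<Rightarrow> real \<times> real) \<Rightarrow> nat set \<Rightarrow> real" where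
  "wcount L r d x = gcount (\<lambda>i j. torus_dist L (x i) (x j) \<le> r) d"

text \<open>The neighbours of a point lie in 25 = 5 x 5 grid cells of side r/2. Two points in one
  cell differ by at most r/2 in each coordinate, hence are adjacent, so each cell is a clique; the
  summand 1 is for the inserted point itself.\<close>

definition dmax :: "nat \<Rightarrow> real" where "dmax d = 1 + real (25 * (d + 1))"

lemma dmax_ge_1: "dmax d \<ge> 1" by (simp add: dmax_def)

lemma wcount_insert_diff_le:
  assumes "r > 0" "finite X" "u \<notin> X" "\<And>i. i \<in> insert u X \<Longrightarrow> x i \<in> torus_box L"
  shows "\<bar>wcount L r d x (insert u X) - wcount L r d x X\<bar> \<le> dmax d"
proof -
  define f where "f = (\<lambda>i. (\<lfloor>2 * sdiff L (fst (x u)) (fst (x i)) / r\<rfloor>, \<lfloor>2 * sdiff L (snd (x u)) (snd (x i)) / r\<rfloor>))"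
  have box: "fst (x i) \<in> {0..<L}" "snd (x i) \<in> {0..<L}" if "i \<in> insert u X" for i
    using assms(4) [OF that] by (auto simp: torus_box_def mem_Times_iff)
  have "\<bar>gcount (\<lambda>i j. torus_dist L (x i) (x j) \<le> r) d (insert u X) - gcount (\<lambda>i j. torus_dist L (x i) (x j) \<le> r) d X\<bar>
     \<le> 1 + real (card ({-2..2::int} \<times> {-2..2::int}) * (d + 1))"
  proof (rule gcount_insert_diff_le [where f = f])
    fix i assume i: "i \<in> X" "torus_dist L (x i) (x u) \<le> r"
    have "\<bar>sdiff L (fst (x u)) (fst (x i))\<bar> \<le> r" "\<bar>sdiff L (snd (x u)) (snd (x i))\<bar> \<le> r"
      using circ_le_torus_dist [of L "x i" "x u"] i box by (simp_all add: abs_sdiff)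
    then show "f i \<in> {-2..2} \<times> {-2..2}"
      unfolding f_def using floor_half_grid [OF assms(1)] by blast
  next
    fix i i' assume i: "i \<in> X" "i' \<in> X" "f i = f i'"
    have "\<bar>sdiff L (fst (x u)) (fst (x i)) - sdiff L (fst (x u)) (fst (x i'))\<bar> \<le> r / 2"
         "\<bar>sdiff L (snd (x u)) (snd (x i)) - sdiff L (snd (x u)) (snd (x i'))\<bar> \<le> r / 2"
      using i(3) unfolding f_def prod.inject by (blast intro: floor_eq_imp_close [OF assms(1)])+
    then have "circ L (fst (x i)) (fst (x i')) \<le> r / 2" "circ L (snd (x i)) (snd (x i')) \<le> r / 2"
      using circ_le_sdiff [of "fst (x u)" L "fst (x i)" "fst (x i')"]
            circ_le_sdiff [of "snd (x u)" L "snd (x i)" "snd (x i')"] box i by auto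
    then show "torus_dist L (x i) (x i') \<le> r"
      by (rule torus_dist_leI [rotated 2]) (use assms i in \<open>auto simp: power_divide\<close>)
  qed (use assms in auto)
  then show ?thesis by (simp add: wcount_def dmax_def)
qed

lemma wcount_second_difference:
  assumes "r > 0" "finite S" "j \<notin> S" "k \<notin> S" "j \<noteq> k" "\<not> near L r (x j) (x k)"
    and box: "\<And>i. i \<in> insert j (insert k S) \<Longrightarrow> x i \<in> torus_box L"
  shows "wcount L r d x (insert k (insert j S)) - wcount L r d x (insert k S)
       = wcount L r d x (insert j S) - wcount L r d x S"
  unfolding wcount_def
proof (rule gcount_second_difference)
  show "\<not> torus_dist L (x j) (x k) \<le> r" "\<not> torus_dist L (x k) (x j) \<le> r"
    using assms torus_dist_le_imp_near [of r L "x j" "x k"] torus_dist_commute [of L "x j" "x k"] by auto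
  show "\<not> (torus_dist L (x i) (x j) \<le> r \<and> torus_dist L (x i) (x k) \<le> r)" if "i \<in> S" for i
    using near_if_common_neighbour [of "x j" L "x k" "x i" r] assms that by auto
qed (use assms in auto)

subsection \<open>Isolated blocks and flips\<close>

type_synonym block = "nat \<times> nat"

text \<open>Half-open, so that distinct blocks are disjoint; the side 4r leaves room for a core that
  is more than r away from everything outside.\<close>

definition blk :: "real \<Rightarrow> block \<Rightarrow> (real \<times> real) set" where
  "blk r b = {4 * r * fst b..<4 * r * fst b + 4 * r} \<times> {4 * r * snd b..<4 * r * snd b + 4 * r}"

text \<open>The number z is the horizontal offset in units of r. All cells of a block share one thin
  horizontal strip, so adjacency between them is decided by the offsets: a difference of at most
  8/10 keeps points within distance r.\<close>

definition cell :: "real \<Rightarrow> real \<Rightarrow> block \<Rightarrow> (real \<times> real) set" where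
  "cell r z b = {4 * r * fst b + z * r..<4 * r * fst b + z * r + r / 10} \<times>
                {4 * r * snd b + 2 * r..<4 * r * snd b + 2 * r + r / 10}"

abbreviation "cellA r \<equiv> cell r 2"
abbreviation "cellB r \<equiv> cell r (14/5)"
abbreviation "cell0 r \<equiv> cell r (3/2)"
abbreviation "cell1 r \<equiv> cell r (23/10)"

text \<open>The offsets of the four cells are chosen such that all of them are more than \<open>r\<close> away from
  the complement of the block, and a point of \<^term>\<open>cell0\<close> is adjacent to the cell A but not to the
  cell B, whereas a point of \<^term>\<open>cell1\<close> is adjacent to both. If A holds \<open>d\<close> points, B two
  and nothing else is nearby, then the moved point has degree \<open>d\<close> or \<open>d + 2\<close>, and all
  points in A and B have degree at least \<open>d + 1\<close> in either position.\<close>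
definition flip :: "real \<Rightarrow> block \<Rightarrow> real \<times> real \<Rightarrow> real \<times> real" where
  "flip r b y = (if y \<in> cell0 r b then (8/10 * r, 0) + y
                 else if y \<in> cell1 r b then (- 8/10 * r, 0) + y else y)"

lemma mem_blk: "y \<in> blk r b \<longleftrightarrow>
    4 * r * fst b \<le> fst y \<and> fst y < 4 * r * fst b + 4 * r \<and> 4 * r * snd b \<le> snd y \<and> snd y < 4 * r * snd b + 4 * r"
  by (auto simp: blk_def mem_Times_iff)

lemma mem_cell: "y \<in> cell r z b \<longleftrightarrow>
    4 * r * fst b + z * r \<le> fst y \<and> fst y < 4 * r * fst b + z * r + r / 10 \<and>
    4 * r * snd b + 2 * r \<le> snd y \<and> snd y < 4 * r * snd b + 2 * r + r / 10"
  by (auto simp: cell_def mem_Times_iff)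

lemma mem_torus_box: "y \<in> torus_box L \<longleftrightarrow> fst y \<in> {0..<L} \<and> snd y \<in> {0..<L}"
  by (auto simp: torus_box_def mem_Times_iff)

lemma cell_subset_blk:
  assumes "r > 0" "0 \<le> z" "z \<le> 3"
  shows "cell r z b \<subseteq> blk r b"
proof
  fix y assume "y \<in> cell r z b"
  moreover have "z * r \<le> 3 * r" "0 \<le> z * r" using assms by auto
  ultimately show "y \<in> blk r b" using assms(1) unfolding mem_cell mem_blk by linarith
qed

lemma cells_subset_blk:
  assumes "r > 0"
  shows "y \<in> cellA r b \<Longrightarrow> y \<in> blk r b" "y \<in> cellB r b \<Longrightarrow> y \<in> blk r b"
    "y \<in> cell0 r b \<Longrightarrow> y \<in> blk r b" "y \<in> cell1 r b \<Longrightarrow> y \<in> blk r b"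
  using cell_subset_blk [OF assms, of 2 b] cell_subset_blk [OF assms, of "14/5" b]
    cell_subset_blk [OF assms, of "3/2" b] cell_subset_blk [OF assms, of "23/10" b]
  by (simp_all add: subset_iff del: split_paired_All)

lemma blk_disjoint:
  assumes "r > 0" "y \<in> blk r b" "y \<in> blk r b'"
  shows "b = b'"
proof -
  have *: "p = q" if "4 * r * real p \<le> t" "t < 4 * r * real p + 4 * r"
      "4 * r * real q \<le> t" "t < 4 * r * real q + 4 * r" for p q t
  proof -
    have "4 * r * real p < 4 * r * (real q + 1)" "4 * r * real q < 4 * r * (real p + 1)"
      using that by (auto simp: distrib_left)
    then have "real p < real q + 1" "real q < real p + 1"
      using assms(1) by (auto simp: mult_less_cancel_left_pos)
    then show ?thesis by linarith
  qed
  show ?thesis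
    using assms(2,3) *[of "fst b" "fst y" "fst b'"] *[of "snd b" "snd y" "snd b'"]
    unfolding mem_blk by (auto intro: prod_eqI)
qed

lemma flip_cell0: "r > 0 \<Longrightarrow> flip r b y \<in> cell0 r b \<longleftrightarrow> y \<in> cell1 r b"
  and flip_cell1: "r > 0 \<Longrightarrow> flip r b y \<in> cell1 r b \<longleftrightarrow> y \<in> cell0 r b"
  and flip_cellA: "r > 0 \<Longrightarrow> flip r b y \<in> cellA r b \<longleftrightarrow> y \<in> cellA r b"
  and flip_cellB: "r > 0 \<Longrightarrow> flip r b y \<in> cellB r b \<longleftrightarrow> y \<in> cellB r b"
  by (auto simp: flip_def cell_def)

lemma flip_eq: "y \<notin> cell0 r b \<Longrightarrow> y \<notin> cell1 r b \<Longrightarrow> flip r b y = y"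
  by (simp add: flip_def)

lemma flip_blk: "r > 0 \<Longrightarrow> flip r b y \<in> blk r b \<longleftrightarrow> y \<in> blk r b"
  by (auto simp: flip_def cell_def blk_def)

lemma flip_other_blk:
  assumes "r > 0" "b \<noteq> b'"
  shows "flip r b y \<in> blk r b' \<longleftrightarrow> y \<in> blk r b'"
proof (cases "y \<in> blk r b")
  case True
  then have "flip r b y \<in> blk r b" using assms flip_blk by auto
  then show ?thesis using blk_disjoint [OF assms(1)] True assms(2) by blast
next
  case False
  then have "flip r b y = y"
    by (intro flip_eq) (use assms in \<open>auto dest: cells_subset_blk\<close>)
  then show ?thesis by simp
qed

lemma flip_outside: "r > 0 \<Longrightarrow> y \<notin> blk r b \<Longrightarrow> flip r b y = y"
  by (intro flip_eq) (auto dest: cells_subset_blk)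

lemma flip_other_cell:
  assumes "r > 0" "b \<noteq> b'" "0 \<le> z" "z \<le> 3"
  shows "flip r b y \<in> cell r z b' \<longleftrightarrow> y \<in> cell r z b'"
proof (cases "y \<in> blk r b")
  case True
  then have "flip r b y \<in> blk r b" using assms flip_blk by auto
  then show ?thesis using blk_disjoint [OF assms(1)] True assms cell_subset_blk by blast
next
  case False
  then show ?thesis using assms by (simp add: flip_outside)
qed

definition blk_in :: "real \<Rightarrow> real \<Rightarrow> block \<Rightarrow> bool" where
  "blk_in L r b \<longleftrightarrow> 4 * r * fst b + 4 * r \<le> L \<and> 4 * r * snd b + 4 * r \<le> L"

lemma blk_subset_box: "r > 0 \<Longrightarrow> blk_in L r b \<Longrightarrow> blk r b \<subseteq> torus_box L"
proof
  fix y assume "r > 0" "blk_in L r b" "y \<in> blk r b"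
  moreover have "0 \<le> 4 * r * fst b" "0 \<le> 4 * r * snd b" using \<open>r > 0\<close> by auto
  ultimately show "y \<in> torus_box L"
    unfolding mem_blk mem_torus_box blk_in_def atLeastLessThan_iff by linarith
qed

text \<open>The margins are 3/2 r on the left and 11/10 r on the right. The interval does not
  straddle the cut of the circle, so the way around the torus also crosses one of the
  margins.\<close>

lemma circ_core_gt:
  assumes "r > 0" "0 \<le> a" "a + 4 * r \<le> L" "a + 3/2 * r \<le> y" "y < a + 29/10 * r"
    "z \<in> {0..<L}" "z \<notin> {a..<a + 4 * r}"
  shows "circ L y z > r"
  using assms by (auto simp: circ_def)

lemma core_far:
  assumes r: "r > 0" and b: "blk_in L r b" and z: "z \<in> torus_box L" "z \<notin> blk r b"
    and y: "y \<in> cellA r b \<union> cellB r b \<union> (cell0 r b \<union> cell1 r b)"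
  shows "torus_dist L y z > r"
proof -
  have y': "4 * r * fst b + 3/2 * r \<le> fst y" "fst y < 4 * r * fst b + 29/10 * r"
     "4 * r * snd b + 3/2 * r \<le> snd y" "snd y < 4 * r * snd b + 29/10 * r"
    using y r by (auto simp: cell_def)
  have z': "fst z \<in> {0..<L}" "snd z \<in> {0..<L}" using z by (auto simp: torus_box_def mem_Times_iff)
  have "fst z \<notin> {4 * r * fst b..<4 * r * fst b + 4 * r} \<or> snd z \<notin> {4 * r * snd b..<4 * r * snd b + 4 * r}"
    using z by (auto simp: blk_def mem_Times_iff)
  then show ?thesis
  proof
    assume "fst z \<notin> {4 * r * fst b..<4 * r * fst b + 4 * r}"
    then have "circ L (fst y) (fst z) > r"
      using r b y' z' by (intro circ_core_gt) (auto simp: blk_in_def)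
    then show ?thesis using circ_le_torus_dist [of L y z] by linarith
  next
    assume "snd z \<notin> {4 * r * snd b..<4 * r * snd b + 4 * r}"
    then have "circ L (snd y) (snd z) > r"
      using r b y' z' by (intro circ_core_gt) (auto simp: blk_in_def)
    then show ?thesis using circ_le_torus_dist [of L y z] by linarith
  qed
qed

lemma circ_le_abs: "circ L a b \<le> \<bar>a - b\<bar>"
  by (simp add: circ_def)

lemma cell_adjacent:
  assumes r: "r > 0" and b: "blk_in L r b" and y: "y \<in> cell r z b" "y' \<in> cell r z' b"
    and z: "\<bar>z - z'\<bar> \<le> 8/10" "0 \<le> z" "z \<le> 3" "0 \<le> z'" "z' \<le> 3"
  shows "torus_dist L y y' \<le> r"
proof -
  have le: "\<bar>z * r - z' * r\<bar> \<le> 8/10 * r"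
    using mult_right_mono [OF z(1), of r] r by (simp add: abs_mult left_diff_distrib [symmetric])
  have "\<bar>fst y - fst y'\<bar> \<le> 9/10 * r" "\<bar>snd y - snd y'\<bar> \<le> 1/10 * r"
    using le y unfolding mem_cell by linarith+
  then have "circ L (fst y) (fst y') \<le> 9/10 * r" "circ L (snd y) (snd y') \<le> 1/10 * r"
    using circ_le_abs [of L "fst y" "fst y'"] circ_le_abs [of L "snd y" "snd y'"] by linarith+
  then show ?thesis
    by (rule torus_dist_leI [rotated 2])
       (use r y blk_subset_box [OF r b] cell_subset_blk [OF r z(2,3), of b] cell_subset_blk [OF r z(4,5), of b]
        in \<open>auto simp: power_mult_distrib power_divide\<close>)
qed

lemma cell0_cellB_far:
  assumes r: "r > 0" and b: "blk_in L r b" and y: "y \<in> cell0 r b" "y' \<in> cellB r b"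
  shows "torus_dist L y y' > r"
proof -
  have "4 * r * fst b \<ge> 0" using r by simp
  then have "circ L (fst y) (fst y') > r"
    using r b y unfolding circ_def mem_cell blk_in_def min_less_iff_conj
    by (intro conjI) linarith+
  then show ?thesis using circ_le_torus_dist [of L y y'] by linarith
qed

section \<open>Good blocks and their contribution to the count\<close>

definition in_blk :: "nat set \<Rightarrow> real \<Rightarrow> (nat \<Rightarrow> real \<times> real) \<Rightarrow> block \<Rightarrow> nat set" where
  "in_blk R r x b = {i \<in> R. x i \<in> blk r b}"

text \<open>The points are counted over the full family \<open>R\<close>, but all those in the block
  must have indices in \<open>E\<close>, the set over which the degree count is taken. Hence a flip
  changes that count, while differences at indices outside \<open>E\<close> do not notice
  it.\<close>

definition good :: "nat set \<Rightarrow> nat set \<Rightarrow> real \<Rightarrow> nat \<Rightarrow> (nat \<Rightarrow> real \<times> real) \<Rightarrow> block \<Rightarrow> bool" where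
  "good R E r d x b \<longleftrightarrow> in_blk R r x b \<subseteq> E \<and>
     card {i \<in> R. x i \<in> cellA r b} = d \<and> card {i \<in> R. x i \<in> cellB r b} = 2 \<and>
     card {i \<in> R. x i \<in> cell0 r b \<union> cell1 r b} = 1 \<and> card (in_blk R r x b) = d + 3"

definition up :: "nat set \<Rightarrow> real \<Rightarrow> (nat \<Rightarrow> real \<times> real) \<Rightarrow> block \<Rightarrow> bool" where
  "up R r x b \<longleftrightarrow> (\<exists>i\<in>R. x i \<in> cell1 r b)"

text \<open>The occupation numbers d, 2 and 1 of disjoint cells add up to d + 3, the number of
  points in the block, so no point lies outside these cells.\<close>

lemma good_core:
  assumes "r > 0" "finite R" and g: "good R E r d x b" and i: "i \<in> in_blk R r x b"
  shows "x i \<in> cellA r b \<union> cellB r b \<union> (cell0 r b \<union> cell1 r b)"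
proof -
  define PA where "PA = {i \<in> R. x i \<in> cellA r b}"
  define PB where "PB = {i \<in> R. x i \<in> cellB r b}"
  define PC where "PC = {i \<in> R. x i \<in> cell0 r b \<union> cell1 r b}"
  have fin: "finite PA" "finite PB" "finite PC" "finite (in_blk R r x b)"
    using assms by (auto simp: PA_def PB_def PC_def in_blk_def)
  have "card (PA \<union> PB \<union> PC) = card PA + card PB + card PC"
    using fin assms(1) by (subst card_Un_disjoint card_Un_disjoint; auto simp: PA_def PB_def PC_def cell_def)+
  also have "\<dots> = card (in_blk R r x b)"
    using g by (simp add: good_def PA_def PB_def PC_def)
  finally have "PA \<union> PB \<union> PC = in_blk R r x b"
    using fin
    by (intro card_seteq) (auto simp: PA_def PB_def PC_def in_blk_def dest: cells_subset_blk [OF assms(1)])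
  with i show ?thesis by (auto simp: PA_def PB_def PC_def)
qed

lemma good_split:
  assumes r: "r > 0" and R: "finite R" and b: "blk_in L r b" and g: "good R E r d x b"
    and box: "\<And>i. i \<in> R \<Longrightarrow> x i \<in> torus_box L" and X: "X \<subseteq> R"
  shows "wcount L r d x X = wcount L r d x (X - in_blk R r x b) + wcount L r d x (X \<inter> in_blk R r x b)"
  unfolding wcount_def
proof (rule gcount_split)
  show "finite X" using R X by (rule finite_subset [rotated])
  fix i j assume ij: "i \<in> X - in_blk R r x b" "j \<in> X \<inter> in_blk R r x b"
  then have "torus_dist L (x j) (x i) > r"
    using X box by (intro core_far [OF r b _ _ good_core [OF r R g]]) (auto simp: in_blk_def)
  then show "\<not> torus_dist L (x i) (x j) \<le> r \<and> \<not> torus_dist L (x j) (x i) \<le> r"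
    using torus_dist_commute [of L "x i" "x j"] by simp
qed

lemma good_count:
  assumes r: "r > 0" and R: "finite R" and b: "blk_in L r b" and g: "good R E r d x b"
  shows "wcount L r d x (in_blk R r x b) = real (d + 2) + of_bool (up R r x b)"
proof -
  define P where "P = in_blk R r x b"
  define PA where "PA = {i \<in> R. x i \<in> cellA r b}"
  define PB where "PB = {i \<in> R. x i \<in> cellB r b}"
  define adj where "adj = (\<lambda>i j. torus_dist L (x i) (x j) \<le> r)"
  have fin: "finite P" "finite PA" "finite PB" using R by (auto simp: P_def in_blk_def PA_def PB_def)
  have PR: "P \<subseteq> R" by (auto simp: P_def in_blk_def)
  have cards: "card PA = d" "card PB = 2" "card P = d + 3" using g by (auto simp: good_def PA_def PB_def P_def)
  obtain v where v: "{i \<in> R. x i \<in> cell0 r b \<union> cell1 r b} = {v}"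
    using g by (auto simp: good_def card_1_singleton_iff)
  have vR: "v \<in> R" "x v \<in> cell0 r b \<union> cell1 r b" using v by blast+
  have disj: "PA \<inter> PB = {}" "v \<notin> PA" "v \<notin> PB" using vR r by (auto simp: PA_def PB_def mem_cell)
  have P: "P = insert v (PA \<union> PB)"
  proof (intro equalityI subsetI)
    fix i assume i: "i \<in> P"
    then have "i \<in> R" "x i \<in> cellA r b \<union> cellB r b \<union> (cell0 r b \<union> cell1 r b)"
      using good_core [OF r R g] by (auto simp: P_def in_blk_def)
    then show "i \<in> insert v (PA \<union> PB)" using v by (auto simp: PA_def PB_def)
  next
    fix i assume "i \<in> insert v (PA \<union> PB)"
    then show "i \<in> P" using vR by (auto simp: P_def PA_def PB_def in_blk_def dest: cells_subset_blk [OF r])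
  qed
  have degA: "gdeg adj P i \<noteq> d" if i: "i \<in> PA" for i
  proof -
    have "{j \<in> P. j \<noteq> i \<and> adj i j} = P - {i}"
      using i vR by (auto simp: P adj_def PA_def PB_def intro: cell_adjacent [OF r b])
    moreover have "i \<in> P" using i by (simp add: P)
    ultimately show ?thesis using cards by (simp add: gdeg_def)
  qed
  \<comment> \<open>The second point of B matters here: a lone point of B would have degree exactly
    d while the moved point is in \<open>cell0\<close>, and a flip would then change two
    indicators.\<close>
  have degB: "gdeg adj P i \<noteq> d" if i: "i \<in> PB" for i
  proof -
    have "card (PA \<union> PB) = d + 2" using cards fin disj by (simp add: card_Un_disjoint)
    then have "card (PA \<union> PB - {i}) = d + 1" using i by (simp add: card_Diff_singleton)
    moreover have "PA \<union> PB - {i} \<subseteq> {j \<in> P. j \<noteq> i \<and> adj i j}"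
      using i by (auto simp: P adj_def PA_def PB_def intro: cell_adjacent [OF r b])
    then have "card (PA \<union> PB - {i}) \<le> gdeg adj P i"
      unfolding gdeg_def using fin by (intro card_mono) auto
    ultimately show ?thesis by simp
  qed
  have degv: "gdeg adj P v \<noteq> d \<longleftrightarrow> up R r x b"
  proof (cases "x v \<in> cell1 r b")
    case True
    have "{j \<in> P. j \<noteq> v \<and> adj v j} = PA \<union> PB"
      using True disj by (auto simp: P adj_def PA_def PB_def intro: cell_adjacent [OF r b])
    then have "gdeg adj P v = d + 2" using cards fin disj by (simp add: gdeg_def card_Un_disjoint)
    then show ?thesis using True vR by (auto simp: up_def)
  next
    case False
    then have v0: "x v \<in> cell0 r b" using vR by auto
    have "{j \<in> P. j \<noteq> v \<and> adj v j} = PA"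
      using v0 disj
      by (auto simp: P adj_def PA_def PB_def intro: cell_adjacent [OF r b] dest: cell0_cellB_far [OF r b v0])
    moreover have "\<not> up R r x b" using False v by (auto simp: up_def)
    ultimately show ?thesis using cards by (simp add: gdeg_def)
  qed
  have "gcount adj d P = (\<Sum>i\<in>P. of_bool (gdeg adj P i \<noteq> d))" by (rule gcount_sum) fact
  also have "\<dots> = of_bool (gdeg adj P v \<noteq> d) + (\<Sum>i\<in>PA \<union> PB. of_bool (gdeg adj P i \<noteq> d))"
    using fin disj by (simp add: P)
  also have "(\<Sum>i\<in>PA \<union> PB. of_bool (gdeg adj P i \<noteq> d)) = (\<Sum>i\<in>PA \<union> PB. 1 :: real)"
    using degA degB by (intro sum.cong) auto
  also have "\<dots> = real (d + 2)" using cards fin disj by (simp add: card_Un_disjoint)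
  finally show ?thesis by (simp add: wcount_def P_def adj_def degv [unfolded P_def adj_def])
qed

text \<open>The map acts on every coordinate, whatever the configuration, so that it preserves the
  product law; in a good block this moves exactly one point.\<close>

definition flipc :: "nat set \<Rightarrow> real \<Rightarrow> block \<Rightarrow> (nat \<Rightarrow> real \<times> real) \<Rightarrow> nat \<Rightarrow> real \<times> real" where
  "flipc R r b x = (\<lambda>i\<in>R. flip r b (x i))"

lemma in_blk_flipc: "r > 0 \<Longrightarrow> in_blk R r (flipc R r b x) b' = in_blk R r x b'"
  by (cases "b = b'") (auto simp: in_blk_def flipc_def flip_blk flip_other_blk)

lemma good_flipc:
  assumes "r > 0"
  shows "good R E r d (flipc R r b x) b' = good R E r d x b'"
proof (cases "b = b'")
  case True
  have "{i \<in> R. flipc R r b x i \<in> cellA r b'} = {i \<in> R. x i \<in> cellA r b'}"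
    "{i \<in> R. flipc R r b x i \<in> cellB r b'} = {i \<in> R. x i \<in> cellB r b'}"
    "{i \<in> R. flipc R r b x i \<in> cell0 r b' \<union> cell1 r b'} = {i \<in> R. x i \<in> cell0 r b' \<union> cell1 r b'}"
    using True by (auto simp: flipc_def flip_cellA [OF assms] flip_cellB [OF assms] flip_cell0 [OF assms] flip_cell1 [OF assms])
  then show ?thesis using assms by (simp add: good_def in_blk_flipc)
next
  case False
  have "{i \<in> R. flipc R r b x i \<in> cell r z b'} = {i \<in> R. x i \<in> cell r z b'}" if "0 \<le> z" "z \<le> 3" for z
    using assms False that by (auto simp: flipc_def flip_other_cell)
  moreover have "{i \<in> R. flipc R r b x i \<in> cell0 r b' \<union> cell1 r b'} = {i \<in> R. x i \<in> cell0 r b' \<union> cell1 r b'}"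
    using assms False by (auto simp: flipc_def flip_other_cell)
  ultimately show ?thesis using assms by (simp add: good_def in_blk_flipc)
qed

lemma up_flipc_other: "r > 0 \<Longrightarrow> b \<noteq> b' \<Longrightarrow> up R r (flipc R r b x) b' = up R r x b'"
  by (auto simp: up_def flipc_def flip_other_cell)

lemma up_flipc_same:
  assumes "r > 0" "good R E r d x b"
  shows "up R r (flipc R r b x) b \<longleftrightarrow> \<not> up R r x b"
proof -
  obtain v where v: "{i \<in> R. x i \<in> cell0 r b \<union> cell1 r b} = {v}"
    using assms by (auto simp: good_def card_1_singleton_iff)
  have disj: "cell0 r b \<inter> cell1 r b = {}" using assms by (auto simp: cell_def)
  have "up R r (flipc R r b x) b \<longleftrightarrow> x v \<in> cell0 r b"
    using v assms(1) by (auto simp: up_def flipc_def flip_cell1)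
  moreover have "up R r x b \<longleftrightarrow> x v \<in> cell1 r b" using v by (auto simp: up_def)
  ultimately show ?thesis using v disj by auto
qed

lemma flipc_box:
  assumes "r > 0" "blk_in L r b" "i \<in> R" "x i \<in> torus_box L"
  shows "flipc R r b x i \<in> torus_box L"
proof (cases "x i \<in> blk r b")
  case True
  then show ?thesis using assms blk_subset_box [of r L b] by (auto simp: flipc_def flip_blk)
next
  case False
  then show ?thesis using assms by (simp add: flipc_def flip_outside)
qed

lemma wcount_flipc_outside:
  assumes "r > 0" "X \<subseteq> R" "X \<inter> in_blk R r x b = {}"
  shows "wcount L r d (flipc R r b x) X = wcount L r d x X"
proof -
  have "flipc R r b x i = x i" if "i \<in> X" for i
    using assms that by (auto simp: flipc_def in_blk_def intro!: flip_outside)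
  then show ?thesis unfolding wcount_def by (intro gcount_cong) auto
qed

text \<open>A good block is isolated, so a flip inside it only moves the contribution of the block itself.\<close>
lemma wcount_flipc_good:
  assumes r: "r > 0" and R: "finite R" and b: "blk_in L r b" and g: "good R E r d x b"
    and box: "\<And>i. i \<in> R \<Longrightarrow> x i \<in> torus_box L" and E: "E \<subseteq> R"
  shows "wcount L r d (flipc R r b x) E = wcount L r d x E + (if up R r x b then -1 else 1)"
proof -
  let ?P = "in_blk R r x b"
  have P: "E \<inter> ?P = ?P" using g by (auto simp: good_def)
  have g': "good R E r d (flipc R r b x) b" using g good_flipc [OF r] by simp
  have "wcount L r d (flipc R r b x) E =
     wcount L r d (flipc R r b x) (E - ?P) + wcount L r d (flipc R r b x) ?P"
    using good_split [OF r R b g' flipc_box [OF r b _ box] E] P by (simp add: in_blk_flipc [OF r])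
  also have "wcount L r d (flipc R r b x) (E - ?P) = wcount L r d x (E - ?P)"
    using E by (intro wcount_flipc_outside [OF r]) auto
  also have "wcount L r d (flipc R r b x) ?P = real (d + 2) + of_bool (\<not> up R r x b)"
    using good_count [OF r R b g'] up_flipc_same [OF r g] by (simp add: in_blk_flipc [OF r])
  finally show ?thesis
    using good_split [OF r R b g box E] good_count [OF r R b g] P by simp
qed

text \<open>The index u lies outside \<open>E\<close>, hence outside the block. The block is
  isolated, so its contribution is the same with and without u and cancels, while the rest of the
  configuration is not touched by the flip.\<close>

lemma wcount_flipc_insert_diff:
  assumes r: "r > 0" and R: "finite R" and b: "blk_in L r b" and g: "good R E r d x b"
    and box: "\<And>i. i \<in> R \<Longrightarrow> x i \<in> torus_box L" and X: "insert u X \<subseteq> R" and u: "u \<notin> E"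
  shows "wcount L r d (flipc R r b x) (insert u X) - wcount L r d (flipc R r b x) X
       = wcount L r d x (insert u X) - wcount L r d x X"
proof -
  let ?P = "in_blk R r x b" and ?y = "flipc R r b x"
  have P: "u \<notin> ?P" using g u by (auto simp: good_def)
  have g': "good R E r d ?y b" using g good_flipc [OF r] by simp
  have *: "wcount L r d z (insert u X) - wcount L r d z X =
      wcount L r d z (insert u X - ?P) - wcount L r d z (X - ?P)"
    if "\<And>X. X \<subseteq> R \<Longrightarrow> wcount L r d z X = wcount L r d z (X - ?P) + wcount L r d z (X \<inter> ?P)" for z
    using that [of "insert u X"] that [of X] X P by (simp add: Int_insert_left)
  have "wcount L r d ?y (insert u X) - wcount L r d ?y X =
      wcount L r d ?y (insert u X - ?P) - wcount L r d ?y (X - ?P)"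
    by (rule *) (use good_split [OF r R b g' flipc_box [OF r b _ box]] in \<open>simp add: in_blk_flipc [OF r]\<close>)
  also have "\<dots> = wcount L r d x (insert u X - ?P) - wcount L r d x (X - ?P)"
    using X by (intro arg_cong2 [of _ _ _ _ "(-)"] wcount_flipc_outside [OF r]) auto
  also have "\<dots> = wcount L r d x (insert u X) - wcount L r d x X"
    by (rule * [symmetric]) (use good_split [OF r R b g box] in simp)
  finally show ?thesis .
qed

subsection \<open>Bounded differences and the uniform configuration\<close>

text \<open>Hoeffding's lemma without centring. In the induction below the mean is itself a function
  of the remaining coordinates and has to stay in the exponent.\<close>

lemma (in prob_space) hoeffding_bounded_range:
  fixes f :: "'a \<Rightarrow> real"
  assumes f [measurable]: "f \<in> borel_measurable M" and s: "s \<ge> 0"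
    and range: "\<And>x. x \<in> space M \<Longrightarrow> f x \<in> {a..b}"
  shows "expectation (\<lambda>x. exp (s * f x)) \<le> exp (s * expectation f + s\<^sup>2 * (b - a)\<^sup>2 / 8)"
proof (cases "s = 0")
  case True
  then show ?thesis by (simp add: prob_space)
next
  case False
  interpret interval_bounded_random_variable M f a b
    by unfold_locales (use range in auto)
  have bnd: "exp (s * (f x - expectation f)) \<le> exp (s * (b - expectation f))" if "x \<in> space M" for x
    using range [OF that] s by (auto intro!: mult_left_mono)
  have int: "integrable M (\<lambda>x. exp (s * (f x - expectation f)))"
    by (rule integrable_const_bound [where B = "exp (s * (b - expectation f))"]) (use bnd in auto)
  have "ennreal (expectation (\<lambda>x. exp (s * (f x - expectation f)))) \<le> ennreal (exp (s\<^sup>2 * (b - a)\<^sup>2 / 8))"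
    using Hoeffdings_lemma_nn_integral [of s] False s int
    by (subst nn_integral_eq_integral [symmetric]) auto
  then have "expectation (\<lambda>x. exp (s * (f x - expectation f))) \<le> exp (s\<^sup>2 * (b - a)\<^sup>2 / 8)"
    by simp
  then have "exp (s * expectation f) * expectation (\<lambda>x. exp (s * (f x - expectation f))) \<le>
      exp (s * expectation f) * exp (s\<^sup>2 * (b - a)\<^sup>2 / 8)" by (intro mult_left_mono) auto
  also have "exp (s * expectation f) * expectation (\<lambda>x. exp (s * (f x - expectation f))) =
     expectation (\<lambda>x. exp (s * expectation f) * exp (s * (f x - expectation f)))"
    by simp
  also have "\<dots> = expectation (\<lambda>x. exp (s * f x))"
    by (intro Bochner_Integration.integral_cong) (auto simp: algebra_simps simp flip: exp_add)
  finally show ?thesis by (simp add: exp_add)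
qed

text \<open>Induction on the coordinates: Hoeffding's lemma integrates out coordinate i with the
  others fixed, and the partial mean inherits the bounded differences. The Laplace transform is kept
  instead of a tail bound, because an exponential moment is what the smoothing estimate
  consumes.\<close>

lemma mcdiarmid_mgf:
  fixes f :: "('i \<Rightarrow> 'a) \<Rightarrow> real"
  assumes "finite I" "prob_space P"
    and "f \<in> borel_measurable (PiM I (\<lambda>_. P))" "s \<ge> 0"
    and "\<And>x. x \<in> space (PiM I (\<lambda>_. P)) \<Longrightarrow> \<bar>f x\<bar> \<le> B"
    and "\<And>x i y. x \<in> space (PiM I (\<lambda>_. P)) \<Longrightarrow> i \<in> I \<Longrightarrow> y \<in> space P \<Longrightarrow> \<bar>f (x(i := y)) - f x\<bar> \<le> c"
  shows "(\<integral>x. exp (s * f x) \<partial>PiM I (\<lambda>_. P)) \<le>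
          exp (s * (\<integral>x. f x \<partial>PiM I (\<lambda>_. P)) + real (card I) * (s\<^sup>2 * c\<^sup>2 / 2))"
  using assms
proof (induction I arbitrary: f rule: finite_induct)
  case empty
  interpret prob_space "PiM {} (\<lambda>_::'i. P)" by (intro prob_space_PiM empty)
  show ?case by (simp add: PiM_empty lebesgue_integral_count_space_finite)
next
  case (insert i I)
  interpret P: prob_space P by fact
  interpret PS: product_sigma_finite "\<lambda>_::'i. P"
    by unfold_locales
  interpret I: prob_space "PiM I (\<lambda>_::'i. P)" by (intro prob_space_PiM insert)
  interpret J: prob_space "PiM (insert i I) (\<lambda>_::'i. P)" by (intro prob_space_PiM insert)
  note f = insert.prems(2) and s = insert.prems(3) and bdd = insert.prems(4) and diff = insert.prems(5)
  have upd_space: "x(i := y) \<in> space (PiM (insert i I) (\<lambda>_. P))"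
    if "x \<in> space (PiM I (\<lambda>_. P))" "y \<in> space P" for x y
    using that insert.hyps by (auto simp: space_PiM PiE_fun_upd)
  have meas2: "(\<lambda>(x, y). f (x(i := y))) \<in> borel_measurable (PiM I (\<lambda>_. P) \<Otimes>\<^sub>M P)"
    using measurable_compose [OF measurable_add_dim f] by (simp add: case_prod_unfold fun_upd_def)
  have measy: "(\<lambda>y. f (x(i := y))) \<in> borel_measurable P" if "x \<in> space (PiM I (\<lambda>_. P))" for x
    using measurable_compose [OF measurable_Pair1' [OF that] meas2] by simp
  define g where "g = (\<lambda>x. \<integral>y. f (x(i := y)) \<partial>P)"
  have g_meas: "g \<in> borel_measurable (PiM I (\<lambda>_. P))"
    unfolding g_def by (rule P.borel_measurable_lebesgue_integral) (use meas2 in simp)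
  have int_f: "integrable P (\<lambda>y. f (x(i := y)))" if "x \<in> space (PiM I (\<lambda>_. P))" for x
    by (rule P.integrable_const_bound [where B = B]) (use measy [OF that] bdd upd_space that in auto)
  have g_bdd: "\<bar>g x\<bar> \<le> B" if "x \<in> space (PiM I (\<lambda>_. P))" for x
  proof -
    have "\<bar>g x\<bar> \<le> (\<integral>y. \<bar>f (x(i := y))\<bar> \<partial>P)" unfolding g_def by (rule integral_abs_bound)
    also have "\<dots> \<le> (\<integral>y. B \<partial>P)"
      by (rule integral_mono) (use int_f [OF that] bdd upd_space that in auto)
    finally show ?thesis by (simp add: P.prob_space)
  qed
  have g_diff: "\<bar>g (x(j := z)) - g x\<bar> \<le> c"
    if x: "x \<in> space (PiM I (\<lambda>_. P))" and j: "j \<in> I" and z: "z \<in> space P" for x j z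
  proof -
    have x': "x(j := z) \<in> space (PiM I (\<lambda>_. P))"
      using x j z by (auto simp: space_PiM PiE_iff extensional_def)
    have "g (x(j := z)) - g x = (\<integral>y. f (x(j := z, i := y)) - f (x(i := y)) \<partial>P)"
      unfolding g_def by (rule Bochner_Integration.integral_diff [symmetric]) (use int_f x x' in auto)
    also have "\<bar>\<dots>\<bar> \<le> (\<integral>y. \<bar>f (x(j := z, i := y)) - f (x(i := y))\<bar> \<partial>P)" by (rule integral_abs_bound)
    also have "\<dots> \<le> (\<integral>y. c \<partial>P)"
    proof (rule integral_mono)
      fix y assume y: "y \<in> space P"
      have "i \<noteq> j" using j insert.hyps by auto
      then have "x(j := z, i := y) = (x(i := y))(j := z)" by (simp add: fun_upd_twist)
      then show "\<bar>f (x(j := z, i := y)) - f (x(i := y))\<bar> \<le> c"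
        using diff [OF upd_space [OF x y] insertI2 [OF j] z] by (simp only:)
    qed (use int_f x x' in auto)
    finally show ?thesis by (simp add: P.prob_space)
  qed
  have exp_int: "integrable (PiM (insert i I) (\<lambda>_. P)) (\<lambda>x. exp (s * f x))"
    by (rule J.integrable_const_bound [where B = "exp (s * B)"])
       (use f s bdd in \<open>auto intro!: mult_left_mono simp: abs_le_iff\<close>)
  have f_int: "integrable (PiM (insert i I) (\<lambda>_. P)) f"
    by (rule J.integrable_const_bound [where B = B]) (use f bdd in auto)
  have inner: "(\<integral>y. exp (s * f (x(i := y))) \<partial>P) \<le> exp (s\<^sup>2 * c\<^sup>2 / 2) * exp (s * g x)"
    if x: "x \<in> space (PiM I (\<lambda>_. P))" for x
  proof -
    obtain y0 where y0: "y0 \<in> space P" using P.not_empty by blast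
    \<comment> \<open>All values in coordinate i lie within c of the value at a reference point,
      hence in an interval of length 2c, and (2c)^2/8 = c^2/2.\<close>
    define h0 where "h0 = f (x(i := y0))"
    have "(\<integral>y. exp (s * f (x(i := y))) \<partial>P) \<le> exp (s * g x + s\<^sup>2 * (h0 + c - (h0 - c))\<^sup>2 / 8)"
      unfolding g_def
    proof (rule P.hoeffding_bounded_range [OF measy [OF x] s])
      fix y assume y: "y \<in> space P"
      show "f (x(i := y)) \<in> {h0 - c..h0 + c}"
        using diff [OF upd_space [OF x y0] insertI1 y]
        unfolding h0_def fun_upd_upd atLeastAtMost_iff by linarith
    qed
    also have "s\<^sup>2 * (h0 + c - (h0 - c))\<^sup>2 / 8 = s\<^sup>2 * c\<^sup>2 / 2" by (simp add: power2_eq_square)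
    finally show ?thesis by (simp only: exp_add mult.commute)
  qed
  have "(\<integral>x. exp (s * f x) \<partial>PiM (insert i I) (\<lambda>_. P)) =
      (\<integral>x. (\<integral>y. exp (s * f (x(i := y))) \<partial>P) \<partial>PiM I (\<lambda>_. P))"
    by (rule PS.product_integral_insert) (use insert exp_int in auto)
  also have "\<dots> \<le> (\<integral>x. exp (s\<^sup>2 * c\<^sup>2 / 2) * exp (s * g x) \<partial>PiM I (\<lambda>_. P))"
  proof (rule integral_mono')
    show "integrable (PiM I (\<lambda>_. P)) (\<lambda>x. exp (s\<^sup>2 * c\<^sup>2 / 2) * exp (s * g x))"
      by (rule I.integrable_const_bound [where B = "exp (s\<^sup>2 * c\<^sup>2 / 2) * exp (s * B)"])
         (use g_meas s g_bdd in \<open>auto intro!: mult_left_mono simp: abs_le_iff\<close>)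
  qed (use inner in auto)
  also have "\<dots> = exp (s\<^sup>2 * c\<^sup>2 / 2) * (\<integral>x. exp (s * g x) \<partial>PiM I (\<lambda>_. P))" by simp
  also have "\<dots> \<le> exp (s\<^sup>2 * c\<^sup>2 / 2) *
      exp (s * (\<integral>x. g x \<partial>PiM I (\<lambda>_. P)) + real (card I) * (s\<^sup>2 * c\<^sup>2 / 2))"
    by (intro mult_left_mono insert.IH insert.prems g_meas g_bdd g_diff) auto
  also have "(\<integral>x. g x \<partial>PiM I (\<lambda>_. P)) = (\<integral>x. f x \<partial>PiM (insert i I) (\<lambda>_. P))"
    unfolding g_def by (rule PS.product_integral_insert [symmetric]) (use insert f_int in auto)
  finally show ?case
    using insert.hyps by (simp add: algebra_simps add_divide_distrib flip: exp_add)
qed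

lemma measurable_card_Collect [measurable (raw)]:
  assumes "finite X" and "\<And>i. i \<in> X \<Longrightarrow> Measurable.pred M (Q i)"
  shows "(\<lambda>x. card {i \<in> X. Q i x}) \<in> measurable M (count_space UNIV)"
proof -
  have "(\<lambda>x. card {i \<in> X. Q i x}) = (\<lambda>x. \<Sum>i\<in>X. if Q i x then 1 else 0)"
    using assms(1) by (auto simp: sum.If_cases Int_def)
  also have "\<dots> \<in> measurable M (count_space UNIV)"
    using assms by measurable
  finally show ?thesis .
qed

lemma measurable_torus_dist [measurable (raw)]:
  assumes "f \<in> borel_measurable M" "g \<in> borel_measurable M"
  shows "(\<lambda>x. torus_dist L (f x) (g x)) \<in> borel_measurable M"
proof -
  have [measurable]: "fst \<in> borel_measurable (borel :: (real \<times> real) measure)"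
    "snd \<in> borel_measurable (borel :: (real \<times> real) measure)"
    by (intro borel_measurable_continuous_onI continuous_intros)+
  note assms [measurable]
  show ?thesis unfolding torus_dist_def by measurable
qed

lemma blk_borel [measurable]: "blk r b \<in> sets borel"
  unfolding blk_def by (intro borel_Times) auto

lemma cell_borel [measurable]: "cell r z b \<in> sets borel"
  unfolding cell_def by (intro borel_Times) auto

lemma torus_box_borel [measurable]: "torus_box L \<in> sets borel"
  unfolding torus_box_def by (intro borel_Times) auto

lemma emeasure_lborel_ivl2:
  fixes a b c d :: real
  assumes "a \<le> b" "c \<le> d"
  shows "emeasure lborel ({a..<b} \<times> {c..<d}) = ennreal ((b - a) * (d - c))"
proof -
  have "emeasure (lborel \<Otimes>\<^sub>M lborel) ({a..<b} \<times> {c..<d}) = emeasure lborel {a..<b} * emeasure lborel {c..<d}"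
    by (rule lborel.emeasure_pair_measure_Times) auto
  also have "\<dots> = ennreal ((b - a) * (d - c))" using assms by (simp add: ennreal_mult)
  finally show ?thesis by (simp add: lborel_prod)
qed

section \<open>Uniform points on the torus and invariance of their law under flips\<close>

definition upoint :: "nat \<Rightarrow> (real \<times> real) measure" where
  "upoint n = uniform_measure lborel (torus_box (side n))"

lemma sets_upoint [measurable_cong, simp]: "sets (upoint n) = sets borel"
  by (simp add: upoint_def)

lemma space_upoint [simp]: "space (upoint n) = UNIV"
  by (simp add: upoint_def)

lemma emeasure_torus_box: "emeasure lborel (torus_box (side n)) = ennreal n"
  by (simp add: torus_box_def side_def emeasure_lborel_ivl2)

lemma prob_space_upoint: "n \<ge> 1 \<Longrightarrow> prob_space (upoint n)"
  unfolding upoint_def by (rule prob_space_uniform_measure) (auto simp: emeasure_torus_box)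

lemma emeasure_upoint: "A \<in> sets borel \<Longrightarrow> emeasure (upoint n) A = emeasure lborel (torus_box (side n) \<inter> A) / ennreal n"
  unfolding upoint_def by (subst emeasure_uniform_measure) (auto simp: emeasure_torus_box)

lemma AE_upoint_box: "n \<ge> 1 \<Longrightarrow> AE y in upoint n. y \<in> torus_box (side n)"
  unfolding upoint_def by (rule AE_uniform_measureI) auto

lemma measurable_flip [measurable]: "flip r b \<in> borel_measurable borel"
  unfolding flip_def by measurable

text \<open>The flip exchanges two disjoint cells that are translates of each other and fixes the
  rest, so translation invariance of Lebesgue measure suffices.\<close>

lemma distr_upoint_flip:
  assumes r: "r > 0" and b: "blk_in (side n) r b"
  shows "distr (upoint n) (upoint n) (flip r b) = upoint n"
proof (rule measure_eqI)
  fix A assume "A \<in> sets (distr (upoint n) (upoint n) (flip r b))"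
  then have A [measurable]: "A \<in> sets borel" by simp
  let ?B = "torus_box (side n)" and ?R = "torus_box (side n) - cell0 r b - cell1 r b"
  have disj: "cell0 r b \<inter> cell1 r b = {}" using r by (auto simp: mem_cell)
  have sub: "cell0 r b \<subseteq> ?B" "cell1 r b \<subseteq> ?B"
    using blk_subset_box [OF r b] by (auto dest: cells_subset_blk [OF r])
  have split: "emeasure lborel (?B \<inter> X) = emeasure lborel (cell0 r b \<inter> X) + emeasure lborel (cell1 r b \<inter> X)
       + emeasure lborel (?R \<inter> X)" if [measurable]: "X \<in> sets borel" for X
  proof -
    have "?B \<inter> X = (cell0 r b \<inter> X \<union> cell1 r b \<inter> X) \<union> ?R \<inter> X" using sub by auto
    also have "emeasure lborel \<dots> = emeasure lborel (cell0 r b \<inter> X \<union> cell1 r b \<inter> X) + emeasure lborel (?R \<inter> X)"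
      by (rule plus_emeasure [symmetric]) auto
    also have "emeasure lborel (cell0 r b \<inter> X \<union> cell1 r b \<inter> X) = emeasure lborel (cell0 r b \<inter> X) + emeasure lborel (cell1 r b \<inter> X)"
      by (rule plus_emeasure [symmetric]) (use disj in auto)
    finally show ?thesis .
  qed
  have shift: "emeasure lborel ((\<lambda>y. v + y) -` X) = emeasure lborel X" if [measurable]: "X \<in> sets borel"
    for v :: "real \<times> real" and X
  proof -
    have "emeasure lborel X = emeasure (distr lborel borel ((+) v)) X" by (simp add: lborel_distr_plus)
    also have "\<dots> = emeasure lborel ((\<lambda>y. v + y) -` X)" by (subst emeasure_distr) auto
    finally show ?thesis by simp
  qed
  let ?F = "flip r b -` A"
  have F [measurable]: "?F \<in> sets borel"
    using measurable_sets [OF measurable_flip A] by simp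
  have "cell0 r b \<inter> ?F = (\<lambda>y. (8/10 * r, 0) + y) -` (cell1 r b \<inter> A)"
    by (auto simp: flip_def mem_cell)
  then have 0: "emeasure lborel (cell0 r b \<inter> ?F) = emeasure lborel (cell1 r b \<inter> A)"
    using shift [of "cell1 r b \<inter> A" "(8/10 * r, 0)"] by simp
  have "cell1 r b \<inter> ?F = (\<lambda>y. (- 8/10 * r, 0) + y) -` (cell0 r b \<inter> A)"
    using r by (auto simp: flip_def mem_cell)
  then have 1: "emeasure lborel (cell1 r b \<inter> ?F) = emeasure lborel (cell0 r b \<inter> A)"
    using shift [of "cell0 r b \<inter> A" "(- 8/10 * r, 0)"] by simp
  have 2: "?R \<inter> ?F = ?R \<inter> A" by (auto simp: flip_def)
  have "emeasure (distr (upoint n) (upoint n) (flip r b)) A = emeasure (upoint n) ?F"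
    by (subst emeasure_distr) auto
  also have "\<dots> = emeasure (upoint n) A"
    unfolding emeasure_upoint [OF F] emeasure_upoint [OF A] split [OF F] split [OF A] 0 1 2 by (simp add: ac_simps)
  finally show "emeasure (distr (upoint n) (upoint n) (flip r b)) A = emeasure (upoint n) A" .
qed simp

text \<open>The index set is separate from n, which only fixes the torus; this allows more
  coordinates than points, to hold the independent copies.\<close>

definition cfg :: "nat set \<Rightarrow> nat \<Rightarrow> (nat \<Rightarrow> real \<times> real) measure" where
  "cfg R n = PiM R (\<lambda>_. upoint n)"

lemma sets_cfg [measurable_cong]: "sets (cfg R n) = sets (PiM R (\<lambda>_. borel))"
  unfolding cfg_def by (intro sets_PiM_cong) auto

lemma prob_space_cfg: "n \<ge> 1 \<Longrightarrow> prob_space (cfg R n)"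
  unfolding cfg_def by (intro prob_space_PiM prob_space_upoint)

lemma AE_cfg_box:
  assumes "n \<ge> 1" "finite R"
  shows "AE x in cfg R n. \<forall>i\<in>R. x i \<in> torus_box (side n)"
  unfolding cfg_def using assms
  by (intro AE_finite_allI AE_PiM_component) (auto intro: prob_space_upoint AE_upoint_box)

lemma distr_cfg_flipc:
  assumes "r > 0" "blk_in (side n) r b" "n \<ge> 1" "finite R"
  shows "distr (cfg R n) (cfg R n) (flipc R r b) = cfg R n"
proof -
  have "flipc R r b = compose R (flip r b)" by (simp add: fun_eq_iff flipc_def compose_def)
  then show ?thesis
    using distr_PiM_finite_prob_space' [OF assms(4), of "\<lambda>_. upoint n" "\<lambda>_. upoint n" "flip r b"] assms
    by (simp add: cfg_def prob_space_upoint distr_upoint_flip)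
qed

lemma measurable_cfg_coord: "i \<in> R \<Longrightarrow> (\<lambda>x. x i) \<in> measurable (cfg R n) borel"
  using measurable_component_singleton [of i R "\<lambda>_. upoint n"] by (simp add: cfg_def)

lemma measurable_flipc: "flipc R r b \<in> measurable (cfg R n) (cfg R n)"
  unfolding flipc_def using measurable_compose [OF measurable_cfg_coord measurable_flip]
  by (subst (2) cfg_def, intro measurable_restrict) simp

lemma measurable_wcount:
  assumes "X \<subseteq> R" "finite R"
  shows "(\<lambda>x. wcount L r d x X) \<in> borel_measurable (cfg R n)"
proof -
  have [measurable]: "(\<lambda>x. x i) \<in> measurable (cfg R n) borel" if "i \<in> X" for i
    using assms that by (intro measurable_cfg_coord) auto
  have "finite X" using assms finite_subset by blast
  show ?thesis unfolding wcount_def gcount_def gdeg_def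
    using \<open>finite X\<close> by measurable
qed

lemma measurable_good:
  assumes "finite R"
  shows "Measurable.pred (cfg R n) (\<lambda>x. good R E r d x b)"
proof -
  have [measurable]: "(\<lambda>x. x i) \<in> measurable (cfg R n) borel" if "i \<in> R" for i
    using that by (rule measurable_cfg_coord)
  have "in_blk R r x b \<subseteq> E \<longleftrightarrow> (\<forall>i\<in>R. x i \<in> blk r b \<longrightarrow> i \<in> E)" for x by (auto simp: in_blk_def)
  then show ?thesis unfolding good_def using assms
    by (simp add: in_blk_def) measurable
qed

subsection \<open>Smoothing of characteristic functions by flips\<close>

lemma cis_borel_measurable [measurable]: "cis \<in> borel_measurable borel"
  by (intro borel_measurable_continuous_onI continuous_intros)

definition blkset :: "real \<Rightarrow> real \<Rightarrow> block set" where
  "blkset L r = {..<nat \<lfloor>L / (4 * r)\<rfloor>} \<times> {..<nat \<lfloor>L / (4 * r)\<rfloor>}"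

lemma finite_blkset [simp]: "finite (blkset L r)"
  by (simp add: blkset_def)

lemma blkset_blk_in:
  assumes "r > 0" "L > 0" "b \<in> blkset L r"
  shows "blk_in L r b"
proof -
  have *: "4 * r * real p + 4 * r \<le> L" if "p < nat \<lfloor>L / (4 * r)\<rfloor>" for p
  proof -
    have "real p + 1 \<le> L / (4 * r)" using that by linarith
    then have "(real p + 1) * (4 * r) \<le> L" using assms by (simp add: pos_le_divide_eq)
    then show ?thesis by (simp add: algebra_simps)
  qed
  show ?thesis using assms by (auto simp: blkset_def blk_in_def intro: *)
qed

definition good_num :: "nat set \<Rightarrow> nat set \<Rightarrow> real \<Rightarrow> nat \<Rightarrow> real \<Rightarrow> (nat \<Rightarrow> real \<times> real) \<Rightarrow> nat" where
  "good_num R E r d L x = card {b \<in> blkset L r. good R E r d x b}"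

text \<open>The factor left in a good block by averaging e^{itW} over the configuration and its
  flip. The sign is negative in the upper position, where the flip lowers the count.\<close>

definition qfac :: "nat set \<Rightarrow> nat set \<Rightarrow> real \<Rightarrow> nat \<Rightarrow> real \<Rightarrow> (nat \<Rightarrow> real \<times> real) \<Rightarrow> block \<Rightarrow> complex" where
  "qfac R E r d t x b =
     (if good R E r d x b then (1 + cis (if up R r x b then - t else t)) / 2 else 1)"

lemma cmod_one_plus_cis: "cmod ((1 + cis t) / 2) = \<bar>cos (t / 2)\<bar>"
proof -
  have "1 + cis t = cis (t / 2) * of_real (2 * cos (t / 2))"
  proof -
    have "cis (t / 2) * of_real (2 * cos (t / 2)) = cis (t / 2) * (cis (t / 2) + cis (- (t / 2)))"
      by (simp add: complex_eq_iff)
    also have "\<dots> = 1 + cis t" by (simp add: distrib_left cis_mult)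
    finally show ?thesis by simp
  qed
  then have "cmod (1 + cis t) = 2 * \<bar>cos (t / 2)\<bar>" by (simp only: norm_mult norm_cis norm_of_real abs_mult)
  then show ?thesis by (simp add: norm_divide)
qed

lemma cos_half_decay:
  assumes "\<bar>t\<bar> \<le> pi"
  shows "\<bar>cos (t / 2)\<bar> \<le> exp (- (t\<^sup>2 / 24))"
proof -
  have "cos (t / 2) \<ge> 0" using assms by (intro cos_ge_zero) auto
  moreover have "cos (t / 2) \<le> 1 - (t / 2)\<^sup>2 / 6"
    by (rule cos_le_one_minus_square) (use assms pi_less_4 in auto)
  moreover have "1 + - (t\<^sup>2 / 24) \<le> exp (- (t\<^sup>2 / 24))" by (rule exp_ge_add_one_self)
  ultimately show ?thesis by (simp add: power_divide)
qed

text \<open>The rate s is left free below t^2/24: it will be a smaller multiple of t^2, so that the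
  quadratic term of the exponential moment stays below the linear one.\<close>

lemma prod_cmod_qfac:
  assumes "\<bar>t\<bar> \<le> pi" "0 \<le> s" "s \<le> t\<^sup>2 / 24"
  shows "cmod (\<Prod>b\<in>blkset L r. qfac R E r d t x b) \<le> exp (- (s * good_num R E r d L x))"
proof -
  have "cmod (\<Prod>b\<in>blkset L r. qfac R E r d t x b) = (\<Prod>b\<in>blkset L r. cmod (qfac R E r d t x b))"
    by (simp add: prod_norm)
  also have "\<dots> \<le> (\<Prod>b\<in>blkset L r. if good R E r d x b then exp (- s) else 1)"
  proof (rule prod_mono, intro conjI norm_ge_zero)
    fix b
    have "\<bar>cos (t / 2)\<bar> \<le> exp (- s)"
      by (rule order_trans [OF cos_half_decay [OF assms(1)]]) (use assms(3) in simp)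
    then show "cmod (qfac R E r d t x b) \<le> (if good R E r d x b then exp (- s) else 1)"
      using cmod_one_plus_cis [of t] cmod_one_plus_cis [of "- t"] by (simp add: qfac_def)
  qed
  also have "\<dots> = exp (- s) ^ good_num R E r d L x"
    by (simp add: prod.If_cases good_num_def Int_def)
  also have "\<dots> = exp (- (s * good_num R E r d L x))"
    by (simp add: exp_of_nat_mult [symmetric] mult.commute)
  finally show ?thesis .
qed

lemma up_measurable:
  assumes "finite R"
  shows "Measurable.pred (cfg R n) (\<lambda>x. up R r x b)"
proof -
  have [measurable]: "(\<lambda>x. x i) \<in> measurable (cfg R n) borel" if "i \<in> R" for i
    using that by (rule measurable_cfg_coord)
  show ?thesis unfolding up_def using assms by measurable
qed

lemma qfac_measurable:
  assumes "finite R"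
  shows "(\<lambda>x. qfac R E r d t x b) \<in> borel_measurable (cfg R n)"
  unfolding qfac_def using up_measurable [OF assms] measurable_good [OF assms] by measurable

lemma cmod_qfac_le_1: "cmod (qfac R E r d t x b) \<le> 1"
  using cmod_one_plus_cis [of t] cmod_one_plus_cis [of "- t"] by (simp add: qfac_def)

lemma qfac_flipc_other: "r > 0 \<Longrightarrow> b \<noteq> b' \<Longrightarrow> qfac R E r d t (flipc R r b x) b' = qfac R E r d t x b'"
  by (simp add: qfac_def good_flipc up_flipc_other)

text \<open>The flip preserves both the law and the event that b is good. On that event the integral
  of G equals that of G times the phase, hence also the mean of the two.\<close>

lemma flip_average:
  fixes G :: "(nat \<Rightarrow> real \<times> real) \<Rightarrow> complex"
  assumes r: "r > 0" and n: "n \<ge> 1" and R: "finite R" and b: "blk_in (side n) r b"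
    and G [measurable]: "G \<in> borel_measurable (cfg R n)"
    and bdd: "AE x in cfg R n. cmod (G x) \<le> B"
    and flip: "AE x in cfg R n. good R E r d x b \<longrightarrow>
        G (flipc R r b x) = cis (if up R r x b then - t else t) * G x"
  shows "(\<integral>x. G x \<partial>cfg R n) = (\<integral>x. G x * qfac R E r d t x b \<partial>cfg R n)"
proof -
  interpret prob_space "cfg R n" by (rule prob_space_cfg [OF n])
  note [measurable] = measurable_good [OF R] up_measurable [OF R] qfac_measurable [OF R] measurable_flipc
  define g where "g = (\<lambda>x. of_bool (good R E r d x b) :: complex)"
  define e where "e = (\<lambda>x. cis (if up R r x b then - t else t))"
  have [measurable]: "g \<in> borel_measurable (cfg R n)" "e \<in> borel_measurable (cfg R n)"
    unfolding g_def e_def by measurable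
  have int: "integrable (cfg R n) (\<lambda>x. u x * G x)"
    if [measurable]: "u \<in> borel_measurable (cfg R n)" and u: "\<And>x. cmod (u x) \<le> 1" for u
  proof (rule integrable_const_bound [where B = "1 * B"])
    show "AE x in cfg R n. cmod (u x * G x) \<le> 1 * B"
      using bdd unfolding norm_mult by eventually_elim (use u in \<open>intro mult_mono; auto\<close>)
  qed measurable
  have g1: "cmod (g x) \<le> 1" for x by (simp add: g_def)
  have e1: "cmod (e x) = 1" for x by (simp add: e_def)
  have "(\<integral>x. g x * G x \<partial>cfg R n) = (\<integral>x. g x * G x \<partial>distr (cfg R n) (cfg R n) (flipc R r b))"
    by (simp add: distr_cfg_flipc [OF r b n R])
  also have "\<dots> = (\<integral>x. g (flipc R r b x) * G (flipc R r b x) \<partial>cfg R n)"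
    by (rule integral_distr) measurable
  also have "\<dots> = (\<integral>x. (g x * e x) * G x \<partial>cfg R n)"
  proof (rule integral_cong_AE)
    show "AE x in cfg R n. g (flipc R r b x) * G (flipc R r b x) = g x * e x * G x"
      using flip by eventually_elim (simp add: g_def e_def good_flipc [OF r])
  qed measurable
  finally have eq: "(\<integral>x. g x * G x \<partial>cfg R n) = (\<integral>x. (g x * e x) * G x \<partial>cfg R n)" .
  have i1: "integrable (cfg R n) (\<lambda>x. (1 - g x) * G x)"
    by (rule int) (auto simp: g_def)
  have i2: "integrable (cfg R n) (\<lambda>x. g x * G x)" by (rule int) (auto simp: g1)
  have i3: "integrable (cfg R n) (\<lambda>x. (g x * e x) * G x)"
    by (rule int) (auto simp: g1 e1 norm_mult)
  have "(\<integral>x. G x * qfac R E r d t x b \<partial>cfg R n) =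
      (\<integral>x. (1 - g x) * G x + (1/2) * (g x * G x) + (1/2) * ((g x * e x) * G x) \<partial>cfg R n)"
    by (intro Bochner_Integration.integral_cong) (auto simp: qfac_def g_def e_def field_simps)
  also have "\<dots> = (\<integral>x. (1 - g x) * G x \<partial>cfg R n) + (1/2) * (\<integral>x. g x * G x \<partial>cfg R n)
      + (1/2) * (\<integral>x. (g x * e x) * G x \<partial>cfg R n)"
    using i1 i2 i3 by simp
  also have "\<dots> = (\<integral>x. (1 - g x) * G x \<partial>cfg R n) + (\<integral>x. g x * G x \<partial>cfg R n)"
    unfolding eq [symmetric] by simp
  also have "\<dots> = (\<integral>x. (1 - g x) * G x + g x * G x \<partial>cfg R n)"
    using i1 i2 by simp
  also have "\<dots> = (\<integral>x. G x \<partial>cfg R n)"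
    by (simp add: algebra_simps)
  finally show ?thesis by simp
qed

text \<open>Blocks are treated one at a time: the factors already gained belong to other blocks and
  are invariant under the flip of the current one, so they can be counted as part of G.\<close>

lemma flip_average_prod:
  fixes G :: "(nat \<Rightarrow> real \<times> real) \<Rightarrow> complex"
  assumes r: "r > 0" and n: "n \<ge> 1" and R: "finite R" and "finite Bs"
    and b: "\<And>b. b \<in> Bs \<Longrightarrow> blk_in (side n) r b"
    and G [measurable]: "G \<in> borel_measurable (cfg R n)"
    and bdd: "AE x in cfg R n. cmod (G x) \<le> B"
    and flip: "\<And>b. b \<in> Bs \<Longrightarrow> AE x in cfg R n. good R E r d x b \<longrightarrow>
        G (flipc R r b x) = cis (if up R r x b then - t else t) * G x"
  shows "(\<integral>x. G x \<partial>cfg R n) = (\<integral>x. G x * (\<Prod>b\<in>Bs. qfac R E r d t x b) \<partial>cfg R n)"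
  using \<open>finite Bs\<close> b flip
proof (induction Bs rule: finite_induct)
  case empty
  then show ?case by simp
next
  case (insert b Bs)
  note [measurable] = qfac_measurable [OF R]
  let ?Q = "\<lambda>x. \<Prod>b\<in>Bs. qfac R E r d t x b"
  have "(\<integral>x. G x \<partial>cfg R n) = (\<integral>x. G x * ?Q x \<partial>cfg R n)"
    by (rule insert.IH) (use insert.prems in auto)
  also have "\<dots> = (\<integral>x. G x * ?Q x * qfac R E r d t x b \<partial>cfg R n)"
  proof (rule flip_average [OF r n R])
    show "AE x in cfg R n. cmod (G x * ?Q x) \<le> B"
      using bdd
    proof eventually_elim
      case (elim x)
      have "cmod (?Q x) \<le> 1" unfolding prod_norm [symmetric]
        by (intro prod_le_1) (auto simp: cmod_qfac_le_1)
      then have "cmod (G x) * cmod (?Q x) \<le> cmod (G x) * 1" by (intro mult_left_mono) auto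
      then show ?case using elim by (simp add: norm_mult)
    qed
    have "?Q (flipc R r b x) = ?Q x" for x
    proof (rule prod.cong [OF refl])
      fix b' assume "b' \<in> Bs"
      then have "b \<noteq> b'" using insert.hyps by blast
      then show "qfac R E r d t (flipc R r b x) b' = qfac R E r d t x b'" by (rule qfac_flipc_other [OF r])
    qed
    moreover have "AE x in cfg R n. good R E r d x b \<longrightarrow>
        G (flipc R r b x) = cis (if up R r x b then - t else t) * G x"
      using insert.prems by auto
    ultimately show "AE x in cfg R n. good R E r d x b \<longrightarrow>
        G (flipc R r b x) * ?Q (flipc R r b x) = cis (if up R r x b then - t else t) * (G x * ?Q x)"
      by (auto elim!: eventually_mono simp: mult.assoc split del: if_split)
    show "blk_in (side n) r b" using insert.prems by auto
  qed measurable
  finally show ?case using insert.hyps by (simp add: mult_ac)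
qed

lemma good_num_measurable:
  assumes "finite R"
  shows "(\<lambda>x. good_num R E r d L x) \<in> measurable (cfg R n) (count_space UNIV)"
  unfolding good_num_def using measurable_good [OF assms] by (intro measurable_card_Collect) auto

lemma side_pos: "n \<ge> 1 \<Longrightarrow> side n > 0"
  by (simp add: side_def)

definition flip_inv :: "nat set \<Rightarrow> nat set \<Rightarrow> real \<Rightarrow> nat \<Rightarrow> nat \<Rightarrow> ((nat \<Rightarrow> real \<times> real) \<Rightarrow> complex) \<Rightarrow> bool" where
  "flip_inv R E r d n H \<longleftrightarrow> (\<forall>b x. blk_in (side n) r b \<longrightarrow> good R E r d x b \<longrightarrow>
      (\<forall>i\<in>R. x i \<in> torus_box (side n)) \<longrightarrow> H (flipc R r b x) = H x)"

text \<open>The indicator \<open>A\<close> of the set where H lives stays inside the expectation,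
  beside the exponential of the number of good blocks; the two are decoupled only later.\<close>

lemma cf_smoothing:
  fixes H :: "(nat \<Rightarrow> real \<times> real) \<Rightarrow> complex"
  assumes r: "r > 0" and n: "n \<ge> 1" and R: "finite R" and E: "E \<subseteq> R"
    and H [measurable]: "H \<in> borel_measurable (cfg R n)"
    and A: "Measurable.pred (cfg R n) A" and B: "B \<ge> 0"
    and bdd: "AE x in cfg R n. cmod (H x) \<le> B * of_bool (A x)"
    and inv: "flip_inv R E r d n H"
    and t: "\<bar>t\<bar> \<le> pi" and s: "0 \<le> s" "s \<le> t\<^sup>2 / 24"
  shows "cmod (\<integral>x. H x * cis (t * wcount (side n) r d x E) \<partial>cfg R n) \<le>
     B * (\<integral>x. of_bool (A x) * exp (- (s * good_num R E r d (side n) x)) \<partial>cfg R n)"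
proof -
  interpret prob_space "cfg R n" by (rule prob_space_cfg [OF n])
  note [measurable] = measurable_wcount [OF E R] qfac_measurable [OF R] A good_num_measurable [OF R]
  let ?w = "\<lambda>x. wcount (side n) r d x E"
  let ?G = "\<lambda>x. H x * cis (t * ?w x)"
  let ?Q = "\<lambda>x. \<Prod>b\<in>blkset (side n) r. qfac R E r d t x b"
  have bdd': "AE x in cfg R n. cmod (?G x) \<le> B"
    using bdd by eventually_elim (auto simp: norm_mult of_bool_def split: if_splits intro: order_trans B)
  have flip: "AE x in cfg R n. good R E r d x b \<longrightarrow>
        ?G (flipc R r b x) = cis (if up R r x b then - t else t) * ?G x" if "b \<in> blkset (side n) r" for b
    using AE_cfg_box [OF n R]
  proof eventually_elim
    case (elim x)
    show ?case
    proof
      assume g: "good R E r d x b"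
      have b: "blk_in (side n) r b" by (rule blkset_blk_in [OF r side_pos [OF n] that])
      have "H (flipc R r b x) = H x" using inv b g elim unfolding flip_inv_def by blast
      moreover have "?w (flipc R r b x) = ?w x + (if up R r x b then -1 else 1)"
        by (rule wcount_flipc_good [OF r R b g _ E]) (use elim in auto)
      ultimately show "?G (flipc R r b x) = cis (if up R r x b then - t else t) * ?G x"
        by (simp add: distrib_left cis_mult [symmetric] cis_divide [symmetric] right_diff_distrib mult_ac
             flip: cis_inverse)
    qed
  qed
  have "(\<integral>x. ?G x \<partial>cfg R n) = (\<integral>x. ?G x * ?Q x \<partial>cfg R n)"
    by (rule flip_average_prod [OF r n R _ _ _ bdd' flip])
       (auto intro: blkset_blk_in [OF r side_pos [OF n]])
  also have "cmod \<dots> \<le> (\<integral>x. cmod (?G x * ?Q x) \<partial>cfg R n)"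
    by (rule integral_norm_bound)
  also have "\<dots> \<le> (\<integral>x. B * (of_bool (A x) * exp (- (s * good_num R E r d (side n) x))) \<partial>cfg R n)"
  proof (rule integral_mono_AE')
    show "integrable (cfg R n) (\<lambda>x. B * (of_bool (A x) * exp (- (s * good_num R E r d (side n) x))))"
      by (rule integrable_const_bound [where B = "B"])
         (use B s in \<open>auto simp: of_bool_def abs_mult intro!: mult_left_le\<close>)
    show "AE x in cfg R n. cmod (?G x * ?Q x) \<le> B * (of_bool (A x) * exp (- (s * good_num R E r d (side n) x)))"
      using bdd
    proof eventually_elim
      case (elim x)
      have "cmod (?G x * ?Q x) = cmod (H x) * cmod (?Q x)" by (simp add: norm_mult)
      also have "\<dots> \<le> (B * of_bool (A x)) * exp (- (s * good_num R E r d (side n) x))"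
        using elim prod_cmod_qfac [OF t s] B by (intro mult_mono) auto
      finally show ?case by simp
    qed
  qed (use B in auto)
  also have "\<dots> = B * (\<integral>x. of_bool (A x) * exp (- (s * good_num R E r d (side n) x)) \<partial>cfg R n)" by simp
  finally show ?thesis .
qed

lemma blks_containing:
  assumes "r > 0"
  shows "finite {b. z \<in> blk r b}" "card {b. z \<in> blk r b} \<le> 1"
proof -
  have "\<exists>b. {b. z \<in> blk r b} \<subseteq> {b}"
  proof (cases "{b. z \<in> blk r b} = {}")
    case False
    then obtain b where "z \<in> blk r b" by blast
    then show ?thesis using blk_disjoint [OF assms] by blast
  qed blast
  then show "finite {b. z \<in> blk r b}" "card {b. z \<in> blk r b} \<le> 1"
    using card_mono [of "{_}" "{b. z \<in> blk r b}"] finite_subset [of "{b. z \<in> blk r b}" "{_}"] by auto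
qed

text \<open>The count on the left is independent of the points indexed by \<open>S\<close>.\<close>
lemma good_num_delete:
  assumes r: "r > 0" and S: "finite S" and ES: "E \<inter> S = {}"
  shows "good_num (R - S) E r d L x \<le> good_num R E r d L x + card S"
proof -
  define blkof where "blkof = (\<lambda>i. {b. x i \<in> blk r b})"
  have one: "finite (blkof i) \<and> card (blkof i) \<le> 1" for i
    using blks_containing [OF r, of "x i"] by (simp add: blkof_def)
  have "{b \<in> blkset L r. good (R - S) E r d x b} \<subseteq> {b \<in> blkset L r. good R E r d x b} \<union> (\<Union>i\<in>S. blkof i)"
  proof
    fix b assume b: "b \<in> {b \<in> blkset L r. good (R - S) E r d x b}"
    show "b \<in> {b \<in> blkset L r. good R E r d x b} \<union> (\<Union>i\<in>S. blkof i)"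
    proof (cases "\<exists>i\<in>S. x i \<in> blk r b")
      case False
      then have "{i \<in> R - S. x i \<in> Z} = {i \<in> R. x i \<in> Z}" if "Z \<subseteq> blk r b" for Z
        using that by auto
      from this [of "blk r b"] this [of "cellA r b"] this [of "cellB r b"] this [of "cell0 r b \<union> cell1 r b"]
      have "good (R - S) E r d x b = good R E r d x b"
        by (simp add: good_def in_blk_def cell_subset_blk [OF r])
      then show ?thesis using b by auto
    qed (auto simp: blkof_def)
  qed
  then have "good_num (R - S) E r d L x \<le> card ({b \<in> blkset L r. good R E r d x b} \<union> (\<Union>i\<in>S. blkof i))"
    unfolding good_num_def using S one by (intro card_mono) auto
  also have "\<dots> \<le> good_num R E r d L x + card (\<Union>i\<in>S. blkof i)"
    unfolding good_num_def by (rule card_Un_le)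
  also have "card (\<Union>i\<in>S. blkof i) \<le> (\<Sum>i\<in>S. card (blkof i))" by (rule card_UN_le [OF S])
  also have "\<dots> \<le> (\<Sum>i\<in>S. 1)" using one by (intro sum_mono) auto
  finally show ?thesis by simp
qed

text \<open>Moving one point affects only the block it leaves and the block it enters.\<close>

lemma good_num_upd:
  assumes r: "r > 0" and R: "finite R"
  shows "good_num R E r d L x \<le> good_num R E r d L (x(i := y)) + 2"
proof -
  define X where "X = {b. x i \<in> blk r b} \<union> {b. y \<in> blk r b}"
  note one = blks_containing [OF r]
  have X: "finite X" "card X \<le> 2"
    using one [of "x i"] one [of y] card_Un_le [of "{b. x i \<in> blk r b}" "{b. y \<in> blk r b}"] by (auto simp: X_def)
  have "{b \<in> blkset L r. good R E r d x b} \<subseteq> {b \<in> blkset L r. good R E r d (x(i := y)) b} \<union> X"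
  proof
    fix b assume b: "b \<in> {b \<in> blkset L r. good R E r d x b}"
    show "b \<in> {b \<in> blkset L r. good R E r d (x(i := y)) b} \<union> X"
    proof (cases "b \<in> X")
      case False
      then have "{j \<in> R. (x(i := y)) j \<in> Z} = {j \<in> R. x j \<in> Z}" if "Z \<subseteq> blk r b" for Z
        using that by (auto simp: X_def)
      from this [of "blk r b"] this [of "cellA r b"] this [of "cellB r b"] this [of "cell0 r b \<union> cell1 r b"]
      have "good R E r d (x(i := y)) b = good R E r d x b"
        by (simp add: good_def in_blk_def cell_subset_blk [OF r])
      then show ?thesis using b by auto
    qed auto
  qed
  then have "good_num R E r d L x \<le> card ({b \<in> blkset L r. good R E r d (x(i := y)) b} \<union> X)"
    unfolding good_num_def using X by (intro card_mono) auto
  also have "\<dots> \<le> good_num R E r d L (x(i := y)) + card X"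
    unfolding good_num_def by (rule card_Un_le)
  finally show ?thesis using X by simp
qed

subsection \<open>Probability of a good block\<close>

text \<open>Independence of two disjoint groups of coordinates. That a function depends on one group
  only is expressed by pointwise invariance, which avoids restricting functions to
  subproducts.\<close>

lemma integral_PiM_split_mult:
  fixes f g :: "('i \<Rightarrow> 'a) \<Rightarrow> 'b :: {real_normed_field, banach, second_countable_topology}"
  assumes "finite R" "S \<subseteq> R" "prob_space P"
    and f: "f \<in> borel_measurable (PiM R (\<lambda>_. P))" "\<And>x. norm (f x) \<le> K1"
    and g: "g \<in> borel_measurable (PiM R (\<lambda>_. P))" "\<And>x. norm (g x) \<le> K2"
    and dep_f: "\<And>x x'. (\<And>i. i \<in> S \<Longrightarrow> x i = x' i) \<Longrightarrow> f x = f x'"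
    and dep_g: "\<And>x x'. (\<And>i. i \<in> R - S \<Longrightarrow> x i = x' i) \<Longrightarrow> g x = g x'"
  shows "(\<integral>x. f x * g x \<partial>PiM R (\<lambda>_. P)) = (\<integral>x. f x \<partial>PiM R (\<lambda>_. P)) * (\<integral>x. g x \<partial>PiM R (\<lambda>_. P))"
proof -
  interpret P: prob_space P by fact
  interpret PS: product_sigma_finite "\<lambda>_::'i. P" by unfold_locales
  interpret R: prob_space "PiM R (\<lambda>_. P)" by (intro prob_space_PiM assms)
  interpret S: prob_space "PiM S (\<lambda>_. P)" by (intro prob_space_PiM assms)
  interpret T: prob_space "PiM (R - S) (\<lambda>_. P)" by (intro prob_space_PiM assms)
  obtain x0 where x0: "x0 \<in> space (PiM S (\<lambda>_. P))" using S.not_empty by blast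
  obtain y0 where y0: "y0 \<in> space (PiM (R - S) (\<lambda>_. P))" using T.not_empty by blast
  have U: "S \<union> (R - S) = R" using assms(2) by auto
  have fold: "(\<integral>x. h x \<partial>PiM R (\<lambda>_. P)) = (\<integral>x. (\<integral>y. h (merge S (R - S) (x, y)) \<partial>PiM (R - S) (\<lambda>_. P)) \<partial>PiM S (\<lambda>_. P))"
    if h: "h \<in> borel_measurable (PiM R (\<lambda>_. P))" and b: "\<And>x. norm (h x) \<le> K" for h :: "('i \<Rightarrow> 'a) \<Rightarrow> 'b" and K
  proof -
    have "integrable (PiM R (\<lambda>_. P)) h"
      by (rule R.integrable_const_bound [where B = K]) (use h b in auto)
    then show ?thesis
      using PS.product_integral_fold [of S "R - S" h] assms(1,2) U finite_subset by auto
  qed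
  have f0: "f (merge S (R - S) (x, y)) = f (merge S (R - S) (x, y0))" for x y
    by (rule dep_f) (simp add: merge_def)
  have g0: "g (merge S (R - S) (x, y)) = g (merge S (R - S) (x0, y))" for x y
    by (rule dep_g) (simp add: merge_def)
  have fg: "f (merge S (R - S) (x, y)) * g (merge S (R - S) (x, y)) =
      f (merge S (R - S) (x, y0)) * g (merge S (R - S) (x0, y))" for x y
    using f0 [of x y] g0 [of x y] by (rule arg_cong2)
  define a where "a = (\<integral>x. f (merge S (R - S) (x, y0)) \<partial>PiM S (\<lambda>_. P))"
  define b where "b = (\<integral>y. g (merge S (R - S) (x0, y)) \<partial>PiM (R - S) (\<lambda>_. P))"
  have "norm (f x * g x) \<le> K1 * K2" for x
    unfolding norm_mult using order_trans [OF norm_ge_zero f(2)]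
    by (intro mult_mono f(2) g(2)) auto
  then have "(\<integral>x. f x * g x \<partial>PiM R (\<lambda>_. P)) =
     (\<integral>x. (\<integral>y. f (merge S (R - S) (x, y)) * g (merge S (R - S) (x, y)) \<partial>PiM (R - S) (\<lambda>_. P)) \<partial>PiM S (\<lambda>_. P))"
    using f(1) g(1) by (intro fold) auto
  also have "\<dots> = (\<integral>x. (\<integral>y. f (merge S (R - S) (x, y0)) * g (merge S (R - S) (x0, y)) \<partial>PiM (R - S) (\<lambda>_. P)) \<partial>PiM S (\<lambda>_. P))"
    by (simp only: fg)
  also have "\<dots> = a * b" by (simp add: a_def b_def)
  finally have 1: "(\<integral>x. f x * g x \<partial>PiM R (\<lambda>_. P)) = a * b" .
  have 2: "(\<integral>x. f x \<partial>PiM R (\<lambda>_. P)) = a"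
  proof -
    have "(\<integral>x. f x \<partial>PiM R (\<lambda>_. P)) =
        (\<integral>x. (\<integral>y. f (merge S (R - S) (x, y)) \<partial>PiM (R - S) (\<lambda>_. P)) \<partial>PiM S (\<lambda>_. P))"
      by (rule fold) (use f in auto)
    also have "\<dots> = (\<integral>x. (\<integral>y. f (merge S (R - S) (x, y0)) \<partial>PiM (R - S) (\<lambda>_. P)) \<partial>PiM S (\<lambda>_. P))"
      by (intro Bochner_Integration.integral_cong refl f0)
    finally show ?thesis by (simp add: a_def T.prob_space)
  qed
  have 3: "(\<integral>x. g x \<partial>PiM R (\<lambda>_. P)) = b"
  proof -
    have "(\<integral>x. g x \<partial>PiM R (\<lambda>_. P)) =
        (\<integral>x. (\<integral>y. g (merge S (R - S) (x, y)) \<partial>PiM (R - S) (\<lambda>_. P)) \<partial>PiM S (\<lambda>_. P))"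
      by (rule fold) (use g in auto)
    also have "\<dots> = (\<integral>x. (\<integral>y. g (merge S (R - S) (x0, y)) \<partial>PiM (R - S) (\<lambda>_. P)) \<partial>PiM S (\<lambda>_. P))"
      by (intro Bochner_Integration.integral_cong refl g0)
    finally show ?thesis by (simp add: b_def S.prob_space)
  qed
  show ?thesis by (simp add: 1 2 3)
qed

lemma measure_upoint:
  assumes "A \<in> sets borel" "A \<subseteq> torus_box (side n)" "emeasure lborel A = ennreal a" "a \<ge> 0" "n \<ge> 1"
  shows "measure (upoint n) A = a / n"
proof -
  have "torus_box (side n) \<inter> A = A" using assms by auto
  then have "emeasure (upoint n) A = ennreal a / ennreal n" using assms by (simp add: emeasure_upoint)
  also have "\<dots> = ennreal (a / n)" using assms by (intro divide_ennreal) auto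
  finally show ?thesis using assms by (simp add: measure_def)
qed

lemma measure_upoint_blk:
  assumes "r > 0" "n \<ge> 1" "blk_in (side n) r b"
  shows "measure (upoint n) (blk r b) = 16 * r\<^sup>2 / n"
proof (rule measure_upoint)
  show "emeasure lborel (blk r b) = ennreal (16 * r\<^sup>2)"
    using assms unfolding blk_def
    by (subst emeasure_lborel_ivl2) (auto simp: power2_eq_square)
qed (use assms blk_subset_box in auto)

lemma measure_upoint_cell:
  assumes "r > 0" "n \<ge> 1" "blk_in (side n) r b" "0 \<le> z" "z \<le> 3"
  shows "measure (upoint n) (cell r z b) = r\<^sup>2 / 100 / n"
proof (rule measure_upoint)
  show "emeasure lborel (cell r z b) = ennreal (r\<^sup>2 / 100)"
    using assms unfolding cell_def
    by (subst emeasure_lborel_ivl2) (auto simp: power2_eq_square)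
  show "cell r z b \<subseteq> torus_box (side n)"
    using cell_subset_blk [of r z b] blk_subset_box [of r "side n" b] assms by blast
qed (use assms in auto)

text \<open>With k = d + 3: a cell has probability r^2/(100 n), and there are at least (n/(2k))^k
  choices of k indices, which gives the power. The remaining at most 4n points avoid a block of
  probability 16 r^2/n, which leaves at least exp(-2 * 16 r^2/n * 4n) = exp(-128 r^2).\<close>

definition good_prob :: "real \<Rightarrow> nat \<Rightarrow> real" where
  "good_prob r d = (r\<^sup>2 / 200 / (d + 3)) ^ (d + 3) * exp (- (128 * r\<^sup>2))"

text \<open>The events \<open>F J\<close>, for J a (d + 3)-subset of \<open>E\<close>, prescribe one
  arrangement: J is enumerated, its points fill A, B and \<open>cell0\<close> in that order, and all
  others avoid the block. They are disjoint because J can be read off as the set of indices in the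
  block, so their probabilities add up.\<close>

lemma prob_good_lower:
  fixes r :: real
  assumes r: "r > 0" and n: "n \<ge> 1" "n \<ge> 2 * (d + 3)" "n \<ge> 32 * r\<^sup>2"
    and R: "finite R" "card R \<le> 4 * n" and E: "E \<subseteq> R" "n \<le> 2 * card E"
    and b: "blk_in (side n) r b"
  shows "measure (cfg R n) {x \<in> space (cfg R n). good R E r d x b} \<ge> good_prob r d"
proof -
  interpret prob_space "cfg R n" by (rule prob_space_cfg [OF n(1)])
  interpret U: prob_space "upoint n" by (rule prob_space_upoint [OF n(1)])
  interpret FP: finite_product_prob_space "\<lambda>_::nat. upoint n" R
    by unfold_locales (rule R(1))
  let ?k = "d + 3"
  define q where "q = 16 * r\<^sup>2 / n"
  define h where "h = r\<^sup>2 / 100 / n"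
  have q: "0 \<le> q" "q \<le> 1/2" using n by (auto simp: q_def field_simps)
  have h: "h > 0" using r n by (simp add: h_def)
  define Js where "Js = {J. J \<subseteq> E \<and> card J = ?k}"
  have finE: "finite E" using E R finite_subset by blast
  have finJs: "finite Js" using finE by (simp add: Js_def)
  define e where "e = (\<lambda>J :: nat set. SOME e. bij_betw e J {..<?k})"
  have e: "bij_betw (e J) J {..<?k}" if "J \<in> Js" for J
  proof -
    have "finite J" "card J = ?k" using that finE finite_subset by (auto simp: Js_def)
    then have "\<exists>e. bij_betw e J {..<?k}"
      using ex_bij_betw_finite_nat [of J] by (auto simp: atLeast0LessThan)
    then show ?thesis unfolding e_def by (rule someI_ex)
  qed
  define Q where "Q = (\<lambda>J i. if i \<in> J then
       (if e J i < d then cellA r b else if e J i < d + 2 then cellB r b else cell0 r b) else - blk r b)"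
  define F where "F = (\<lambda>J. PiE R (Q J))"
  have Qsets: "Q J i \<in> sets (upoint n)" for J i
    by (auto simp: Q_def borel_comp)
  have Fsets: "F J \<in> events" for J
    unfolding F_def cfg_def using Qsets R by (intro sets_PiM_I_finite) auto
  have inblk: "in_blk R r x b = J" if "x \<in> F J" "J \<in> Js" for x J
  proof -
    have "x i \<in> blk r b \<longleftrightarrow> i \<in> J" if "i \<in> R" for i
    proof -
      have "x i \<in> Q J i" using \<open>x \<in> F J\<close> that by (auto simp: F_def)
      then show ?thesis by (auto simp: Q_def dest: cells_subset_blk [OF r] split: if_splits)
    qed
    then show ?thesis using that E by (auto simp: in_blk_def Js_def)
  qed
  have goodF: "good R E r d x b" if x: "x \<in> F J" and J: "J \<in> Js" for x J
  proof -
    have JE: "J \<subseteq> E" "J \<subseteq> R" "card J = ?k" using J E by (auto simp: Js_def)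
    have c: "{i \<in> R. x i \<in> Z} = {i \<in> J. e J i \<in> N}"
      if "Z \<subseteq> blk r b" "\<And>i. i \<in> J \<Longrightarrow> x i \<in> Z \<longleftrightarrow> e J i \<in> N" for Z N
      using inblk [OF x J] that JE by (auto simp: in_blk_def)
    have card: "card {i \<in> J. e J i \<in> N} = card N" if "N \<subseteq> {..<?k}" for N
    proof (rule bij_betw_same_card [of "e J"])
      show "bij_betw (e J) {i \<in> J. e J i \<in> N} N"
        unfolding bij_betw_def
      proof
        show "inj_on (e J) {i \<in> J. e J i \<in> N}"
          by (rule inj_on_subset [OF bij_betw_imp_inj_on [OF e [OF J]]]) auto
        have "N \<subseteq> e J ` J" using bij_betw_imp_surj_on [OF e [OF J]] that by simp
        then show "e J ` {i \<in> J. e J i \<in> N} = N" by blast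
      qed
    qed
    have xi: "x i \<in> (if e J i < d then cellA r b else if e J i < d + 2 then cellB r b else cell0 r b)"
      if "i \<in> J" for i
    proof -
      have "x i \<in> Q J i" using x that JE by (auto simp: F_def)
      then show ?thesis using that by (simp add: Q_def)
    qed
    have disj: "cellA r b \<inter> cellB r b = {}" "cellA r b \<inter> cell0 r b = {}" "cellB r b \<inter> cell0 r b = {}"
      "cellA r b \<inter> cell1 r b = {}" "cellB r b \<inter> cell1 r b = {}" "cell0 r b \<inter> cell1 r b = {}"
      using r by (auto simp: mem_cell)
    have cN: "card {i \<in> R. x i \<in> Z} = card N"
      if "Z \<subseteq> blk r b" "N \<subseteq> {..<?k}" "\<And>i. i \<in> J \<Longrightarrow> x i \<in> Z \<longleftrightarrow> e J i \<in> N" for Z N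
      using c [OF that(1,3)] card [OF that(2)] by simp
    have ek: "e J i < d + 3" if "i \<in> J" for i using e [OF J] that by (auto simp: bij_betw_def)
    have "card {i \<in> R. x i \<in> cellA r b} = card {..<d}"
    proof (rule cN)
      show "x i \<in> cellA r b \<longleftrightarrow> e J i \<in> {..<d}" if "i \<in> J" for i
        using disj xi [OF that] by (auto split: if_splits)
    qed (auto dest: cells_subset_blk [OF r])
    moreover have "card {i \<in> R. x i \<in> cellB r b} = card {d..<d + 2}"
    proof (rule cN)
      show "x i \<in> cellB r b \<longleftrightarrow> e J i \<in> {d..<d + 2}" if "i \<in> J" for i
        using disj xi [OF that] by (auto split: if_splits)
    qed (auto dest: cells_subset_blk [OF r])
    moreover have "card {i \<in> R. x i \<in> cell0 r b \<union> cell1 r b} = card {d + 2..<d + 3}"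
    proof (rule cN)
      show "x i \<in> cell0 r b \<union> cell1 r b \<longleftrightarrow> e J i \<in> {d + 2..<d + 3}" if "i \<in> J" for i
        using disj xi [OF that] ek [OF that] by (auto split: if_splits)
    qed (auto dest: cells_subset_blk [OF r])
    ultimately show ?thesis using inblk [OF x J] JE by (simp add: good_def)
  qed
  have mF: "measure (cfg R n) (F J) \<ge> h ^ ?k * exp (- (128 * r\<^sup>2))" if J: "J \<in> Js" for J
  proof -
    have JE: "J \<subseteq> R" "card J = ?k" "finite J"
      using J E finite_subset [OF _ finE] by (auto simp: Js_def)
    have 1: "measure (cfg R n) (F J) = (\<Prod>i\<in>R. measure (upoint n) (Q J i))"
      unfolding F_def cfg_def by (rule FP.prob_times) (rule Qsets)
    have "(\<Prod>i\<in>R. measure (upoint n) (Q J i)) = (\<Prod>i\<in>J. measure (upoint n) (Q J i)) * (\<Prod>i\<in>R - J. measure (upoint n) (Q J i))"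
      using JE R by (subst prod.subset_diff [of J R]) (auto simp: mult.commute)
    also have "(\<Prod>i\<in>J. measure (upoint n) (Q J i)) = (\<Prod>i\<in>J. h)"
      by (intro prod.cong) (auto simp: Q_def h_def measure_upoint_cell [OF r n(1) b])
    also have "(\<Prod>i\<in>R - J. measure (upoint n) (Q J i)) = (\<Prod>i\<in>R - J. 1 - q)"
    proof (intro prod.cong refl)
      fix i assume "i \<in> R - J"
      then have "Q J i = space (upoint n) - blk r b" by (auto simp: Q_def)
      then show "measure (upoint n) (Q J i) = 1 - q"
        using U.prob_compl [of "blk r b"] measure_upoint_blk [OF r n(1) b] by (simp add: q_def)
    qed
    finally have 2: "measure (cfg R n) (F J) = h ^ ?k * (1 - q) ^ card (R - J)"
      using 1 JE by simp
    \<comment> \<open>Valid for q \<le> 1/2, which is the condition n \<ge> 32 r^2.\<close>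
    have "exp (- (2 * q)) \<le> 1 - q"
    proof -
      have "exp (2 * q) * (1 - q) \<ge> (1 + 2 * q) * (1 - q)"
        using q by (intro mult_right_mono) (auto simp: add.commute exp_ge_add_one_self)
      also have "(1 + 2 * q) * (1 - q) = 1 + q * (1 - 2 * q)" by (simp add: algebra_simps)
      finally have "exp (2 * q) * (1 - q) \<ge> 1" using q mult_nonneg_nonneg [of q "1 - 2 * q"] by linarith
      then show ?thesis by (simp add: exp_minus field_simps)
    qed
    then have "exp (- (2 * q)) ^ (4 * n) \<le> (1 - q) ^ (4 * n)" by (intro power_mono) auto
    also have "\<dots> \<le> (1 - q) ^ card (R - J)"
      using q R card_mono [of R "R - J"] by (intro power_decreasing) auto
    also have "exp (- (2 * q)) ^ (4 * n) = exp (- (128 * r\<^sup>2))"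
      using n by (simp add: exp_of_nat_mult [symmetric] q_def)
    finally show ?thesis using h unfolding 2 by (intro mult_left_mono) auto
  qed
  have disj: "disjoint_family_on F Js"
    unfolding disjoint_family_on_def using inblk by blast
  have "good_prob r d \<le> card Js * (h ^ ?k * exp (- (128 * r\<^sup>2)))"
  proof -
    have le: "?k \<le> card E" using order_trans [OF n(2) E(2)] by simp
    have "(r\<^sup>2 / 200 / ?k) ^ ?k = (real n / 2 / ?k) ^ ?k * h ^ ?k"
      using n by (simp add: h_def flip: power_mult_distrib)
    also have "\<dots> \<le> (real (card E) / ?k) ^ ?k * h ^ ?k"
      using E h by (intro mult_right_mono power_mono divide_right_mono) auto
    also have "(real (card E) / ?k) ^ ?k \<le> real (card E choose ?k)"
      using binomial_ge_n_over_k_pow_k [OF le, where 'a = real] by simp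
    also have "card E choose ?k = card Js"
      using n_subsets [OF finE, of ?k] by (simp add: Js_def)
    finally have "(r\<^sup>2 / 200 / ?k) ^ ?k \<le> card Js * h ^ ?k" using h by (simp add: mult_right_mono)
    then have "(r\<^sup>2 / 200 / ?k) ^ ?k * exp (- (128 * r\<^sup>2)) \<le> card Js * h ^ ?k * exp (- (128 * r\<^sup>2))"
      by (intro mult_right_mono) auto
    then show ?thesis by (simp add: good_prob_def mult.assoc)
  qed
  also have "\<dots> = (\<Sum>J\<in>Js. h ^ ?k * exp (- (128 * r\<^sup>2)))" by simp
  also have "\<dots> \<le> (\<Sum>J\<in>Js. measure (cfg R n) (F J))" by (intro sum_mono mF)
  also have "\<dots> = measure (cfg R n) (\<Union>J\<in>Js. F J)"
    by (rule finite_measure_finite_Union [symmetric]) (use finJs Fsets disj in auto)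
  also have "\<dots> \<le> measure (cfg R n) {x \<in> space (cfg R n). good R E r d x b}"
  proof (rule finite_measure_mono)
    show "(\<Union>J\<in>Js. F J) \<subseteq> {x \<in> space (cfg R n). good R E r d x b}"
      using goodF Fsets sets.sets_into_space by fastforce
    show "{x \<in> space (cfg R n). good R E r d x b} \<in> events"
      using measurable_good [OF R(1)] by (simp add: pred_def)
  qed
  finally show ?thesis .
qed

subsection \<open>Uniform smoothing estimates\<close>

text \<open>There are at least n/(64 r^2) blocks: with u = sqrt n / (4r) \<ge> 1 the floor of u is
  at least u/2, and u^2/4 = n/(64 r^2).\<close>

definition good_rate :: "real \<Rightarrow> nat \<Rightarrow> real" where
  "good_rate r d = good_prob r d / (64 * r\<^sup>2)"

lemma good_prob_pos: "r > 0 \<Longrightarrow> good_prob r d > 0"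
  by (simp add: good_prob_def)

lemma good_rate_pos: "r > 0 \<Longrightarrow> good_rate r d > 0"
  by (simp add: good_rate_def good_prob_pos)

text \<open>The second condition provides d + 3 indices in any set of at least n/2; the third bounds
  the probability of a block by 1/2 and guarantees that a block fits into the torus.\<close>

definition n_large :: "real \<Rightarrow> nat \<Rightarrow> nat \<Rightarrow> bool" where
  "n_large r d n \<longleftrightarrow> n \<ge> 1 \<and> n \<ge> 2 * (d + 3) \<and> real n \<ge> 32 * r\<^sup>2"

lemma eventually_n_large: "eventually (n_large r d) sequentially"
proof -
  have "eventually (\<lambda>n. real n \<ge> 32 * r\<^sup>2) sequentially"
    using eventually_ge_at_top [of "nat \<lceil>32 * r\<^sup>2\<rceil>"] by eventually_elim linarith
  then show ?thesis unfolding n_large_def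
    by (intro eventually_conj eventually_ge_at_top)
qed

lemma card_blkset:
  assumes r: "r > 0" and n: "real n \<ge> 32 * r\<^sup>2"
  shows "real (card (blkset (side n) r)) \<ge> real n / (64 * r\<^sup>2)"
proof -
  define u where "u = side n / (4 * r)"
  have u2: "u\<^sup>2 = real n / (16 * r\<^sup>2)" by (simp add: u_def side_def power_divide power_mult_distrib)
  have u0: "u \<ge> 0" using r by (simp add: u_def side_def)
  have "u\<^sup>2 \<ge> 1" unfolding u2 using n r by (simp add: field_simps)
  then have u1: "u \<ge> 1" using u0 by (metis abs_of_nonneg abs_le_square_iff one_power2 abs_one)
  have "real (nat \<lfloor>u\<rfloor>) = of_int \<lfloor>u\<rfloor>" "\<lfloor>u\<rfloor> \<ge> 1" using u1 by (simp_all add: le_floor_iff)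
  then have "real (nat \<lfloor>u\<rfloor>) \<ge> u / 2" by linarith
  then have "real (nat \<lfloor>u\<rfloor>) ^ 2 \<ge> (u / 2)\<^sup>2" using u0 by (intro power_mono) auto
  then show ?thesis using u2
    by (simp add: blkset_def u_def [symmetric] card_cartesian_product power_divide power2_eq_square)
qed

lemma expectation_good_num:
  assumes r: "r > 0" and n: "n_large r d n"
    and R: "finite R" "card R \<le> 4 * n" and E: "E \<subseteq> R" "n \<le> 2 * card E"
  shows "(\<integral>x. real (good_num R E r d (side n) x) \<partial>cfg R n) \<ge> good_rate r d * n"
proof -
  have n': "n \<ge> 1" "n \<ge> 2 * (d + 3)" "real n \<ge> 32 * r\<^sup>2" using n by (auto simp: n_large_def)
  interpret prob_space "cfg R n" by (rule prob_space_cfg [OF n'(1)])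
  have ev: "{x \<in> space (cfg R n). good R E r d x b} \<in> events" for b
    using measurable_good [OF R(1)] by (simp add: pred_def)
  have "(\<integral>x. real (good_num R E r d (side n) x) \<partial>cfg R n) =
      (\<integral>x. (\<Sum>b\<in>blkset (side n) r. indicator {x \<in> space (cfg R n). good R E r d x b} x) \<partial>cfg R n)"
    by (intro Bochner_Integration.integral_cong)
       (auto simp: good_num_def indicator_def sum.If_cases Int_def)
  also have "\<dots> = (\<Sum>b\<in>blkset (side n) r. measure (cfg R n) {x \<in> space (cfg R n). good R E r d x b})"
    using ev by (subst Bochner_Integration.integral_sum) (auto simp: emeasure_eq_measure)
  also have "\<dots> \<ge> (\<Sum>b\<in>blkset (side n) r. good_prob r d)"
    by (intro sum_mono prob_good_lower r n' R E blkset_blk_in [OF r side_pos [OF n'(1)]])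
  finally have "(\<integral>x. real (good_num R E r d (side n) x) \<partial>cfg R n) \<ge> card (blkset (side n) r) * good_prob r d"
    by simp
  moreover have "good_rate r d * n \<le> card (blkset (side n) r) * good_prob r d"
    using mult_right_mono [OF card_blkset [OF r n'(3)], of "good_prob r d"] good_prob_pos [OF r, of d]
    by (simp add: good_rate_def mult.commute)
  ultimately show ?thesis by linarith
qed

text \<open>Bounded differences for the negative count: step 2 and at most 4n coordinates give the
  quadratic term 4n * 2^2 s^2/2 = 8 n s^2, against the mean of at least \<open>good_rate\<close>
  times n.\<close>

lemma exp_good_num:
  fixes r s :: real
  assumes r: "r > 0" and n: "n_large r d n"
    and R: "finite R" "card R \<le> 4 * n" and E: "E \<subseteq> R" "n \<le> 2 * card E" and s: "s \<ge> 0"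
  shows "(\<integral>x. exp (- (s * good_num R E r d (side n) x)) \<partial>cfg R n) \<le> exp (- (s * n * (good_rate r d - 8 * s)))"
proof -
  have n1: "n \<ge> 1" using n by (simp add: n_large_def)
  let ?f = "\<lambda>x. - real (good_num R E r d (side n) x)"
  note [measurable] = good_num_measurable [OF R(1)]
  have "(\<integral>x. exp (s * ?f x) \<partial>cfg R n) \<le> exp (s * (\<integral>x. ?f x \<partial>cfg R n) + real (card R) * (s\<^sup>2 * 2\<^sup>2 / 2))"
    unfolding cfg_def
  proof (rule mcdiarmid_mgf)
    show "?f \<in> borel_measurable (PiM R (\<lambda>_. upoint n))" unfolding cfg_def [symmetric] by measurable
    show "\<bar>?f x\<bar> \<le> card (blkset (side n) r)" for x
      unfolding good_num_def by (simp add: card_mono)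
    fix x :: "nat \<Rightarrow> real \<times> real" and i y
    have "good_num R E r d (side n) (x(i := y)) \<le> good_num R E r d (side n) ((x(i := y))(i := x i)) + 2"
      by (rule good_num_upd [OF r R(1)])
    moreover have "good_num R E r d (side n) x \<le> good_num R E r d (side n) (x(i := y)) + 2"
      by (rule good_num_upd [OF r R(1)])
    ultimately show "\<bar>?f (x(i := y)) - ?f x\<bar> \<le> 2" by simp
  qed (use R(1) prob_space_upoint [OF n1] s in auto)
  also have "\<dots> \<le> exp (- (s * n * (good_rate r d - 8 * s)))"
  proof -
    have "s * (good_rate r d * n) \<le> s * (\<integral>x. real (good_num R E r d (side n) x) \<partial>cfg R n)"
      by (intro mult_left_mono expectation_good_num r n R E s)
    moreover have "real (card R) * (s\<^sup>2 * 2\<^sup>2 / 2) \<le> real (4 * n) * (s\<^sup>2 * 2\<^sup>2 / 2)"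
      using R by (intro mult_right_mono) (auto simp del: of_nat_mult)
    ultimately show ?thesis by (simp add: algebra_simps power2_eq_square)
  qed
  finally show ?thesis by simp
qed

text \<open>For s = \<kappa> t^2, the bound t^2 \<le> 16 yields 8 s \<le> good_rate/2, since 256 = 2
  * 8 * 16; the bound 1/24 comes from the cosine. Half of the linear rate survives and becomes
  \<open>crate\<close>.\<close>

definition \<kappa> :: "real \<Rightarrow> nat \<Rightarrow> real" where
  "\<kappa> r d = min (1/24) (good_rate r d / 256)"

definition crate :: "real \<Rightarrow> nat \<Rightarrow> real" where
  "crate r d = \<kappa> r d * good_rate r d / 2"

lemma kappa_pos: "r > 0 \<Longrightarrow> \<kappa> r d > 0" and crate_pos: "r > 0 \<Longrightarrow> crate r d > 0"
  using good_rate_pos [of r d] by (auto simp: \<kappa>_def crate_def)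

lemma restrict_cfg:
  assumes "n \<ge> 1" "T \<subseteq> R" "finite R"
  shows "distr (cfg R n) (cfg T n) (\<lambda>x. restrict x T) = cfg T n"
proof -
  interpret product_prob_space "\<lambda>_::nat. upoint n" R
    using assms by (intro product_prob_spaceI prob_space_upoint)
  show ?thesis unfolding cfg_def by (rule distr_PiM_restrict_finite) (use assms finite_subset in auto)
qed

lemma good_num_cong:
  assumes "\<And>i. i \<in> R \<Longrightarrow> x i = x' i"
  shows "good_num R E r d L x = good_num R E r d L x'"
proof -
  have *: "{i \<in> R. x i \<in> Z} = {i \<in> R. x' i \<in> Z}" for Z using assms by auto
  show ?thesis unfolding good_num_def good_def in_blk_def by (simp only: *)
qed

text \<open>The event \<open>A\<close> depends on the points in S only. Counting good blocks without
  these points makes the count independent of \<open>A\<close>, so the probability of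
  \<open>A\<close> and the Gaussian factor multiply.\<close>

lemma cf_uniform_smoothing:
  fixes H :: "(nat \<Rightarrow> real \<times> real) \<Rightarrow> complex"
  assumes r: "r > 0" and n: "n_large r d n"
    and R: "finite R" "card R \<le> 4 * n" and S: "S \<subseteq> R" "card S \<le> 4"
    and E: "E \<subseteq> R - S" "n \<le> 2 * card E"
    and H: "H \<in> borel_measurable (cfg R n)"
    and A: "Measurable.pred (cfg R n) A" and B: "B \<ge> 0"
    and dep: "\<And>x x'. (\<And>i. i \<in> S \<Longrightarrow> x i = x' i) \<Longrightarrow> A x = A x'"
    and bdd: "AE x in cfg R n. cmod (H x) \<le> B * of_bool (A x)"
    and inv: "flip_inv R E r d n H"
    and t: "\<bar>t\<bar> \<le> pi"
  shows "cmod (\<integral>x. H x * cis (t * wcount (side n) r d x E) \<partial>cfg R n) \<le>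
     B * exp 3 * (\<integral>x. of_bool (A x) \<partial>cfg R n) * exp (- (crate r d * n * t\<^sup>2))"
proof -
  have n1: "n \<ge> 1" using n by (simp add: n_large_def)
  interpret prob_space "cfg R n" by (rule prob_space_cfg [OF n1])
  have fS: "finite S" using S R finite_subset by blast
  have ER: "E \<subseteq> R" "E \<inter> S = {}" using E by auto
  define s where "s = \<kappa> r d * t\<^sup>2"
  have t2: "t\<^sup>2 \<le> 16"
  proof -
    have "\<bar>t\<bar>\<^sup>2 \<le> 4\<^sup>2" using t pi_less_4 by (intro power_mono) auto
    then show ?thesis by simp
  qed
  have s0: "0 \<le> s" using kappa_pos [OF r, of d] by (simp add: s_def)
  have s1: "s \<le> t\<^sup>2 / 24" unfolding s_def
    using mult_right_mono [of "\<kappa> r d" "1/24" "t\<^sup>2"] by (simp add: \<kappa>_def)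
  have s2: "8 * s \<le> good_rate r d / 2"
  proof -
    have "s \<le> good_rate r d / 256 * 16" unfolding s_def
      using t2 good_rate_pos [OF r, of d] by (intro mult_mono) (auto simp: \<kappa>_def)
    then show ?thesis by simp
  qed
  note [measurable] = good_num_measurable [OF R(1)] A
  let ?m = "\<lambda>x. good_num (R - S) E r d (side n) x"
  have meas': "?m \<in> measurable (cfg R n) (count_space UNIV)"
  proof -
    have "(\<lambda>x. ?m (restrict x (R - S))) \<in> measurable (cfg R n) (count_space UNIV)"
      using measurable_compose [OF _ good_num_measurable [of "R - S"], of "\<lambda>x. restrict x (R - S)" "cfg R n"] R
      unfolding cfg_def by (auto intro!: measurable_restrict_subset)
    moreover have "?m (restrict x (R - S)) = ?m x" for x
      by (rule good_num_cong) simp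
    ultimately show ?thesis by simp
  qed
  note [measurable] = meas'
  have "cmod (\<integral>x. H x * cis (t * wcount (side n) r d x E) \<partial>cfg R n) \<le>
     B * (\<integral>x. of_bool (A x) * exp (- (s * good_num R E r d (side n) x)) \<partial>cfg R n)"
    by (rule cf_smoothing [OF r n1 R(1) ER(1) H A B bdd inv t s0 s1])
  also have "\<dots> \<le> B * (\<integral>x. exp 3 * (of_bool (A x) * exp (- (s * ?m x))) \<partial>cfg R n)"
  proof (rule mult_left_mono [OF integral_mono B])
    show "integrable (cfg R n) (\<lambda>x. of_bool (A x) * exp (- (s * good_num R E r d (side n) x)))"
      by (rule integrable_const_bound [where B = 1]) (use s0 in \<open>auto simp: of_bool_def\<close>)
    show "integrable (cfg R n) (\<lambda>x. exp 3 * (of_bool (A x) * exp (- (s * ?m x))))"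
      by (rule integrable_const_bound [where B = "exp 3"]) (use s0 in \<open>auto simp: of_bool_def\<close>)
    fix x
    have "?m x \<le> good_num R E r d (side n) x + 4"
      using good_num_delete [OF r fS ER(2), of R d "side n" x] S by linarith
    then have "s * ?m x \<le> s * (good_num R E r d (side n) x + 4)"
      using s0 by (intro mult_left_mono) auto
    \<comment> \<open>Up to four blocks are lost by deleting S, at a cost of exp(4s), and 4s \<le> 4
      * 16/24 < 3; hence the factor \<open>exp 3\<close>.\<close>
    moreover have "4 * s \<le> 3" using s1 t2 by simp
    ultimately have "- (s * good_num R E r d (side n) x) \<le> 3 + - (s * ?m x)"
      by (simp add: distrib_left)
    then have "exp (- (s * good_num R E r d (side n) x)) \<le> exp 3 * exp (- (s * ?m x))"
      unfolding exp_add [symmetric] by simp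
    then show "of_bool (A x) * exp (- (s * good_num R E r d (side n) x)) \<le>
        exp 3 * (of_bool (A x) * exp (- (s * ?m x)))"
      by (simp add: of_bool_def)
  qed
  also have "\<dots> = B * exp 3 * (\<integral>x. of_bool (A x) * exp (- (s * ?m x)) \<partial>cfg R n)" by simp
  also have "(\<integral>x. of_bool (A x) * exp (- (s * ?m x)) \<partial>cfg R n) =
      (\<integral>x. of_bool (A x) \<partial>cfg R n) * (\<integral>x. exp (- (s * ?m x)) \<partial>cfg R n)"
    unfolding cfg_def
  proof (rule integral_PiM_split_mult [where ?K1.0 = 1 and ?K2.0 = 1, OF R(1) S(1) prob_space_upoint [OF n1]])
    show "(\<lambda>x. of_bool (A x) :: real) \<in> borel_measurable (PiM R (\<lambda>_. upoint n))"
      "(\<lambda>x. exp (- (s * ?m x))) \<in> borel_measurable (PiM R (\<lambda>_. upoint n))"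
      unfolding cfg_def [symmetric] by measurable
    show "of_bool (A x) = (of_bool (A x') :: real)" if "\<And>i. i \<in> S \<Longrightarrow> x i = x' i" for x x'
      using dep [OF that] by simp
    show "exp (- (s * ?m x)) = exp (- (s * ?m x'))" if "\<And>i. i \<in> R - S \<Longrightarrow> x i = x' i" for x x'
    proof -
      have "?m x = ?m x'" by (rule good_num_cong) (use that in auto)
      then show ?thesis by simp
    qed
  qed (use s0 in \<open>auto simp: of_bool_def\<close>)
  also have "(\<integral>x. exp (- (s * ?m x)) \<partial>cfg R n) = (\<integral>x. exp (- (s * ?m x)) \<partial>cfg (R - S) n)"
  proof -
    have "(\<integral>x. exp (- (s * ?m x)) \<partial>cfg (R - S) n) =
        (\<integral>x. exp (- (s * ?m x)) \<partial>distr (cfg R n) (cfg (R - S) n) (\<lambda>x. restrict x (R - S)))"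
      by (simp add: restrict_cfg [OF n1 _ R(1)])
    also have "\<dots> = (\<integral>x. exp (- (s * ?m (restrict x (R - S)))) \<partial>cfg R n)"
    proof (rule integral_distr)
      show "(\<lambda>x. restrict x (R - S)) \<in> measurable (cfg R n) (cfg (R - S) n)"
        unfolding cfg_def by (rule measurable_restrict_subset) auto
      have [measurable]: "?m \<in> measurable (cfg (R - S) n) (count_space UNIV)"
        using R by (intro good_num_measurable) auto
      show "(\<lambda>x. exp (- (s * ?m x))) \<in> borel_measurable (cfg (R - S) n)" by measurable
    qed
    also have "(\<lambda>x. ?m (restrict x (R - S))) = ?m" by (intro ext good_num_cong) simp
    then have "(\<integral>x. exp (- (s * ?m (restrict x (R - S)))) \<partial>cfg R n) = (\<integral>x. exp (- (s * ?m x)) \<partial>cfg R n)"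
      by (simp add: fun_eq_iff)
    finally show ?thesis by simp
  qed
  also have "B * exp 3 * ((\<integral>x. of_bool (A x) \<partial>cfg R n) * \<dots>) \<le>
     B * exp 3 * ((\<integral>x. of_bool (A x) \<partial>cfg R n) * exp (- (crate r d * n * t\<^sup>2)))"
  proof (intro mult_left_mono)
    have "(\<integral>x. exp (- (s * ?m x)) \<partial>cfg (R - S) n) \<le> exp (- (s * n * (good_rate r d - 8 * s)))"
      using R card_mono [of R "R - S"] by (intro exp_good_num [OF r n]) (use E s0 in auto)
    also have "s * n * (good_rate r d - 8 * s) \<ge> s * n * (good_rate r d / 2)"
      using s0 s2 by (intro mult_left_mono) auto
    then have "exp (- (s * n * (good_rate r d - 8 * s))) \<le> exp (- (crate r d * n * t\<^sup>2))"
      by (simp add: crate_def s_def mult_ac)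
    finally show "(\<integral>x. exp (- (s * ?m x)) \<partial>cfg (R - S) n) \<le> exp (- (crate r d * n * t\<^sup>2))" .
  qed (use B in \<open>auto intro!: integral_nonneg_AE\<close>)
  finally show ?thesis by (simp add: mult.assoc)
qed

lemma measure_upoint_near:
  assumes r: "r > 0" and n: "n \<ge> 1" and x: "x \<in> torus_box (side n)"
  shows "measure (upoint n) {y. near (side n) r x y \<and> y \<in> torus_box (side n)} \<le> 324 * r\<^sup>2 / n"
proof -
  interpret U: prob_space "upoint n" by (rule prob_space_upoint [OF n])
  let ?L = "side n"
  let ?K = "{..<3::nat} \<times> {..<3::nat}"
  \<comment> \<open>The shifts by -L, 0 and L account for wrapping. The closed interval of
    half-width 2r is enlarged to a half-open one of length 6r, so nine squares of area 36 r^2 give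
    324 r^2.\<close>
  define I where "I = (\<lambda>(a::real) (k::nat). {a + (real k - 1) * ?L - 2 * r..<a + (real k - 1) * ?L + 4 * r})"
  define Z where "Z = (\<lambda>p. I (fst x) (fst p) \<times> I (snd x) (snd p))"
  have Zs: "Z p \<in> sets borel" for p unfolding Z_def I_def by (intro borel_Times) auto
  have *: "\<exists>k<3. b \<in> I a k" if "circ ?L a b \<le> 2 * r" "a \<in> {0..<?L}" "b \<in> {0..<?L}" for a b
  proof -
    have "\<bar>a - b\<bar> \<le> 2 * r \<or> ?L - \<bar>a - b\<bar> \<le> 2 * r" using that by (auto simp: circ_def min_le_iff_disj)
    then have "b \<in> I a 0 \<or> b \<in> I a 1 \<or> b \<in> I a 2"
      using that r unfolding I_def by (auto simp: abs_if split: if_splits)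
    moreover have "0 < (3::nat)" "1 < (3::nat)" "2 < (3::nat)" by simp_all
    ultimately show ?thesis by blast
  qed
  have sub: "{y. near ?L r x y \<and> y \<in> torus_box ?L} \<subseteq> (\<Union>p\<in>?K. Z p)"
  proof
    fix y assume "y \<in> {y. near ?L r x y \<and> y \<in> torus_box ?L}"
    then have y: "circ ?L (fst x) (fst y) \<le> 2 * r" "circ ?L (snd x) (snd y) \<le> 2 * r"
      "fst y \<in> {0..<?L}" "snd y \<in> {0..<?L}" "fst x \<in> {0..<?L}" "snd x \<in> {0..<?L}"
      using x unfolding near_def mem_torus_box by auto
    show "y \<in> (\<Union>p\<in>?K. Z p)"
      using *[OF y(1) y(5,3)] *[OF y(2) y(6,4)] unfolding Z_def by (auto simp: mem_Times_iff)
  qed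
  have mZ: "measure (upoint n) (Z p) \<le> 36 * r\<^sup>2 / n" for p
  proof -
    have "emeasure (upoint n) (Z p) \<le> emeasure lborel (Z p) / ennreal n"
      unfolding emeasure_upoint [OF Zs] using Zs by (intro divide_right_mono_ennreal emeasure_mono) auto
    also have "emeasure lborel (Z p) = ennreal (36 * r\<^sup>2)"
      unfolding Z_def I_def using r by (subst emeasure_lborel_ivl2) (auto simp: power2_eq_square)
    also have "ennreal (36 * r\<^sup>2) / ennreal n = ennreal (36 * r\<^sup>2 / n)"
      using n by (intro divide_ennreal) auto
    finally show ?thesis by (simp add: U.emeasure_eq_measure)
  qed
  have "measure (upoint n) {y. near ?L r x y \<and> y \<in> torus_box ?L} \<le> measure (upoint n) (\<Union>p\<in>?K. Z p)"
    by (rule U.finite_measure_mono [OF sub]) (use Zs in auto)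
  also have "\<dots> \<le> (\<Sum>p\<in>?K. measure (upoint n) (Z p))"
    by (rule U.finite_measure_subadditive_finite) (use Zs in auto)
  also have "\<dots> \<le> (\<Sum>p\<in>?K. 36 * r\<^sup>2 / n)" by (intro sum_mono mZ)
  also have "\<dots> = 324 * r\<^sup>2 / n" by (simp add: card_cartesian_product)
  finally show ?thesis .
qed

subsection \<open>Resampling and covariances\<close>

lemma gcount_reindex:
  assumes "inj_on f A"
  shows "gcount (\<lambda>i j. E (f i) (f j)) d A = gcount E d (f ` A)"
proof -
  have deg: "gdeg (\<lambda>i j. E (f i) (f j)) A i = gdeg E (f ` A) (f i)" if "i \<in> A" for i
  proof -
    have "{j \<in> f ` A. j \<noteq> f i \<and> E (f i) j} = f ` {j \<in> A. j \<noteq> i \<and> E (f i) (f j)}"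
      using assms that by (auto simp: inj_on_def)
    moreover have "inj_on f {j \<in> A. j \<noteq> i \<and> E (f i) (f j)}" by (rule inj_on_subset [OF assms]) auto
    ultimately show ?thesis by (simp add: gdeg_def card_image)
  qed
  have "{i \<in> f ` A. gdeg E (f ` A) i \<noteq> d} = f ` {i \<in> A. gdeg (\<lambda>i j. E (f i) (f j)) A i \<noteq> d}"
    using deg by auto
  moreover have "inj_on f {i \<in> A. gdeg (\<lambda>i j. E (f i) (f j)) A i \<noteq> d}" by (rule inj_on_subset [OF assms]) auto
  ultimately show ?thesis by (simp add: gcount_def card_image)
qed

definition reidx :: "nat set \<Rightarrow> (nat \<Rightarrow> nat) \<Rightarrow> (nat \<Rightarrow> real \<times> real) \<Rightarrow> nat \<Rightarrow> real \<times> real" where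
  "reidx R f x = (\<lambda>i\<in>R. x (f i))"

lemma wcount_cong:
  assumes "\<And>i. i \<in> A \<Longrightarrow> x i = x' i"
  shows "wcount L r d x A = wcount L r d x' A"
  unfolding wcount_def by (rule gcount_cong) (use assms in simp)

lemma wcount_reidx:
  assumes "inj_on f R" "A \<subseteq> R"
  shows "wcount L r d (reidx R f x) A = wcount L r d x (f ` A)"
proof -
  have "wcount L r d (reidx R f x) A = gcount (\<lambda>i j. torus_dist L (x (f i)) (x (f j)) \<le> r) d A"
    unfolding wcount_def using assms by (intro gcount_cong) (auto simp: reidx_def)
  also have "\<dots> = wcount L r d x (f ` A)"
    unfolding wcount_def by (rule gcount_reindex) (rule inj_on_subset [OF assms])
  finally show ?thesis .
qed

lemma wcount_bounds: "finite A \<Longrightarrow> 0 \<le> wcount L r d x A \<and> wcount L r d x A \<le> card A"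
  unfolding wcount_def gcount_def by (auto intro!: card_mono)

lemma measurable_reidx:
  assumes "f \<in> R \<rightarrow> R"
  shows "reidx R f \<in> measurable (cfg R n) (cfg R n)"
  unfolding reidx_def using assms
  by (subst (2) cfg_def, intro measurable_restrict) (use measurable_cfg_coord in \<open>auto simp: Pi_iff\<close>)

lemma integral_reidx:
  fixes F :: "(nat \<Rightarrow> real \<times> real) \<Rightarrow> 'b :: {banach, second_countable_topology}"
  assumes n: "n \<ge> 1" and f: "inj_on f R" "f \<in> R \<rightarrow> R" and F: "F \<in> borel_measurable (cfg R n)"
  shows "(\<integral>x. F (reidx R f x) \<partial>cfg R n) = (\<integral>x. F x \<partial>cfg R n)"
proof -
  have "distr (cfg R n) (cfg R n) (reidx R f) = cfg R n"
    using distr_PiM_reindex [of R "\<lambda>_. upoint n" f R] f prob_space_upoint [OF n]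
    by (simp add: cfg_def reidx_def [abs_def])
  then have "(\<integral>x. F x \<partial>cfg R n) = (\<integral>x. F x \<partial>distr (cfg R n) (cfg R n) (reidx R f))" by simp
  also have "\<dots> = (\<integral>x. F (reidx R f x) \<partial>cfg R n)"
    by (rule integral_distr [OF measurable_reidx [OF f(2)] F])
  finally show ?thesis by simp
qed

definition exch :: "nat \<Rightarrow> nat \<Rightarrow> nat \<Rightarrow> nat" where
  "exch k l i = (if i = k then l else if i = l then k else i)"

definition theta :: "nat \<Rightarrow> nat \<Rightarrow> nat \<Rightarrow> nat" where
  "theta m k i = (if i < k then i + m else i)"

text \<open>An involution that agrees with \<open>theta m k\<close> on the original indices when k
  \<le> m. As a permutation of the family it preserves the law, which shows that hybrid index sets
  have the same distribution as the original.\<close>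

definition bswap :: "nat \<Rightarrow> nat \<Rightarrow> nat \<Rightarrow> nat" where
  "bswap m k i = (if i < k then i + m else if m \<le> i \<and> i < m + k then i - m else i)"

lemma inj_bswap: "k \<le> m \<Longrightarrow> inj (bswap m k)"
  by (rule injI) (auto simp: bswap_def split: if_splits)

lemma bswap_theta: "k \<le> m \<Longrightarrow> B \<subseteq> {..<m} \<Longrightarrow> bswap m k ` B = theta m k ` B"
  by (intro image_cong) (auto simp: bswap_def theta_def)

lemma bswap_Pi: "k \<le> m \<Longrightarrow> 2 * m \<le> N \<Longrightarrow> bswap m k \<in> {..<N} \<rightarrow> {..<N}"
  by (auto simp: bswap_def)

lemma inj_on_theta: "inj_on (theta m k) {..<m}"
  by (rule inj_onI) (auto simp: theta_def split: if_splits)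

lemma theta_insert:
  assumes "k \<in> B" "B \<subseteq> {..<m}"
  shows "theta m k ` B = insert k (theta m k ` (B - {k}))"
    and "theta m (Suc k) ` B = insert (k + m) (theta m k ` (B - {k}))"
proof -
  have "B = insert k (B - {k})" using assms by auto
  then have "theta m k ` B = insert (theta m k k) (theta m k ` (B - {k}))"
    "theta m (Suc k) ` B = insert (theta m (Suc k) k) (theta m (Suc k) ` (B - {k}))"
    by (metis image_insert)+
  moreover have "theta m (Suc k) ` (B - {k}) = theta m k ` (B - {k})"
    by (intro image_cong) (auto simp: theta_def)
  ultimately show "theta m k ` B = insert k (theta m k ` (B - {k}))"
    "theta m (Suc k) ` B = insert (k + m) (theta m k ` (B - {k}))"
    by (simp_all add: theta_def)
qed

text \<open>Resampling the coordinates one at a time turns a covariance into a sum of products of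
  discrete derivatives: \<open>theta m k ` B\<close> is the index set in which the first \<open>k\<close>
  coordinates are replaced by their independent copies, shifted by \<open>m\<close>.\<close>
lemma covariance_telescope:
  fixes F :: "(nat \<Rightarrow> real \<times> real) \<Rightarrow> complex" and g :: "real \<Rightarrow> complex"
    and r :: real and d :: nat
  assumes n: "n \<ge> 1" and R: "R = {..<N}" "2 * m \<le> N" and B: "B \<subseteq> {..<m}"
    and F [measurable]: "F \<in> borel_measurable (cfg R n)" and Fb: "\<And>x. cmod (F x) \<le> KF"
    and dep: "\<And>x x'. (\<And>i. i < m \<Longrightarrow> x i = x' i) \<Longrightarrow> F x = F x'"
    and g [measurable]: "g \<in> borel_measurable borel"
    and gb: "\<And>y. 0 \<le> y \<Longrightarrow> y \<le> real (card B) \<Longrightarrow> cmod (g y) \<le> Kg"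
  defines "W \<equiv> \<lambda>A x. wcount (side n) r d x A"
  defines "E \<equiv> \<lambda>k. theta m k ` (B - {k})"
  shows "(\<integral>x. F x * g (W B x) \<partial>cfg R n) - (\<integral>x. F x \<partial>cfg R n) * (\<integral>x. g (W B x) \<partial>cfg R n) =
     (\<Sum>k\<in>B. (\<integral>x. (F x - F (reidx R (exch k (k + m)) x)) *
          (g (W (insert k (E k)) x) - g (W (insert (k + m) (E k)) x)) \<partial>cfg R n)) / 2"
proof -
  interpret prob_space "cfg R n" by (rule prob_space_cfg [OF n])
  have fR: "finite R" by (simp add: R)
  have fB: "finite B" using B finite_subset by blast
  have thR: "theta m k ` B \<subseteq> R" for k using B R by (auto simp: theta_def)
  have thcard: "card (theta m k ` B) = card B" for k
    by (rule card_image) (rule inj_on_subset [OF inj_on_theta B])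
  have Wm: "W A \<in> borel_measurable (cfg R n)" if "A \<subseteq> R" for A
    unfolding W_def by (rule measurable_wcount [OF that fR])
  note [measurable] = Wm [OF thR]
  have gWb: "cmod (g (W (theta m k ` B) x)) \<le> Kg" for k x
    unfolding W_def using wcount_bounds [of "theta m k ` B" "side n" r d x] fB thcard [of k] by (intro gb) auto
  have KF0: "KF \<ge> 0" and Kg0: "Kg \<ge> 0"
    using Fb [of undefined] gWb [of 0 undefined] norm_ge_zero order_trans by blast+
  have Fg: "integrable (cfg R n) (\<lambda>x. F x * g (W (theta m k ` B) x))" for k
    by (rule integrable_const_bound [where B = "KF * Kg"])
       (use Fb gWb KF0 in \<open>auto simp: norm_mult intro!: mult_mono\<close>)
  let ?a = "\<lambda>k. (\<integral>x. F x * g (W (theta m k ` B) x) \<partial>cfg R n)"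
  have th0: "theta m 0 ` B = B" by (simp add: theta_def image_def)
  have thS: "theta m m ` B = (\<lambda>i. i + m) ` B" using B by (intro image_cong) (auto simp: theta_def)
  \<comment> \<open>After the last replacement g depends only on coordinates from m onwards and is
    independent of F; relabelling then restores the original index set.\<close>
  have last: "?a m = (\<integral>x. F x \<partial>cfg R n) * (\<integral>x. g (W B x) \<partial>cfg R n)"
  proof -
    have "?a m = (\<integral>x. F x \<partial>cfg R n) * (\<integral>x. g (W (theta m m ` B) x) \<partial>cfg R n)"
      unfolding cfg_def
    proof (rule integral_PiM_split_mult [where S = "{..<m}", OF fR _ prob_space_upoint [OF n] _ Fb _ gWb dep])
      show "{..<m} \<subseteq> R" using R by auto
      show "F \<in> borel_measurable (PiM R (\<lambda>_. upoint n))"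
        "(\<lambda>x. g (W (theta m m ` B) x)) \<in> borel_measurable (PiM R (\<lambda>_. upoint n))"
        unfolding cfg_def [symmetric] by measurable
      show "g (W (theta m m ` B) x) = g (W (theta m m ` B) x')" if "\<And>i. i \<in> R - {..<m} \<Longrightarrow> x i = x' i" for x x'
      proof -
        have "W (theta m m ` B) x = W (theta m m ` B) x'"
          unfolding W_def thS using B R by (intro wcount_cong that) auto
        then show ?thesis by simp
      qed
    qed auto
    also have "(\<integral>x. g (W (theta m m ` B) x) \<partial>cfg R n) = (\<integral>x. g (W B (reidx R (bswap m m) x)) \<partial>cfg R n)"
    proof -
      have "W B (reidx R (bswap m m) x) = W (theta m m ` B) x" for x
        unfolding W_def using B R
        by (subst wcount_reidx) (auto simp: bswap_theta intro: inj_on_subset [OF inj_bswap])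
      then show ?thesis by simp
    qed
    also have "\<dots> = (\<integral>x. g (W B x) \<partial>cfg R n)"
    proof (rule integral_reidx [OF n])
      show "inj_on (bswap m m) R" by (rule inj_on_subset [OF inj_bswap]) auto
      show "bswap m m \<in> R \<rightarrow> R" using bswap_Pi [of m m N] R by simp
      show "(\<lambda>x. g (W B x)) \<in> borel_measurable (cfg R n)"
        using measurable_compose [OF Wm [OF thR [of 0]] g] th0 by simp
    qed
    finally show ?thesis .
  qed
  have swap: "?a k - ?a (Suc k) = (if k \<in> B then
        (\<integral>x. (F x - F (reidx R (exch k (k + m)) x)) *
          (g (W (insert k (E k)) x) - g (W (insert (k + m) (E k)) x)) \<partial>cfg R n) / 2 else 0)"
    if k: "k < m" for k
  proof (cases "k \<in> B")
    case False
    then have "theta m (Suc k) ` B = theta m k ` B"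
      by (intro image_cong) (auto simp: theta_def less_Suc_eq)
    then show ?thesis using False by simp
  next
    case True
    have ins: "theta m k ` B = insert k (E k)" "theta m (Suc k) ` B = insert (k + m) (E k)"
      unfolding E_def by (rule theta_insert [OF True B])+
    have EX: "k \<notin> E k" "k + m \<notin> E k" using B k by (auto simp: E_def theta_def split: if_splits)
    have ER: "insert k (E k) \<subseteq> R" "insert (k + m) (E k) \<subseteq> R" using thR [of k] thR [of "Suc k"] ins by auto
    let ?s = "exch k (k + m)"
    have s: "inj_on ?s R" "?s \<in> R \<rightarrow> R" using ER by (auto simp: inj_on_def exch_def)
    define D where "D = (\<lambda>x. g (W (insert k (E k)) x) - g (W (insert (k + m) (E k)) x))"
    have [measurable]: "D \<in> borel_measurable (cfg R n)"
      unfolding D_def using Wm [OF ER(1)] Wm [OF ER(2)] by measurable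
    have [measurable]: "(\<lambda>x. F (reidx R ?s x)) \<in> borel_measurable (cfg R n)"
      using measurable_compose [OF measurable_reidx [OF s(2)] F] .
    have Db: "cmod (D x) \<le> 2 * Kg" for x
      unfolding D_def using gWb [of k x] gWb [of "Suc k" x] ins norm_triangle_ineq4 [of "g (W (insert k (E k)) x)" "g (W (insert (k + m) (E k)) x)"]
      by simp
    have i1: "integrable (cfg R n) (\<lambda>x. F x * D x)"
      by (rule integrable_const_bound [where B = "KF * (2 * Kg)"])
         (use Fb Db KF0 in \<open>auto simp: norm_mult intro!: mult_mono\<close>)
    have i2: "integrable (cfg R n) (\<lambda>x. F (reidx R ?s x) * D x)"
      by (rule integrable_const_bound [where B = "KF * (2 * Kg)"])
         (use Fb Db KF0 in \<open>auto simp: norm_mult intro!: mult_mono\<close>)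
    have tE: "?s ` E k = E k" 
    proof -
      have "?s ` E k = id ` E k" using EX by (intro image_cong) (auto simp: exch_def)
      then show ?thesis by simp
    qed
    \<comment> \<open>The increment of g changes sign when a coordinate and its copy are exchanged.
      Averaging the integral with its exchanged form therefore puts a difference on F as well, at
      the price of a factor 1/2.\<close>
    have Ds: "D (reidx R ?s x) = - D x" for x
      unfolding D_def W_def wcount_reidx [OF s(1) ER(1)] wcount_reidx [OF s(1) ER(2)] image_insert tE by (simp add: exch_def)
    have "?a k - ?a (Suc k) = (\<integral>x. F x * g (W (theta m k ` B) x) - F x * g (W (theta m (Suc k) ` B) x) \<partial>cfg R n)"
      using Fg by (intro Bochner_Integration.integral_diff [symmetric])
    also have "\<dots> = (\<integral>x. F x * D x \<partial>cfg R n)" by (simp add: D_def ins right_diff_distrib)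
    finally have 1: "?a k - ?a (Suc k) = (\<integral>x. F x * D x \<partial>cfg R n)" .
    also have "\<dots> = (\<integral>x. F (reidx R ?s x) * D (reidx R ?s x) \<partial>cfg R n)"
      by (rule integral_reidx [OF n s, symmetric]) measurable
    also have "\<dots> = - (\<integral>x. F (reidx R ?s x) * D x \<partial>cfg R n)" by (simp add: Ds)
    finally have 2: "?a k - ?a (Suc k) = - (\<integral>x. F (reidx R ?s x) * D x \<partial>cfg R n)" .
    have "(\<integral>x. (F x - F (reidx R ?s x)) * D x \<partial>cfg R n) =
        (\<integral>x. F x * D x \<partial>cfg R n) - (\<integral>x. F (reidx R ?s x) * D x \<partial>cfg R n)"
      using i1 i2 by (simp add: left_diff_distrib)
    also have "\<dots> = 2 * (?a k - ?a (Suc k))" using 1 2 by simp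
    finally show ?thesis using True by (simp add: D_def)
  qed
  have "?a 0 - ?a m = (\<Sum>k<m. ?a k - ?a (Suc k))"
    by (rule sum_lessThan_telescope' [symmetric])
  also have "\<dots> = (\<Sum>k<m. if k \<in> B then
        (\<integral>x. (F x - F (reidx R (exch k (k + m)) x)) *
          (g (W (insert k (E k)) x) - g (W (insert (k + m) (E k)) x)) \<partial>cfg R n) / 2 else 0)"
    by (intro sum.cong) (use swap in auto)
  also have "\<dots> = (\<Sum>k\<in>B. (\<integral>x. (F x - F (reidx R (exch k (k + m)) x)) *
          (g (W (insert k (E k)) x) - g (W (insert (k + m) (E k)) x)) \<partial>cfg R n) / 2)"
    using B by (simp add: sum.If_cases Int_absorb1)
  finally show ?thesis using last th0 by (simp add: sum_divide_distrib)
qed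

subsection \<open>The differential equation for the characteristic function\<close>

lemma measurable_near:
  assumes "f \<in> borel_measurable M" "g \<in> borel_measurable M"
  shows "Measurable.pred M (\<lambda>x. near L r (f x) (g x))"
proof -
  have [measurable]: "fst \<in> borel_measurable (borel :: (real \<times> real) measure)"
    "snd \<in> borel_measurable (borel :: (real \<times> real) measure)"
    by (intro borel_measurable_continuous_onI continuous_intros)+
  note assms [measurable]
  show ?thesis unfolding near_def circ_def by measurable
qed

text \<open>The box conditions are part of the event, so that its probability bound has no
  exceptional configurations to treat.\<close>

definition near_box :: "nat \<Rightarrow> real \<Rightarrow> real \<times> real \<Rightarrow> real \<times> real \<Rightarrow> bool" where
  "near_box n r y z \<longleftrightarrow> near (side n) r y z \<and> y \<in> torus_box (side n) \<and> z \<in> torus_box (side n)"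

lemma measurable_near_box:
  assumes [measurable]: "f \<in> borel_measurable M" "g \<in> borel_measurable M"
  shows "Measurable.pred M (\<lambda>x. near_box n r (f x) (g x))"
  unfolding near_box_def using measurable_near [OF assms] by measurable

lemma prob_near_box:
  assumes r: "r > 0" and n: "n \<ge> 1" and R: "finite R" and ab: "a \<in> R" "b \<in> R" "a \<noteq> b"
  shows "(\<integral>x. of_bool (near_box n r (x a) (x b)) \<partial>cfg R n) \<le> 324 * r\<^sup>2 / n"
proof -
  interpret U: prob_space "upoint n" by (rule prob_space_upoint [OF n])
  interpret PS: product_sigma_finite "\<lambda>_::nat. upoint n" by unfold_locales
  interpret T: prob_space "cfg {b, a} n" by (rule prob_space_cfg [OF n])
  interpret A: prob_space "cfg {a} n" by (rule prob_space_cfg [OF n])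
  let ?f = "\<lambda>x. of_bool (near_box n r (x a) (x b)) :: real"
  have m [measurable]: "?f \<in> borel_measurable (cfg {b, a} n)"
    using measurable_near_box [OF measurable_cfg_coord [of a "{b, a}"] measurable_cfg_coord [of b "{b, a}"]] by measurable
  have "(\<integral>x. ?f x \<partial>cfg {b, a} n) = (\<integral>x. ?f x \<partial>distr (cfg R n) (cfg {b, a} n) (\<lambda>x. restrict x {b, a}))"
    using restrict_cfg [OF n, of "{b, a}" R] ab R by simp
  also have "\<dots> = (\<integral>x. ?f (restrict x {b, a}) \<partial>cfg R n)"
    by (rule integral_distr [OF _ m]) (use ab in \<open>auto simp: cfg_def intro!: measurable_restrict_subset\<close>)
  finally have "(\<integral>x. ?f x \<partial>cfg R n) = (\<integral>x. ?f x \<partial>cfg {b, a} n)" by simp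
  also have "\<dots> = (\<integral>x. (\<integral>y. ?f (x(b := y)) \<partial>upoint n) \<partial>cfg {a} n)"
    unfolding cfg_def
  proof (rule PS.product_integral_insert)
    show "integrable (PiM (insert b {a}) (\<lambda>_. upoint n)) ?f"
      unfolding cfg_def [symmetric] by (rule T.integrable_const_bound [where B = 1]) auto
  qed (use ab in auto)
  also have "\<dots> \<le> (\<integral>x. 324 * r\<^sup>2 / n \<partial>cfg {a} n)"
  proof (rule integral_mono')
    fix x :: "nat \<Rightarrow> real \<times> real"
    have m1: "Measurable.pred (upoint n) (\<lambda>y. near_box n r (x a) y)"
      by (rule measurable_near_box) auto
    have "(\<integral>y. ?f (x(b := y)) \<partial>upoint n) = (\<integral>y. indicator {y. near_box n r (x a) y} y \<partial>upoint n)"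
      using ab by (intro Bochner_Integration.integral_cong) (auto simp: indicator_def)
    also have "\<dots> = measure (upoint n) {y. near_box n r (x a) y}" by simp
    also have "\<dots> \<le> 324 * r\<^sup>2 / n"
    proof (cases "x a \<in> torus_box (side n)")
      case True
      then show ?thesis using measure_upoint_near [OF r n True] by (simp add: near_box_def)
    next
      case False
      then show ?thesis by (simp add: near_box_def)
    qed
    finally show "(\<integral>y. ?f (x(b := y)) \<partial>upoint n) \<le> 324 * r\<^sup>2 / n" .
  qed auto
  also have "\<dots> = 324 * r\<^sup>2 / n" using A.prob_space by simp
  finally show ?thesis .
qed

lemma cis_diff_le: "cmod (cis a - cis b) \<le> \<bar>a - b\<bar>"
proof -
  have "cis a - cis b = cis b * (cis (a - b) - 1)"
    by (simp add: right_diff_distrib cis_mult)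
  then show ?thesis using cmod_cis_minus_1 [of "a - b"] by (simp add: norm_mult)
qed

text \<open>Expansion in e^{it} - 1 instead of \<i>t, so that the main term has the shape of the
  Poisson equation; both sides are compared with the linear term \<i>ta.\<close>

lemma cis_mult_taylor:
  assumes "\<bar>a\<bar> \<le> K" "K \<ge> 1"
  shows "cmod (cis (t * a) - 1 - a * (cis t - 1)) \<le> K\<^sup>2 * t\<^sup>2"
proof -
  have "cis (t * a) - 1 - a * (cis t - 1) = (cis (t * a) - 1 - \<i> * (t * a)) - a * (cis t - 1 - \<i> * t)"
    by (simp add: algebra_simps)
  also have "cmod \<dots> \<le> (t * a)\<^sup>2 / 2 + \<bar>a\<bar> * (t\<^sup>2 / 2)"
  proof (rule order_trans [OF norm_triangle_ineq4], rule add_mono)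
    show "cmod (cis (t * a) - 1 - \<i> * (t * a)) \<le> (t * a)\<^sup>2 / 2"
      using cmod_cis_minus_linear [of "t * a"] by simp
    show "cmod (a * (cis t - 1 - \<i> * t)) \<le> \<bar>a\<bar> * (t\<^sup>2 / 2)"
      unfolding norm_mult norm_of_real by (intro mult_left_mono cmod_cis_minus_linear) auto
  qed
  also have "\<dots> \<le> K\<^sup>2 * t\<^sup>2 / 2 + K\<^sup>2 * (t\<^sup>2 / 2)"
  proof (rule add_mono)
    have "a\<^sup>2 \<le> K\<^sup>2" using power_mono [OF assms(1), of 2] by simp
    then show "(t * a)\<^sup>2 / 2 \<le> K\<^sup>2 * t\<^sup>2 / 2" 
      using mult_right_mono [of "a\<^sup>2" "K\<^sup>2" "t\<^sup>2"] by (simp add: power_mult_distrib mult.commute)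
    have "K * 1 \<le> K * K" using assms by (intro mult_left_mono) auto
    then have "\<bar>a\<bar> \<le> K\<^sup>2" using assms unfolding power2_eq_square by linarith
    then show "\<bar>a\<bar> * (t\<^sup>2 / 2) \<le> K\<^sup>2 * (t\<^sup>2 / 2)" by (intro mult_right_mono) auto
  qed
  finally show ?thesis by simp
qed

locale rgg =
  fixes r :: real and d n :: nat
  assumes r: "r > 0" and nl: "n_large r d n"
begin

abbreviation "R \<equiv> {..<4 * n}"
abbreviation "M \<equiv> cfg R n"
abbreviation "W A x \<equiv> wcount (side n) r d x A"
abbreviation "K \<equiv> dmax d"
abbreviation "inbox x \<equiv> (\<forall>i\<in>R. x i \<in> torus_box (side n))"
text \<open>The Gaussian factor, including the loss \<open>exp 3\<close> for deleting up to four
  points.\<close>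

abbreviation "dec t \<equiv> exp 3 * exp (- (crate r d * n * t\<^sup>2))"

lemma n1: "n \<ge> 1" and n6: "n \<ge> 6"
  using nl by (auto simp: n_large_def)

sublocale prob_space M
  by (rule prob_space_cfg [OF n1])

lemma AE_box: "AE x in M. inbox x"
  by (rule AE_cfg_box [OF n1]) simp

lemma W_meas: "A \<subseteq> R \<Longrightarrow> W A \<in> borel_measurable M"
  by (rule measurable_wcount) auto

lemma W_insert_diff:
  assumes "inbox x" "insert u X \<subseteq> R" "u \<notin> X"
  shows "\<bar>W (insert u X) x - W X x\<bar> \<le> K"
  using assms finite_subset [of X R] by (intro wcount_insert_diff_le [OF r]) auto

lemma W_exchange_diff:
  assumes "inbox x" "insert u (insert v X) \<subseteq> R" "u \<notin> X" "v \<notin> X"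
  shows "\<bar>W (insert u X) x - W (insert v X) x\<bar> \<le> 2 * K"
  using W_insert_diff [of x u X] W_insert_diff [of x v X] assms by auto

lemma flip_W_insert_diff:
  assumes "blk_in (side n) r b" "good R E r d x b" "inbox x" "insert u X \<subseteq> R" "u \<notin> E"
  shows "W (insert u X) (flipc R r b x) - W X (flipc R r b x) = W (insert u X) x - W X x"
  using assms by (intro wcount_flipc_insert_diff [OF r]) auto

lemma flip_W_exchange_diff:
  assumes "blk_in (side n) r b" "good R E r d x b" "inbox x" "insert u (insert v X) \<subseteq> R" "u \<notin> E" "v \<notin> E"
  shows "W (insert u X) (flipc R r b x) - W (insert v X) (flipc R r b x) = W (insert u X) x - W (insert v X) x"
  using flip_W_insert_diff [OF assms(1-3), of u X] flip_W_insert_diff [OF assms(1-3), of v X] assms by auto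

lemma W_far:
  assumes x: "inbox x" and sub: "insert j (insert k S) \<subseteq> R" and "j \<notin> S" "k \<notin> S" "j \<noteq> k"
    and "\<not> near_box n r (x j) (x k)"
  shows "W (insert j (insert k S)) x - W (insert k S) x = W (insert j S) x - W S x"
proof -
  have "finite S" using sub finite_subset [of S R] by auto
  then have "W (insert k (insert j S)) x - W (insert k S) x = W (insert j S) x - W S x"
    using assms by (intro wcount_second_difference [OF r]) (auto simp: near_box_def)
  then show ?thesis by (simp add: insert_commute)
qed

text \<open>If k is in C, the exchange replaces k by l. Both sets are compared with C without k: the
  vanishing second difference for each of the four pairs shows that neither k nor l influences the
  derivative at j or j'.\<close>

lemma W_exchange_far:
  assumes x: "inbox x" and sub: "insert j (insert j' (insert k (insert l C))) \<subseteq> R"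
    and C: "j \<notin> C" "j' \<notin> C" "l \<notin> C" "distinct [j, j', k, l]"
    and far: "\<not> near_box n r (x j) (x k)" "\<not> near_box n r (x j') (x k)"
      "\<not> near_box n r (x j) (x l)" "\<not> near_box n r (x j') (x l)"
  shows "W (insert j (exch k l ` C)) x - W (insert j' (exch k l ` C)) x = W (insert j C) x - W (insert j' C) x"
proof (cases "k \<in> C")
  case False
  then have "exch k l ` C = id ` C" using C by (intro image_cong) (auto simp: exch_def)
  then show ?thesis by simp
next
  case True
  define S where "S = C - {k}"
  have S: "C = insert k S" "k \<notin> S" using True by (auto simp: S_def)
  have "exch k l ` S = id ` S" using C S by (intro image_cong) (auto simp: exch_def)
  then have E: "exch k l ` C = insert l S" by (simp add: S exch_def)
  have "W (insert u (insert v S)) x - W (insert v S) x = W (insert u S) x - W S x"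
    if "u \<in> {j, j'}" "v \<in> {k, l}" for u v
    using that sub C S far by (intro W_far [OF x]) auto
  from this [of j k] this [of j' k] this [of j l] this [of j' l]
  show ?thesis unfolding E unfolding S(1) by simp
qed

lemma smoothing:
  assumes "S \<subseteq> R" "card S \<le> 4" "E \<subseteq> R - S" "n \<le> card E + 2"
    and "H \<in> borel_measurable M" "Measurable.pred M A" "B \<ge> 0"
    and "\<And>x x'. (\<And>i. i \<in> S \<Longrightarrow> x i = x' i) \<Longrightarrow> A x = A x'"
    and "\<And>x. inbox x \<Longrightarrow> cmod (H x) \<le> B * of_bool (A x)"
    and "\<And>b x. blk_in (side n) r b \<Longrightarrow> good R E r d x b \<Longrightarrow> inbox x \<Longrightarrow> H (flipc R r b x) = H x"
    and "\<bar>t\<bar> \<le> pi"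
  shows "cmod (\<integral>x. H x * cis (t * W E x) \<partial>M) \<le> B * (\<integral>x. of_bool (A x) \<partial>M) * dec t"
proof -
  have "cmod (\<integral>x. H x * cis (t * W E x) \<partial>M) \<le>
     B * exp 3 * (\<integral>x. of_bool (A x) \<partial>M) * exp (- (crate r d * n * t\<^sup>2))"
  proof (rule cf_uniform_smoothing [OF r nl _ _ assms(1-3) _ assms(5-8) _ _ assms(11)])
    show "AE x in M. cmod (H x) \<le> B * of_bool (A x)" using AE_box by eventually_elim (use assms(9) in blast)
    \<comment> \<open>Up to two indices may be missing: n - 2 \<ge> n/2 because n \<ge> 6.\<close>
    show "n \<le> 2 * card E" using assms(4) n6 by simp
    show "flip_inv R E r d n H" unfolding flip_inv_def using assms(10) by blast
  qed auto
  then show ?thesis by (simp add: mult_ac)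
qed

lemma smoothing_plain:
  assumes "S \<subseteq> R" "card S \<le> 4" "E \<subseteq> R - S" "n \<le> card E + 2"
    and "H \<in> borel_measurable M" "B \<ge> 0"
    and "\<And>x. inbox x \<Longrightarrow> cmod (H x) \<le> B"
    and "\<And>b x. blk_in (side n) r b \<Longrightarrow> good R E r d x b \<Longrightarrow> inbox x \<Longrightarrow> H (flipc R r b x) = H x"
    and "\<bar>t\<bar> \<le> pi"
  shows "cmod (\<integral>x. H x * cis (t * W E x) \<partial>M) \<le> B * dec t"
  using smoothing [OF assms(1-5), of "\<lambda>_. True" B t] assms prob_space by simp

section \<open>First resampling: discrete derivatives of the count\<close>

definition "I = {..<n}"
definition "Cs j = I - {j}"
definition "Bs j = theta n j ` Cs j"
text \<open>The effect of replacing point j by its copy j + n among the original points;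
  \<open>bdif\<close> is the same effect in the hybrid in which all points before j have been
  replaced already.\<close>

definition "hdif j x = W (insert j (Cs j)) x - W (insert (j + n) (Cs j)) x"
definition "bdif j x = W (insert j (Bs j)) x - W (insert (j + n) (Bs j)) x"
definition "fdif j x = hdif j x * bdif j x"

lemma idx:
  assumes "j \<in> I"
  shows "insert j (Cs j) = I" "j \<notin> Cs j" "j + n \<notin> Cs j" "Cs j \<subseteq> {..<2 * n}"
    "j \<notin> Bs j" "j + n \<notin> Bs j" "Bs j \<subseteq> {..<2 * n}" "card (Bs j) = n - 1" "j < 2 * n" "j + n < 2 * n"
    "insert j (Cs j) \<subseteq> R" "insert (j + n) (Cs j) \<subseteq> R" "insert j (Bs j) \<subseteq> R" "insert (j + n) (Bs j) \<subseteq> R"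
proof -
  show "card (Bs j) = n - 1"
    unfolding Bs_def by (subst card_image [OF inj_on_subset [OF inj_on_theta]]) (use assms in \<open>auto simp: Cs_def I_def\<close>)
qed (use assms in \<open>auto simp: Bs_def Cs_def I_def theta_def split: if_splits\<close>)

lemma hdif_meas: "j \<in> I \<Longrightarrow> hdif j \<in> borel_measurable M"
  and fdif_meas: "j \<in> I \<Longrightarrow> fdif j \<in> borel_measurable M"
  unfolding fdif_def hdif_def bdif_def using idx [of j]
  by (auto intro!: borel_measurable_diff borel_measurable_times W_meas)

lemma hdif_le: "j \<in> I \<Longrightarrow> inbox x \<Longrightarrow> \<bar>hdif j x\<bar> \<le> 2 * K"
  and bdif_le: "j \<in> I \<Longrightarrow> inbox x \<Longrightarrow> \<bar>bdif j x\<bar> \<le> 2 * K"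
  unfolding hdif_def bdif_def by (rule W_exchange_diff; use idx [of j] in simp)+

lemma K1: "K \<ge> 1" by (rule dmax_ge_1)

lemma fdif_le: "j \<in> I \<Longrightarrow> inbox x \<Longrightarrow> \<bar>fdif j x\<bar> \<le> 4 * K\<^sup>2"
  using mult_mono [OF hdif_le bdif_le, of j x j x] K1 by (simp add: fdif_def abs_mult power2_eq_square)

lemma exch_insert_image: "j \<notin> {k, l} \<Longrightarrow> exch k l ` insert j A = insert j (exch k l ` A)"
  by (simp add: exch_def)

lemma exch_R: "k \<in> R \<Longrightarrow> l \<in> R \<Longrightarrow> inj_on (exch k l) R \<and> exch k l \<in> R \<rightarrow> R"
  by (auto simp: inj_on_def exch_def)

text \<open>Used twice: g the identity yields the variance, g = e^{it.} the equation. Because both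
  come from the same sum over j, the coefficient of the equation matches \<sigma>2 exactly.\<close>

lemma cov_first:
  fixes g :: "real \<Rightarrow> complex"
  assumes g: "g \<in> borel_measurable borel" and gb: "\<And>y. 0 \<le> y \<Longrightarrow> y \<le> real n \<Longrightarrow> cmod (g y) \<le> Kg"
  shows "(\<integral>x. W I x * g (W I x) \<partial>M) - (\<integral>x. complex_of_real (W I x) \<partial>M) * (\<integral>x. g (W I x) \<partial>M) =
     (\<Sum>j\<in>I. (\<integral>x. hdif j x * (g (W (insert j (Bs j)) x) - g (W (insert (j + n) (Bs j)) x)) \<partial>M)) / 2"
proof -
  have Im: "(\<lambda>x. complex_of_real (W I x)) \<in> borel_measurable M"
    using W_meas [of I] by (auto simp: I_def)
  have "(\<integral>x. complex_of_real (W I x) * g (W I x) \<partial>M) - (\<integral>x. complex_of_real (W I x) \<partial>M) * (\<integral>x. g (W I x) \<partial>M) =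
     (\<Sum>j\<in>I. (\<integral>x. (complex_of_real (W I x) - complex_of_real (W I (reidx R (exch j (j + n)) x))) *
        (g (W (insert j (theta n j ` (I - {j}))) x) - g (W (insert (j + n) (theta n j ` (I - {j}))) x)) \<partial>M)) / 2"
  proof (rule covariance_telescope [where m = n and B = I and KF = "real n" and Kg = Kg, OF n1 refl])
    show "complex_of_real (W I x) = complex_of_real (W I x')" if "\<And>i. i < n \<Longrightarrow> x i = x' i" for x x'
      using wcount_cong [of I x x'] that by (auto simp: I_def)
    show "cmod (complex_of_real (W I x)) \<le> real n" for x
      using wcount_bounds [of I "side n" r d x] by (simp add: I_def)
  qed (use Im g gb in \<open>auto simp: I_def\<close>)
  also have "(\<Sum>j\<in>I. (\<integral>x. (complex_of_real (W I x) - complex_of_real (W I (reidx R (exch j (j + n)) x))) *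
        (g (W (insert j (theta n j ` (I - {j}))) x) - g (W (insert (j + n) (theta n j ` (I - {j}))) x)) \<partial>M)) =
     (\<Sum>j\<in>I. (\<integral>x. hdif j x * (g (W (insert j (Bs j)) x) - g (W (insert (j + n) (Bs j)) x)) \<partial>M))"
  proof (rule sum.cong [OF refl])
    fix j assume j: "j \<in> I"
    have "exch j (j + n) ` Cs j = id ` Cs j" using idx [OF j] by (intro image_cong) (auto simp: exch_def)
    then have "exch j (j + n) ` insert j (Cs j) = insert (exch j (j + n) j) (Cs j)"
      unfolding image_insert by simp
    then have "exch j (j + n) ` I = insert (j + n) (Cs j)"
      using idx(1) [OF j] by (simp only: exch_def if_True refl)
    then have "W I (reidx R (exch j (j + n)) x) = W (insert (j + n) (Cs j)) x" for x
      using exch_R [of j "j + n"] j by (subst wcount_reidx) (auto simp: I_def)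
    then show "(\<integral>x. (complex_of_real (W I x) - complex_of_real (W I (reidx R (exch j (j + n)) x))) *
        (g (W (insert j (theta n j ` (I - {j}))) x) - g (W (insert (j + n) (theta n j ` (I - {j}))) x)) \<partial>M) =
      (\<integral>x. hdif j x * (g (W (insert j (Bs j)) x) - g (W (insert (j + n) (Bs j)) x)) \<partial>M)"
      using idx(1) [OF j] by (simp add: hdif_def Bs_def Cs_def [symmetric])
  qed
  finally show ?thesis .
qed

end

context rgg
begin

lemma cis_W_meas: "A \<subseteq> R \<Longrightarrow> (\<lambda>x. cis (t * W A x)) \<in> borel_measurable M"
  using measurable_compose [OF borel_measurable_times [OF borel_measurable_const W_meas], of A cis borel t] by simp

definition "\<phi> t = (\<integral>x. cis (t * W I x) \<partial>M)"
definition "\<sigma>2 = (\<integral>x. (W I x - (\<integral>x. W I x \<partial>M))\<^sup>2 \<partial>M)"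

lemma I_R: "I \<subseteq> R" by (auto simp: I_def)

lemma W_I_bounds: "0 \<le> W I x" "W I x \<le> n"
  using wcount_bounds [of I "side n" r d x] by (auto simp: I_def)

lemma W_I_integrable: "integrable M (W I)"
  by (rule integrable_const_bound [where B = n]) (use W_I_bounds W_meas [OF I_R] in auto)

lemma phi_bound: "\<bar>t\<bar> \<le> pi \<Longrightarrow> cmod (\<phi> t) \<le> dec t"
  using smoothing_plain [of "{}" I "\<lambda>_. 1" 1 t] by (simp add: \<phi>_def I_def)

lemma phi_insert_Bs:
  assumes j: "j \<in> I"
  shows "(\<integral>x. cis (t * W (insert j (Bs j)) x) \<partial>M) = \<phi> t"
proof -
  have "insert j (Bs j) = theta n j ` I"
    using theta_insert(1) [of j I n] j by (simp add: Bs_def Cs_def I_def)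
  also have "\<dots> = bswap n j ` I"
    using j by (intro bswap_theta [symmetric]) (auto simp: I_def)
  finally have B: "insert j (Bs j) = bswap n j ` I" .
  have inj: "inj_on (bswap n j) R" using j by (intro inj_on_subset [OF inj_bswap]) (auto simp: I_def)
  have "\<phi> t = (\<integral>x. cis (t * W I (reidx R (bswap n j) x)) \<partial>M)"
    unfolding \<phi>_def using j
    by (intro integral_reidx [OF n1 inj, symmetric] cis_W_meas I_R bswap_Pi) (auto simp: I_def)
  then show ?thesis by (simp add: wcount_reidx [OF inj I_R] B)
qed

text \<open>With j inserted, the hybrid is a relabelling of the original and has transform \<phi>;
  leaving out j changes the count by at most K, which costs a factor |t| K.\<close>

lemma phi_Bs:
  assumes j: "j \<in> I" and t: "\<bar>t\<bar> \<le> pi"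
  shows "cmod ((\<integral>x. cis (t * W (Bs j) x) \<partial>M) - \<phi> t) \<le> K * \<bar>t\<bar> * dec t"
proof -
  let ?B = "Bs j"
  note idx = idx [OF j]
  define H where "H = (\<lambda>x. 1 - cis (t * (W (insert j ?B) x - W ?B x)))"
  have BR: "?B \<subseteq> R" "insert j ?B \<subseteq> R" using idx by auto
  have i: "integrable M (\<lambda>x. cis (t * W A x))" if "A \<subseteq> R" for A
    by (rule integrable_const_bound [where B = 1]) (use cis_W_meas [OF that] in auto)
  have "(\<integral>x. cis (t * W ?B x) \<partial>M) - \<phi> t = (\<integral>x. cis (t * W ?B x) - cis (t * W (insert j ?B) x) \<partial>M)"
    unfolding phi_insert_Bs [OF j, symmetric] by (intro Bochner_Integration.integral_diff [symmetric] i BR)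
  also have "\<dots> = (\<integral>x. H x * cis (t * W ?B x) \<partial>M)"
    by (intro Bochner_Integration.integral_cong)
       (auto simp: H_def left_diff_distrib cis_mult algebra_simps)
  also have "cmod \<dots> \<le> K * \<bar>t\<bar> * dec t"
  proof (rule smoothing_plain [of "{j}"])
    have m: "(\<lambda>x. W (insert j ?B) x - W ?B x) \<in> borel_measurable M" using BR by (intro borel_measurable_diff W_meas)
    show "H \<in> borel_measurable M" unfolding H_def using m by measurable
    fix x assume x: "inbox x"
    have "cmod (H x) \<le> \<bar>t * (W (insert j ?B) x - W ?B x)\<bar>"
      using cmod_cis_minus_1 [of "t * (W (insert j ?B) x - W ?B x)"] by (simp add: H_def norm_minus_commute)
    also have "\<dots> \<le> \<bar>t\<bar> * K"
      unfolding abs_mult using W_insert_diff [OF x BR(2)] idx by (intro mult_left_mono) auto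
    finally show "cmod (H x) \<le> K * \<bar>t\<bar>" by (simp add: mult.commute)
  next
    fix b x assume "blk_in (side n) r b" "good R (Bs j) r d x b" "inbox x"
    then have "W (insert j ?B) (flipc R r b x) - W ?B (flipc R r b x) = W (insert j ?B) x - W ?B x"
      using BR idx by (intro flip_W_insert_diff [where E = "Bs j"]) auto
    then show "H (flipc R r b x) = H x" by (simp only: H_def)
  qed (use idx t K1 j in \<open>auto simp: I_def\<close>)
  finally show ?thesis .
qed

text \<open>Half of 16 * 1296: the 16 is from the product of differences in
  \<open>cov_second_term\<close>, 1296 = 4 * 324 from the four pairs that may be close, and the half
  from the symmetrisation.\<close>

definition "CA = 10368 * K ^ 3 * r\<^sup>2"

lemma four_near_prob:
  assumes "j \<in> R" "j' \<in> R" "k \<in> R" "l \<in> R" "distinct [j, j', k, l]"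
  shows "(\<integral>x. of_bool (\<exists>u\<in>{j, j'}. \<exists>v\<in>{k, l}. near_box n r (x u) (x v)) \<partial>M) \<le> 1296 * r\<^sup>2 / n"
proof -
  have m: "Measurable.pred M (\<lambda>x. near_box n r (x u) (x v))" if "u \<in> R" "v \<in> R" for u v
    using that by (intro measurable_near_box measurable_cfg_coord)
  note [measurable] = m [OF assms(1) assms(3)] m [OF assms(1) assms(4)] m [OF assms(2) assms(3)] m [OF assms(2) assms(4)]
  let ?b = "\<lambda>u v x. of_bool (near_box n r (x u) (x v)) :: real"
  have i: "integrable M (?b u v)" if "u \<in> R" "v \<in> R" for u v
    using m [OF that] by (intro integrable_const_bound [where B = 1]) auto
  have "(\<integral>x. of_bool (\<exists>u\<in>{j, j'}. \<exists>v\<in>{k, l}. near_box n r (x u) (x v)) \<partial>M) \<le>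
     (\<integral>x. ?b j k x + ?b j l x + ?b j' k x + ?b j' l x \<partial>M)"
  proof (rule integral_mono)
    show "integrable M (\<lambda>x. of_bool (\<exists>u\<in>{j, j'}. \<exists>v\<in>{k, l}. near_box n r (x u) (x v)) :: real)"
      by (rule integrable_const_bound [where B = 1]) auto
    show "integrable M (\<lambda>x. ?b j k x + ?b j l x + ?b j' k x + ?b j' l x)"
      by (intro Bochner_Integration.integrable_add i assms)
  qed (auto simp: of_bool_def)
  also have "\<dots> = (\<integral>x. ?b j k x \<partial>M) + (\<integral>x. ?b j l x \<partial>M) + (\<integral>x. ?b j' k x \<partial>M) + (\<integral>x. ?b j' l x \<partial>M)"
    using assms i by (simp add: Bochner_Integration.integral_add)
  also have "\<dots> \<le> 324 * r\<^sup>2 / n + 324 * r\<^sup>2 / n + 324 * r\<^sup>2 / n + 324 * r\<^sup>2 / n"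
    using assms by (intro add_mono prob_near_box [OF r n1]) auto
  finally show ?thesis by simp
qed

text \<open>Unless one of j, j + n is close to one of k, l, exchanging k and l leaves
  \<open>fdif j\<close> unchanged. That event concerns four points only and has probability O(1/n).
  On it the difference of \<open>fdif j\<close> is at most 8 K^2 and that of the phases at most 2 K
  |t|. All factors are flip-invariant because E omits the four indices.\<close>

lemma cov_second_term:
  assumes j: "j \<in> I" and t: "\<bar>t\<bar> \<le> pi" and k: "k \<in> Bs j"
  defines "E \<equiv> theta (2 * n) k ` (Bs j - {k})" and "l \<equiv> k + 2 * n"
  shows "cmod (\<integral>x. (complex_of_real (fdif j x) - complex_of_real (fdif j (reidx R (exch k l) x))) *
      (cis (t * W (insert k E) x) - cis (t * W (insert l E) x)) \<partial>M) \<le>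
      16 * K ^ 3 * \<bar>t\<bar> * (1296 * r\<^sup>2 / n) * dec t"
proof -
  note ix = idx [OF j]
  let ?j' = "j + n"
  let ?C = "exch k l ` Cs j" and ?B = "exch k l ` Bs j"
  have k2: "k < 2 * n" "k \<noteq> j" "k \<noteq> ?j'" using k ix by auto
  have jR: "j \<in> R" "?j' \<in> R" "k \<in> R" "l \<in> R" using ix k2 by (auto simp: l_def)
  have dist: "distinct [j, ?j', k, l]" using k2 ix n1 by (auto simp: l_def)
  have ex: "inj_on (exch k l) R" "exch k l \<in> R \<rightarrow> R" using exch_R [OF jR(3,4)] by auto
  have CR: "insert j ?C \<subseteq> R" "insert ?j' ?C \<subseteq> R" "insert j ?B \<subseteq> R" "insert ?j' ?B \<subseteq> R"
    using ix ex(2) jR by auto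
  have notin: "j \<notin> ?C" "?j' \<notin> ?C" "j \<notin> ?B" "?j' \<notin> ?B"
    using ix dist by (auto simp: exch_def)
  have l: "l \<notin> Cs j" "l \<notin> Bs j" using ix by (auto simp: l_def)
  have ins: "exch k l ` insert u A = insert u (exch k l ` A)" if "u \<in> {j, ?j'}" for u A
    using that dist by (intro exch_insert_image) auto
  have fr: "fdif j (reidx R (exch k l) x) =
      (W (insert j ?C) x - W (insert ?j' ?C) x) * (W (insert j ?B) x - W (insert ?j' ?B) x)" for x
  proof -
    have wr: "W (insert u A) (reidx R (exch k l) x) = W (insert u (exch k l ` A)) x"
      if "u \<in> {j, ?j'}" "insert u A \<subseteq> R" for u A
      by (simp only: wcount_reidx [OF ex(1) that(2)] ins [OF that(1)])
    show ?thesis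
      unfolding fdif_def hdif_def bdif_def
      using wr [of j "Cs j"] wr [of ?j' "Cs j"] wr [of j "Bs j"] wr [of ?j' "Bs j"] ix(11-14) by simp
  qed
  have E: "E \<subseteq> R - {j, ?j', k, l}" "card E = n - 2"
  proof -
    show "E \<subseteq> R - {j, ?j', k, l}"
      using ix k2 by (auto simp: E_def l_def theta_def split: if_splits)
    have "card E = card (Bs j - {k})"
      unfolding E_def by (rule card_image [OF inj_on_subset [OF inj_on_theta]]) (use ix in auto)
    then show "card E = n - 2" using ix k by simp
  qed
  have ER: "insert k E \<subseteq> R" "insert l E \<subseteq> R" "E \<subseteq> R" using E jR by auto
  define D where "D = (\<lambda>x. complex_of_real (fdif j x) - complex_of_real (fdif j (reidx R (exch k l) x)))"
  define G where "G = (\<lambda>x. cis (t * (W (insert k E) x - W E x)) - cis (t * (W (insert l E) x - W E x)))"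
  define A where "A = (\<lambda>x. \<exists>u\<in>{j, ?j'}. \<exists>v\<in>{k, l}. near_box n r (x u) (x v))"
  have "(\<integral>x. D x * (cis (t * W (insert k E) x) - cis (t * W (insert l E) x)) \<partial>M) =
      (\<integral>x. (D x * G x) * cis (t * W E x) \<partial>M)"
    by (intro Bochner_Integration.integral_cong)
       (auto simp: G_def left_diff_distrib right_diff_distrib cis_mult mult.assoc)
  also have "cmod \<dots> \<le> (16 * K ^ 3 * \<bar>t\<bar>) * (\<integral>x. of_bool (A x) \<partial>M) * dec t"
  proof (rule smoothing [of "{j, ?j', k, l}"])
    show "card {j, ?j', k, l} \<le> 4" using dist by simp
    have [measurable]: "fdif j \<in> borel_measurable M" by (rule fdif_meas [OF j])
    have [measurable]: "(\<lambda>x. fdif j (reidx R (exch k l) x)) \<in> borel_measurable M"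
      by (rule measurable_compose [OF measurable_reidx [OF ex(2)] fdif_meas [OF j]])
    have [measurable]: "(\<lambda>x. W (insert k E) x - W E x) \<in> borel_measurable M"
      "(\<lambda>x. W (insert l E) x - W E x) \<in> borel_measurable M"
      using ER by (auto intro!: borel_measurable_diff W_meas)
    show "(\<lambda>x. D x * G x) \<in> borel_measurable M" unfolding D_def G_def by measurable
    have m: "Measurable.pred M (\<lambda>x. near_box n r (x u) (x v))" if "u \<in> R" "v \<in> R" for u v
      using that by (intro measurable_near_box measurable_cfg_coord)
    note [measurable] = m [OF jR(1,3)] m [OF jR(1,4)] m [OF jR(2,3)] m [OF jR(2,4)]
    show "Measurable.pred M A" unfolding A_def by simp
    show "A x = A x'" if "\<And>i. i \<in> {j, ?j', k, l} \<Longrightarrow> x i = x' i" for x x'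
      using that by (simp add: A_def)
    show "cmod (D x * G x) \<le> 16 * K ^ 3 * \<bar>t\<bar> * of_bool (A x)" if x: "inbox x" for x
    proof (cases "A x")
      case False
      then have far: "\<not> near_box n r (x j) (x k)" "\<not> near_box n r (x ?j') (x k)"
        "\<not> near_box n r (x j) (x l)" "\<not> near_box n r (x ?j') (x l)"
        by (simp_all add: A_def)
      have sub: "insert j (insert ?j' (insert k (insert l (Cs j)))) \<subseteq> R"
        "insert j (insert ?j' (insert k (insert l (Bs j)))) \<subseteq> R"
        using ix(11-14) jR by auto
      have "W (insert j ?C) x - W (insert ?j' ?C) x = W (insert j (Cs j)) x - W (insert ?j' (Cs j)) x"
        by (rule W_exchange_far [OF x sub(1) ix(2,3) l(1) dist far])
      moreover have "W (insert j ?B) x - W (insert ?j' ?B) x = W (insert j (Bs j)) x - W (insert ?j' (Bs j)) x"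
        by (rule W_exchange_far [OF x sub(2) ix(5,6) l(2) dist far])
      ultimately have "fdif j (reidx R (exch k l) x) = fdif j x"
        unfolding fr by (simp add: fdif_def hdif_def bdif_def)
      then show ?thesis using False by (simp add: D_def)
    next
      case True
      have "\<bar>fdif j (reidx R (exch k l) x)\<bar> \<le> (2 * K) * (2 * K)"
        unfolding fr abs_mult using CR notin K1 by (intro mult_mono W_exchange_diff [OF x]) auto
      then have "cmod (D x) \<le> 4 * K\<^sup>2 + 4 * K\<^sup>2"
        unfolding D_def using fdif_le [OF j x]
        by (intro order_trans [OF norm_triangle_ineq4] add_mono) (auto simp: power2_eq_square)
      moreover have "cmod (G x) \<le> 2 * K * \<bar>t\<bar>"
      proof -
        have "cmod (G x) \<le> \<bar>t * (W (insert k E) x - W E x) - t * (W (insert l E) x - W E x)\<bar>"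
          unfolding G_def by (rule cis_diff_le)
        also have "\<dots> = \<bar>t\<bar> * \<bar>W (insert k E) x - W (insert l E) x\<bar>"
          by (simp add: abs_mult [symmetric] algebra_simps)
        also have "\<dots> \<le> \<bar>t\<bar> * (2 * K)"
          using E ER by (intro mult_left_mono W_exchange_diff [OF x]) auto
        finally show ?thesis by (simp add: mult_ac)
      qed
      ultimately have "cmod (D x * G x) \<le> (4 * K\<^sup>2 + 4 * K\<^sup>2) * (2 * K * \<bar>t\<bar>)"
        unfolding norm_mult by (intro mult_mono) auto
      also have "\<dots> = 16 * K ^ 3 * \<bar>t\<bar>" by (simp add: power2_eq_square power3_eq_cube)
      finally show ?thesis using True by simp
    qed
    show "D (flipc R r b x) * G (flipc R r b x) = D x * G x"
      if b: "blk_in (side n) r b" "good R E r d x b" "inbox x" for b x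
    proof -
      note fx = flip_W_exchange_diff [OF b]
      have jE: "j \<notin> E" "?j' \<notin> E" "k \<notin> E" "l \<notin> E" using E by auto
      have "fdif j (flipc R r b x) = fdif j x"
        unfolding fdif_def hdif_def bdif_def using ix jE by (subst (1 2) fx) auto
      moreover have "fdif j (reidx R (exch k l) (flipc R r b x)) = fdif j (reidx R (exch k l) x)"
        unfolding fr using CR jE by (subst (1 2) fx) auto
      moreover have "W (insert k E) (flipc R r b x) - W E (flipc R r b x) = W (insert k E) x - W E x"
        "W (insert l E) (flipc R r b x) - W E (flipc R r b x) = W (insert l E) x - W E x"
        using ER jE by (auto intro!: flip_W_insert_diff [OF b])
      ultimately show ?thesis by (simp only: D_def G_def)
    qed
  qed (use E jR t K1 in auto)
  also have "\<dots> \<le> (16 * K ^ 3 * \<bar>t\<bar>) * (1296 * r\<^sup>2 / n) * dec t"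
    using four_near_prob [OF jR dist] K1 unfolding A_def by (intro mult_right_mono mult_left_mono) auto
  finally show ?thesis by (simp only: D_def)
qed

text \<open>\<open>fdif j\<close> depends on the first 2n coordinates, so the resampling is run with
  m = 2n. It has n - 1 terms, each smaller by a factor of order 1/n, so the total is of order
  |t|.\<close>

lemma cov_second:
  assumes j: "j \<in> I" and t: "\<bar>t\<bar> \<le> pi"
  shows "cmod ((\<integral>x. fdif j x * cis (t * W (Bs j) x) \<partial>M) -
      (\<integral>x. complex_of_real (fdif j x) \<partial>M) * (\<integral>x. cis (t * W (Bs j) x) \<partial>M)) \<le> CA * \<bar>t\<bar> * dec t"
proof -
  note ix = idx [OF j]
  define E where "E = (\<lambda>k. theta (2 * n) k ` (Bs j - {k}))"
  define T where "T = (\<lambda>k. \<integral>x. (complex_of_real (fdif j x) - complex_of_real (fdif j (reidx R (exch k (k + 2 * n)) x))) *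
      (cis (t * W (insert k (E k)) x) - cis (t * W (insert (k + 2 * n) (E k)) x)) \<partial>M)"
  \<comment> \<open>The bound by 4 K^2 is available only for configurations in the box. The
    telescoping asks for a bound at every x, and the crude n^2 serves, since it does not enter the
    result.\<close>
  have fb: "cmod (complex_of_real (fdif j x)) \<le> real n * real n" for x
  proof -
    have fin: "finite (Cs j)" "finite (Bs j)" using ix finite_subset by (metis finite_lessThan)+
    have cC: "card (insert u (Cs j)) \<le> n" "card (insert u (Bs j)) \<le> n" for u
    proof -
      have "card (Cs j) = n - 1" using j by (simp add: Cs_def I_def)
      then show "card (insert u (Cs j)) \<le> n" "card (insert u (Bs j)) \<le> n"
        using card_insert_le_m1 [of n "Cs j" u] card_insert_le_m1 [of n "Bs j" u] ix n1 by auto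
    qed
    have "0 \<le> W (insert u (Cs j)) x \<and> W (insert u (Cs j)) x \<le> n" "0 \<le> W (insert u (Bs j)) x \<and> W (insert u (Bs j)) x \<le> n" for u
      using wcount_bounds [of "insert u (Cs j)" "side n" r d x] wcount_bounds [of "insert u (Bs j)" "side n" r d x] cC [of u] fin by auto
    from this(1) [of j] this(1) [of "j + n"] this(2) [of j] this(2) [of "j + n"]
    have "\<bar>hdif j x\<bar> \<le> n" "\<bar>bdif j x\<bar> \<le> n" unfolding hdif_def bdif_def by linarith+
    then have "\<bar>hdif j x\<bar> * \<bar>bdif j x\<bar> \<le> real n * real n" by (intro mult_mono) auto
    then show ?thesis by (simp add: fdif_def norm_mult)
  qed
  have "(\<integral>x. complex_of_real (fdif j x) * cis (t * W (Bs j) x) \<partial>M) -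
      (\<integral>x. complex_of_real (fdif j x) \<partial>M) * (\<integral>x. cis (t * W (Bs j) x) \<partial>M) = (\<Sum>k\<in>Bs j. T k) / 2"
    unfolding T_def E_def
  proof (rule covariance_telescope [where m = "2 * n" and B = "Bs j" and KF = "real n * real n" and Kg = 1 and g = "\<lambda>y. cis (t * y)", OF n1 refl])
    show "complex_of_real (fdif j x) = complex_of_real (fdif j x')" if "\<And>i. i < 2 * n \<Longrightarrow> x i = x' i" for x x'
    proof -
      have "W A x = W A x'" if "A \<subseteq> {..<2 * n}" for A
        using that \<open>\<And>i. i < 2 * n \<Longrightarrow> x i = x' i\<close> by (intro wcount_cong) auto
      moreover have "insert u (Cs j) \<subseteq> {..<2 * n}" "insert u (Bs j) \<subseteq> {..<2 * n}" if "u \<in> {j, j + n}" for u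
        using ix(4,7,9,10) that by auto
      ultimately have "hdif j x = hdif j x'" "bdif j x = bdif j x'"
        unfolding hdif_def bdif_def by (metis insertI1 insertI2)+
      then show ?thesis by (simp add: fdif_def)
    qed
    show "(\<lambda>x. complex_of_real (fdif j x)) \<in> borel_measurable M"
      using fdif_meas [OF j] by simp
    show "(\<lambda>y. cis (t * y)) \<in> borel_measurable borel" by measurable
  qed (use fb ix in auto)
  also have "cmod \<dots> \<le> (\<Sum>k\<in>Bs j. 16 * K ^ 3 * \<bar>t\<bar> * (1296 * r\<^sup>2 / n) * dec t) / 2"
  proof -
    have "cmod (\<Sum>k\<in>Bs j. T k) \<le> (\<Sum>k\<in>Bs j. 16 * K ^ 3 * \<bar>t\<bar> * (1296 * r\<^sup>2 / n) * dec t)"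
      unfolding T_def E_def by (rule sum_norm_le [OF cov_second_term [OF j t]])
    then show ?thesis unfolding norm_divide norm_numeral by (rule divide_right_mono) simp
  qed
  also have "\<dots> = real (n - 1) / n * (CA * \<bar>t\<bar> * dec t)"
    using ix by (simp add: CA_def)
  also have "\<dots> \<le> 1 * (CA * \<bar>t\<bar> * dec t)"
    using n1 K1 by (intro mult_right_mono) (auto simp: CA_def)
  finally show ?thesis by simp
qed

lemma variance_formula: "\<sigma>2 = (\<Sum>j\<in>I. (\<integral>x. fdif j x \<partial>M)) / 2"
proof -
  have "(\<integral>x. W I x * complex_of_real (W I x) \<partial>M) - (\<integral>x. complex_of_real (W I x) \<partial>M) * (\<integral>x. complex_of_real (W I x) \<partial>M) =
     (\<Sum>j\<in>I. (\<integral>x. hdif j x * (complex_of_real (W (insert j (Bs j)) x) - complex_of_real (W (insert (j + n) (Bs j)) x)) \<partial>M)) / 2"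
    by (rule cov_first [where Kg = n]) auto
  also have "(\<lambda>j x. hdif j x * (complex_of_real (W (insert j (Bs j)) x) - complex_of_real (W (insert (j + n) (Bs j)) x))) =
      (\<lambda>j x. complex_of_real (fdif j x))"
    by (simp add: fdif_def bdif_def fun_eq_iff)
  finally have "complex_of_real ((\<integral>x. W I x * W I x \<partial>M) - (\<integral>x. W I x \<partial>M) * (\<integral>x. W I x \<partial>M)) =
      complex_of_real ((\<Sum>j\<in>I. (\<integral>x. fdif j x \<partial>M)) / 2)"
    by (simp flip: of_real_mult)
  then have 1: "(\<integral>x. W I x * W I x \<partial>M) - (\<integral>x. W I x \<partial>M) * (\<integral>x. W I x \<partial>M) = (\<Sum>j\<in>I. (\<integral>x. fdif j x \<partial>M)) / 2"
    by (simp only: of_real_eq_iff)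
  have "integrable M (\<lambda>x. W I x * W I x)"
    by (rule integrable_const_bound [where B = "real n * real n"])
       (use W_I_bounds W_meas [OF I_R] in \<open>auto intro!: mult_mono simp: abs_mult\<close>)
  then have "\<sigma>2 = (\<integral>x. W I x * W I x \<partial>M) - (\<integral>x. W I x \<partial>M) * (\<integral>x. W I x \<partial>M)"
    unfolding \<sigma>2_def using variance_eq [OF W_I_integrable] by (simp add: power2_eq_square)
  with 1 show ?thesis by simp
qed

lemma fdif_integral_le: "j \<in> I \<Longrightarrow> \<bar>\<integral>x. fdif j x \<partial>M\<bar> \<le> 4 * K\<^sup>2"
proof -
  assume j: "j \<in> I"
  have "\<bar>\<integral>x. fdif j x \<partial>M\<bar> \<le> (\<integral>x. \<bar>fdif j x\<bar> \<partial>M)" by (rule integral_abs_bound)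
  also have "\<dots> \<le> (\<integral>x. 4 * K\<^sup>2 \<partial>M)"
  proof (rule integral_mono_AE')
    show "AE x in M. \<bar>fdif j x\<bar> \<le> 4 * K\<^sup>2" using AE_box by eventually_elim (rule fdif_le [OF j])
  qed auto
  finally show ?thesis by (simp add: prob_space)
qed

lemma variance_upper: "\<sigma>2 \<le> 2 * K\<^sup>2 * n"
proof -
  have "(\<Sum>j\<in>I. (\<integral>x. fdif j x \<partial>M)) \<le> (\<Sum>j\<in>I. 4 * K\<^sup>2)"
    using fdif_integral_le by (intro sum_mono) (simp add: abs_le_iff)
  then show ?thesis by (simp add: variance_formula I_def mult_ac)
qed

text \<open>The errors of \<open>ode_term\<close> collected: 4 K^3 for the Taylor remainder,
  \<open>CA\<close> for the decorrelation, and 4 K^3 for restoring the omitted point.\<close>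

definition "CB = 8 * K ^ 3 + CA"

lemma ode_term:
  assumes j: "j \<in> I" and t: "\<bar>t\<bar> \<le> pi"
  shows "cmod ((\<integral>x. hdif j x * (cis (t * W (insert j (Bs j)) x) - cis (t * W (insert (j + n) (Bs j)) x)) \<partial>M)
     - (cis t - 1) * (\<integral>x. complex_of_real (fdif j x) \<partial>M) * \<phi> t) \<le> CB * t\<^sup>2 * dec t"
proof -
  note ix = idx [OF j]
  let ?B = "Bs j" and ?j' = "j + n"
  have BR: "?B \<subseteq> R" using ix by auto
  define a where "a = (\<lambda>x. W (insert j ?B) x - W ?B x)"
  define a' where "a' = (\<lambda>x. W (insert ?j' ?B) x - W ?B x)"
  \<comment> \<open>The nonlinear part of the phase increment. Its linear part contributes (cis t -
    1) times a - a', which is \<open>bdif\<close>, and multiplying by \<open>hdif\<close> gives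
    \<open>fdif\<close>.\<close>
  define \<rho> where "\<rho> = (\<lambda>x. (cis (t * a x) - 1 - a x * (cis t - 1)) - (cis (t * a' x) - 1 - a' x * (cis t - 1)))"
  have am [measurable]: "a \<in> borel_measurable M" "a' \<in> borel_measurable M"
    unfolding a_def a'_def using ix BR by (auto intro!: borel_measurable_diff W_meas)
  note [measurable] = hdif_meas [OF j] fdif_meas [OF j] cis_W_meas [OF BR]
  have \<rho>m [measurable]: "\<rho> \<in> borel_measurable M" unfolding \<rho>_def by measurable
  have \<rho>b: "cmod (\<rho> x) \<le> 2 * K\<^sup>2 * t\<^sup>2" if x: "inbox x" for x
  proof -
    have "\<bar>a x\<bar> \<le> K" "\<bar>a' x\<bar> \<le> K" unfolding a_def a'_def using ix by (auto intro!: W_insert_diff [OF x])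
    then have "cmod (\<rho> x) \<le> K\<^sup>2 * t\<^sup>2 + K\<^sup>2 * t\<^sup>2"
      unfolding \<rho>_def by (intro order_trans [OF norm_triangle_ineq4] add_mono cis_mult_taylor K1)
    then show ?thesis by (simp add: mult_ac)
  qed
  define H where "H = (\<lambda>x. hdif j x * \<rho> x)"
  have Hb: "cmod (H x) \<le> 4 * K ^ 3 * t\<^sup>2" if x: "inbox x" for x
  proof -
    have "cmod (H x) \<le> 2 * K * (2 * K\<^sup>2 * t\<^sup>2)"
      unfolding H_def norm_mult using hdif_le [OF j x] \<rho>b [OF x] K1 by (intro mult_mono) auto
    then show ?thesis by (simp add: power2_eq_square power3_eq_cube)
  qed
  have split: "hdif j x * (cis (t * W (insert j ?B) x) - cis (t * W (insert ?j' ?B) x)) =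
      H x * cis (t * W ?B x) + (cis t - 1) * (fdif j x * cis (t * W ?B x))" for x
  proof -
    have e1: "cis (t * W (insert j ?B) x) = cis (t * a x) * cis (t * W ?B x)"
      "cis (t * W (insert ?j' ?B) x) = cis (t * a' x) * cis (t * W ?B x)"
      by (simp_all add: a_def a'_def cis_mult algebra_simps)
    have e2: "complex_of_real (fdif j x) = hdif j x * (complex_of_real (a x) - complex_of_real (a' x))"
      by (simp add: fdif_def bdif_def a_def a'_def)
    show ?thesis unfolding e1 e2 H_def \<rho>_def by (simp add: algebra_simps)
  qed
  have i1: "integrable M (\<lambda>x. H x * cis (t * W ?B x))"
  proof (rule integrable_const_bound [where B = "4 * K ^ 3 * t\<^sup>2"])
    show "AE x in M. cmod (H x * cis (t * W ?B x)) \<le> 4 * K ^ 3 * t\<^sup>2"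
      using AE_box by eventually_elim (use Hb in \<open>simp add: norm_mult\<close>)
  qed (simp add: H_def)
  have i2: "integrable M (\<lambda>x. fdif j x * cis (t * W ?B x))"
  proof (rule integrable_const_bound [where B = "4 * K\<^sup>2"])
    show "AE x in M. cmod (fdif j x * cis (t * W ?B x)) \<le> 4 * K\<^sup>2"
      using AE_box by eventually_elim (use fdif_le [OF j] in \<open>simp add: norm_mult\<close>)
  qed simp
  let ?P = "\<integral>x. cis (t * W ?B x) \<partial>M" and ?f = "\<integral>x. complex_of_real (fdif j x) \<partial>M"
  let ?X = "\<integral>x. H x * cis (t * W ?B x) \<partial>M" and ?Y = "\<integral>x. fdif j x * cis (t * W ?B x) \<partial>M"
  have "(\<integral>x. hdif j x * (cis (t * W (insert j ?B) x) - cis (t * W (insert ?j' ?B) x)) \<partial>M) = ?X + (cis t - 1) * ?Y"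
    unfolding split using i1 i2 by simp
  then have eq: "(\<integral>x. hdif j x * (cis (t * W (insert j ?B) x) - cis (t * W (insert ?j' ?B) x)) \<partial>M)
     - (cis t - 1) * ?f * \<phi> t = ?X + ((cis t - 1) * (?Y - ?f * ?P) + (cis t - 1) * ?f * (?P - \<phi> t))"
    by (simp add: algebra_simps)
  \<comment> \<open>Three errors of order t^2: the nonlinear part, the covariance of
    \<open>fdif j\<close> with the phase, and the difference between the transform without point j
    and \<phi>. The last two gain a factor |t| from cis t - 1.\<close>
  have "cmod (?X + ((cis t - 1) * (?Y - ?f * ?P) + (cis t - 1) * ?f * (?P - \<phi> t))) \<le>
      4 * K ^ 3 * t\<^sup>2 * dec t + (\<bar>t\<bar> * (CA * \<bar>t\<bar> * dec t) + \<bar>t\<bar> * (4 * K\<^sup>2) * (K * \<bar>t\<bar> * dec t))"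
  proof (intro order_trans [OF norm_triangle_ineq] add_mono)
    show "cmod ?X \<le> 4 * K ^ 3 * t\<^sup>2 * dec t"
    proof (rule smoothing_plain [of "{j, ?j'}"])
      show "H (flipc R r b x) = H x" if b: "blk_in (side n) r b" "good R ?B r d x b" "inbox x" for b x
      proof -
        have "hdif j (flipc R r b x) = hdif j x"
          unfolding hdif_def using ix by (intro flip_W_exchange_diff [OF b]) auto
        moreover have "a (flipc R r b x) = a x" "a' (flipc R r b x) = a' x"
          unfolding a_def a'_def using ix by (auto intro!: flip_W_insert_diff [OF b])
        ultimately show ?thesis by (simp only: H_def \<rho>_def)
      qed
      show "card {j, ?j'} \<le> 4" by (simp add: card_insert_if)
      show "H \<in> borel_measurable M" unfolding H_def by measurable
    qed (use ix Hb t K1 n1 in auto)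
    show "cmod ((cis t - 1) * (?Y - ?f * ?P)) \<le> \<bar>t\<bar> * (CA * \<bar>t\<bar> * dec t)"
      unfolding norm_mult by (intro mult_mono cmod_cis_minus_1 cov_second [OF j t]) auto
    have "cmod ?f \<le> 4 * K\<^sup>2" using fdif_integral_le [OF j] by simp
    then show "cmod ((cis t - 1) * ?f * (?P - \<phi> t)) \<le> \<bar>t\<bar> * (4 * K\<^sup>2) * (K * \<bar>t\<bar> * dec t)"
      unfolding norm_mult by (intro mult_mono cmod_cis_minus_1 phi_Bs [OF j t]) auto
  qed
  also have "\<dots> = CB * t\<^sup>2 * dec t"
  proof -
    have "4 * k ^ 3 * u\<^sup>2 * e + (u * (a * u * e) + u * (4 * k\<^sup>2) * (k * u * e)) = (8 * k ^ 3 + a) * u\<^sup>2 * e"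
      for k u e a :: real
      by (simp add: power2_eq_square power3_eq_cube algebra_simps)
    from this [of K "\<bar>t\<bar>" "dec t" CA] show ?thesis unfolding power2_abs CB_def .
  qed
  finally show ?thesis unfolding eq .
qed

lemma ode_bound:
  assumes t: "\<bar>t\<bar> \<le> pi"
  shows "cmod ((\<integral>x. W I x * cis (t * W I x) \<partial>M) - (\<integral>x. complex_of_real (W I x) \<partial>M) * \<phi> t
      - (cis t - 1) * \<sigma>2 * \<phi> t) \<le> CB * n * t\<^sup>2 * dec t"
proof -
  let ?T = "\<lambda>j. \<integral>x. hdif j x * (cis (t * W (insert j (Bs j)) x) - cis (t * W (insert (j + n) (Bs j)) x)) \<partial>M"
  let ?f = "\<lambda>j. \<integral>x. complex_of_real (fdif j x) \<partial>M"
  have 1: "(\<integral>x. W I x * cis (t * W I x) \<partial>M) - (\<integral>x. complex_of_real (W I x) \<partial>M) * \<phi> t = (\<Sum>j\<in>I. ?T j) / 2"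
    unfolding \<phi>_def by (rule cov_first [where Kg = 1]) auto
  have 2: "(cis t - 1) * \<sigma>2 * \<phi> t = (\<Sum>j\<in>I. (cis t - 1) * ?f j * \<phi> t) / 2"
    by (simp add: variance_formula sum_distrib_left sum_distrib_right)
  have eq: "(\<integral>x. W I x * cis (t * W I x) \<partial>M) - (\<integral>x. complex_of_real (W I x) \<partial>M) * \<phi> t
      - (cis t - 1) * \<sigma>2 * \<phi> t = (\<Sum>j\<in>I. ?T j - (cis t - 1) * ?f j * \<phi> t) / 2"
    unfolding 1 2 by (simp add: sum_subtractf diff_divide_distrib)
  have "cmod (\<Sum>j\<in>I. ?T j - (cis t - 1) * ?f j * \<phi> t) \<le> (\<Sum>j\<in>I. CB * t\<^sup>2 * dec t)"
    by (rule sum_norm_le [OF ode_term [OF _ t]])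
  moreover have "(\<Sum>j\<in>I. CB * t\<^sup>2 * dec t) = CB * n * t\<^sup>2 * dec t" by (simp add: I_def)
  moreover have "0 \<le> CB * n * t\<^sup>2 * dec t" using K1 by (simp add: CB_def CA_def)
  ultimately show ?thesis unfolding eq norm_divide norm_numeral by linarith
qed

end

subsection \<open>Rates of approximation\<close>

lemma pts_space_cfg: "pts_space n = cfg {..<n} n"
  by (simp add: pts_space_def cfg_def upoint_def)

lemma Wd_wcount: "real (Wd n r d V) = wcount (side n) r d V {..<n}"
  by (simp add: Wd_def Mdeg_def wcount_def gcount_def gdeg_def)

context rgg
begin

section \<open>Transfer from the enlarged family to the n given points\<close>

lemma pts_space_distr: "pts_space n = distr M (pts_space n) (\<lambda>x. restrict x I)"
  unfolding pts_space_cfg I_def by (rule restrict_cfg [OF n1, symmetric]) auto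

lemma restrict_meas: "(\<lambda>x. restrict x I) \<in> measurable M (pts_space n)"
  unfolding pts_space_cfg cfg_def I_def by (rule measurable_restrict_subset) auto

lemma W_pts: "W I (restrict x I) = W I x"
  by (rule wcount_cong) simp

lemma W_meas_pts: "W I \<in> borel_measurable (pts_space n)"
  unfolding pts_space_cfg by (rule measurable_wcount) (auto simp: I_def)

lemma integral_pts:
  fixes f :: "real \<Rightarrow> 'b :: {banach, second_countable_topology}"
  assumes [measurable]: "f \<in> borel_measurable borel"
  shows "(\<integral>V. f (real (Wd n r d V)) \<partial>pts_space n) = (\<integral>x. f (W I x) \<partial>M)"
proof -
  note [measurable] = W_meas_pts
  have "(\<integral>V. f (real (Wd n r d V)) \<partial>pts_space n) = (\<integral>V. f (W I V) \<partial>pts_space n)"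
    by (simp add: Wd_wcount I_def)
  also have "\<dots> = (\<integral>V. f (W I V) \<partial>distr M (pts_space n) (\<lambda>x. restrict x I))"
    by (simp flip: pts_space_distr)
  also have "\<dots> = (\<integral>x. f (W I (restrict x I)) \<partial>M)"
    by (rule integral_distr [OF restrict_meas]) measurable
  finally show ?thesis by (simp add: W_pts)
qed

lemma W_mean_eq: "W_mean n r d = (\<integral>x. W I x \<partial>M)"
  unfolding W_mean_def by (rule integral_pts) simp

lemma W_var_eq: "W_var n r d = \<sigma>2"
  unfolding W_var_def \<sigma>2_def W_mean_eq [symmetric]
  by (rule integral_pts [of "\<lambda>y. (y - W_mean n r d)\<^sup>2"]) simp

abbreviation "p \<equiv> W_pmf n r d"

lemma p_eq: "p a = (\<integral>x. of_bool (W I x = of_int a) \<partial>M)"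
proof -
  have "(\<integral>V. (of_bool (real (Wd n r d V) = of_int a) :: real) \<partial>pts_space n) =
      (\<integral>V. indicator {V \<in> space (pts_space n). int (Wd n r d V) = a} V \<partial>pts_space n)"
  proof (intro Bochner_Integration.integral_cong refl)
    fix V assume "V \<in> space (pts_space n)"
    moreover have "real (Wd n r d V) = of_int a \<longleftrightarrow> int (Wd n r d V) = a"
      by (metis of_int_eq_iff of_int_of_nat_eq)
    ultimately show "of_bool (real (Wd n r d V) = of_int a) =
       (indicator {V \<in> space (pts_space n). int (Wd n r d V) = a} V :: real)"
      by (simp add: indicator_def)
  qed
  also have "\<dots> = measure (pts_space n) ({V \<in> space (pts_space n). int (Wd n r d V) = a} \<inter> space (pts_space n))"
    by simp
  also have "{V \<in> space (pts_space n). int (Wd n r d V) = a} \<inter> space (pts_space n) = {V \<in> space (pts_space n). int (Wd n r d V) = a}"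
    by auto
  finally have "(\<integral>V. (of_bool (real (Wd n r d V) = of_int a) :: real) \<partial>pts_space n) = p a"
    unfolding W_pmf_def .
  then show ?thesis
    using integral_pts [of "\<lambda>y. of_bool (y = of_int a) :: real"] by simp
qed

lemma W_I_values: "\<exists>a\<in>{0..int n}. W I x = of_int a"
proof
  let ?c = "card {i \<in> I. gdeg (\<lambda>i j. torus_dist (side n) (x i) (x j) \<le> r) I i \<noteq> d}"
  show "W I x = of_int (int ?c)" by (simp add: wcount_def gcount_def)
  have "?c \<le> card I" by (rule card_mono) (auto simp: I_def)
  then show "int ?c \<in> {0..int n}" by (simp add: I_def)
qed

lemma p_outside: "a \<notin> {0..int n} \<Longrightarrow> p a = 0"
proof -
  assume "a \<notin> {0..int n}"
  then have "W I x \<noteq> of_int a" for x using W_I_values [of x] by auto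
  then show ?thesis by (simp add: p_eq)
qed

lemma sum_p:
  fixes f :: "real \<Rightarrow> complex"
  shows "(\<Sum>a\<in>{0..int n}. f (of_int a) * p a) = (\<integral>x. f (W I x) \<partial>M)"
proof -
  have [measurable]: "W I \<in> borel_measurable M" by (rule W_meas [OF I_R])
  have "(\<integral>x. f (W I x) \<partial>M) = (\<integral>x. (\<Sum>a\<in>{0..int n}. f (of_int a) * of_real (of_bool (W I x = of_int a))) \<partial>M)"
  proof (intro Bochner_Integration.integral_cong refl)
    fix x
    obtain b where b: "b \<in> {0..int n}" "W I x = of_int b" using W_I_values by blast
    have "(\<Sum>a\<in>{0..int n}. f (of_int a) * of_real (of_bool (W I x = of_int a))) =
        (\<Sum>a\<in>{0..int n}. if a = b then f (of_int a) else 0)"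
      using b by (intro sum.cong) auto
    then show "f (W I x) = (\<Sum>a\<in>{0..int n}. f (of_int a) * of_real (of_bool (W I x = of_int a)))"
      using b by simp
  qed
  also have "\<dots> = (\<Sum>a\<in>{0..int n}. (\<integral>x. f (of_int a) * of_real (of_bool (W I x = of_int a)) \<partial>M))"
  proof (intro Bochner_Integration.integral_sum)
    fix a
    show "integrable M (\<lambda>x. f (of_int a) * of_real (of_bool (W I x = of_int a)))"
      by (rule integrable_const_bound [where B = "cmod (f (of_int a))"]) (auto simp: norm_mult)
  qed
  also have "\<dots> = (\<Sum>a\<in>{0..int n}. f (of_int a) * p a)" by (simp add: p_eq)
  finally show ?thesis by simp
qed

definition "CK = exp 3 + exp 3 * CB + 2 * K\<^sup>2"

lemma CB_nonneg: "CB \<ge> 0"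
  using K1 by (simp add: CA_def CB_def)

lemma CK_bounds: "CK \<ge> 1" "exp 3 \<le> CK" "exp 3 * CB \<le> CK" "2 * K\<^sup>2 \<le> CK"
proof -
  have "exp 3 \<ge> (1 :: real)" "0 \<le> exp 3 * CB" "0 \<le> 2 * K\<^sup>2" using CB_nonneg by auto
  then show "CK \<ge> 1" "exp 3 \<le> CK" "exp 3 * CB \<le> CK" "2 * K\<^sup>2 \<le> CK" unfolding CK_def by linarith+
qed

text \<open>A small variance would keep the centred transform near 1, since 1 - x^2/2 \<le> cos x;
  the smoothing bound makes its modulus at most 1/2 at a suitable t.\<close>

lemma variance_lower:
  assumes n: "n \<ge> 4 / crate r d"
  shows "crate r d / 8 * n \<le> \<sigma>2"
proof -
  let ?c = "crate r d"
  have c: "?c > 0" by (rule crate_pos [OF r])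
  have [measurable]: "W I \<in> borel_measurable M" by (rule W_meas [OF I_R])
  define m where "m = (\<integral>x. W I x \<partial>M)"
  \<comment> \<open>Chosen so that the exponent is 3 - 4 = -1 and the bound on \<phi>(t) becomes 1/e
    \<le> 1/2. The lower bound on n ensures t \<le> 1.\<close>
  define t where "t = sqrt (4 / (?c * n))"
  have cn: "?c * n > 0" using c n1 by simp
  have t2: "t\<^sup>2 = 4 / (?c * n)" using cn by (simp add: t_def)
  have "t \<le> 1" unfolding t_def using n c cn by (simp add: field_simps)
  moreover have "t \<ge> 0" using cn by (simp add: t_def)
  ultimately have "\<bar>t\<bar> \<le> pi" using pi_ge_two by linarith
  then have "cmod (\<phi> t) \<le> dec t" by (rule phi_bound)
  also have "dec t = exp (-1)"
    using c n1 by (simp add: t2 flip: exp_add)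
  also have "exp (-1) \<le> (1/2 :: real)"
    using exp_ge_add_one_self [of "1::real"] by (simp add: exp_minus field_simps)
  finally have half: "cmod (\<phi> t) \<le> 1/2" .
  have sq: "integrable M (\<lambda>x. (W I x - m)\<^sup>2)"
  proof (rule integrable_const_bound [where B = "(real n + \<bar>m\<bar>)\<^sup>2"])
    have "\<bar>W I x - m\<bar> \<le> real n + \<bar>m\<bar>" for x using W_I_bounds [of x] by linarith
    then have "\<bar>W I x - m\<bar>\<^sup>2 \<le> (real n + \<bar>m\<bar>)\<^sup>2" for x by (intro power_mono) auto
    then show "AE x in M. norm ((W I x - m)\<^sup>2) \<le> (real n + \<bar>m\<bar>)\<^sup>2" by simp
  qed measurable
  have "1 - t\<^sup>2 / 2 * \<sigma>2 = (\<integral>x. 1 - t\<^sup>2 / 2 * (W I x - m)\<^sup>2 \<partial>M)"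
    using sq by (simp add: \<sigma>2_def m_def prob_space)
  also have "\<dots> \<le> (\<integral>x. cos (t * (W I x - m)) \<partial>M)"
  proof (rule integral_mono)
    show "integrable M (\<lambda>x. cos (t * (W I x - m)))"
      by (rule integrable_const_bound [where B = 1]) auto
    fix x
    have "1 - (t * (W I x - m))\<^sup>2 / 2 \<le> cos (t * (W I x - m))"
    proof -
      have c2: "cos y = 1 - 2 * (sin (y / 2))\<^sup>2" for y :: real
        using cos_double_sin [of "y / 2"] by simp
      have "(sin z)\<^sup>2 \<le> z\<^sup>2" for z :: real
        using abs_sin_x_le_abs_x [of z] by (simp add: abs_le_square_iff)
      from this [of "t * (W I x - m) / 2"] show ?thesis
        unfolding c2 [of "t * (W I x - m)"] by (simp add: power_divide)
    qed
    then show "1 - t\<^sup>2 / 2 * (W I x - m)\<^sup>2 \<le> cos (t * (W I x - m))"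
      by (simp add: power_mult_distrib)
  qed (use sq in auto)
  also have "\<dots> = Re (\<integral>x. cis (t * (W I x - m)) \<partial>M)"
  proof -
    have "integrable M (\<lambda>x. cis (t * (W I x - m)))"
      by (rule integrable_const_bound [where B = 1]) auto
    from integral_Re [OF this] show ?thesis by simp
  qed
  also have "(\<integral>x. cis (t * (W I x - m)) \<partial>M) = (\<integral>x. cis (- (t * m)) * cis (t * W I x) \<partial>M)"
    by (intro Bochner_Integration.integral_cong) (auto simp: cis_mult algebra_simps)
  also have "\<dots> = cis (- (t * m)) * \<phi> t" by (simp add: \<phi>_def)
  also have "Re \<dots> \<le> cmod (cis (- (t * m)) * \<phi> t)" by (rule complex_Re_le_cmod)
  also have "\<dots> \<le> 1/2" using half by (simp add: norm_mult)
  finally have "t\<^sup>2 * \<sigma>2 \<ge> 1" by simp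
  then have "\<sigma>2 \<ge> ?c * n / 4" using cn unfolding t2 by (simp add: field_simps)
  moreover have "?c * n / 4 \<ge> ?c / 8 * n" using cn by linarith
  ultimately show ?thesis by linarith
qed

text \<open>One constant has to serve as decay rate and as lower variance rate, so the decay rate
  \<open>crate\<close> is weakened to an eighth.\<close>

lemma comparison:
  assumes n: "n \<ge> 4 / crate r d"
  shows "tp_comparison p n (W_mean n r d) (W_var n r d) (crate r d / 8) CK"
proof
  have c: "crate r d > 0" by (rule crate_pos [OF r])
  have dec8: "exp (- (crate r d * n * t\<^sup>2)) \<le> exp (- (crate r d / 8 * n * t\<^sup>2))" for t :: real
    using c by (simp add: mult_right_mono)
  have ph: "(\<Sum>a\<in>{0..int n}. p a * cis (of_int a * t)) = \<phi> t" for t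
    using sum_p [of "\<lambda>y. cis (t * y)"] by (simp add: \<phi>_def mult.commute)
  have [measurable]: "W I \<in> borel_measurable M" by (rule W_meas [OF I_R])
  show "1 \<le> n" by (rule n1)
  show "0 < crate r d / 8" using c by simp
  show "1 \<le> CK" by (rule CK_bounds)
  show "p a = 0" if "a \<notin> {0..int n}" for a using that by (rule p_outside)
  have "complex_of_real (\<Sum>a\<in>{0..int n}. p a) = 1"
    using sum_p [of "\<lambda>_. 1"] by (simp add: prob_space)
  then show "(\<Sum>a\<in>{0..int n}. p a) = 1" by (simp only: of_real_eq_1_iff)
  show "crate r d / 8 * n \<le> W_var n r d" unfolding W_var_eq by (rule variance_lower [OF n])
  show "W_var n r d \<le> CK * n"
    unfolding W_var_eq using variance_upper mult_right_mono [OF CK_bounds(4), of n] by simp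
  fix t :: real assume t: "\<bar>t\<bar> \<le> pi"
  have "cmod (\<phi> t) \<le> exp 3 * exp (- (crate r d * n * t\<^sup>2))" by (rule phi_bound [OF t])
  also have "\<dots> \<le> CK * exp (- (crate r d / 8 * n * t\<^sup>2))"
    using CK_bounds dec8 by (intro mult_mono) auto
  finally show "cmod (\<Sum>a\<in>{0..int n}. p a * cis (of_int a * t)) \<le> CK * exp (- (crate r d / 8 * n * t\<^sup>2))"
    by (simp add: ph)
  have i: "integrable M (\<lambda>x. W I x * cis (t * W I x))" "integrable M (\<lambda>x. cis (t * W I x))"
    by (rule integrable_const_bound [where B = n], use W_I_bounds in \<open>auto simp: norm_mult\<close>,
        rule integrable_const_bound [where B = 1], auto)
  have "(\<Sum>a\<in>{0..int n}. (of_int a - W_mean n r d) * p a * cis (of_int a * t)) =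
      (\<integral>x. (W I x - W_mean n r d) * cis (t * W I x) \<partial>M)"
    using sum_p [of "\<lambda>y. (y - W_mean n r d) * cis (t * y)"] by (simp add: mult_ac)
  also have "\<dots> = (\<integral>x. W I x * cis (t * W I x) - W_mean n r d * cis (t * W I x) \<partial>M)"
    by (simp add: left_diff_distrib)
  also have "\<dots> = (\<integral>x. W I x * cis (t * W I x) \<partial>M) - W_mean n r d * \<phi> t"
    using i by (simp add: \<phi>_def)
  finally have D: "(\<Sum>a\<in>{0..int n}. (of_int a - W_mean n r d) * p a * cis (of_int a * t)) =
     (\<integral>x. W I x * cis (t * W I x) \<partial>M) - W_mean n r d * \<phi> t" .
  have "cmod ((\<integral>x. W I x * cis (t * W I x) \<partial>M) - (\<integral>x. complex_of_real (W I x) \<partial>M) * \<phi> t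
      - (cis t - 1) * \<sigma>2 * \<phi> t) \<le> CB * n * t\<^sup>2 * dec t" by (rule ode_bound [OF t])
  also have "\<dots> = (exp 3 * CB) * (n * t\<^sup>2) * exp (- (crate r d * n * t\<^sup>2))" by simp
  also have "\<dots> \<le> CK * (n * t\<^sup>2) * exp (- (crate r d / 8 * n * t\<^sup>2))"
    using CK_bounds dec8 by (intro mult_mono mult_right_mono) auto
  finally show "cmod ((\<Sum>a\<in>{0..int n}. (of_int a - W_mean n r d) * p a * cis (of_int a * t))
           - (cis t - 1) * W_var n r d * (\<Sum>a\<in>{0..int n}. p a * cis (of_int a * t)))
          \<le> CK * n * t\<^sup>2 * exp (- (crate r d / 8 * n * t\<^sup>2))"
    unfolding D ph W_var_eq by (simp add: W_mean_eq mult.assoc)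
qed

end

text \<open>The constants of both locales depend on r and d but not on n, so they can be fixed
  before n is chosen; each large n then instantiates the locales with the same values.\<close>

lemma rates:
  assumes "r > 0"
  shows "\<exists>(a::real) (b::real) (C::real). a > 0 \<and> C \<ge> 0 \<and> (\<forall>\<^sub>F n in sequentially.
     a * n \<le> W_var n r d \<and> W_var n r d \<le> b * n \<and>
     \<bar>d_loc (W_pmf n r d) (TP_pmf (W_mean n r d) (W_var n r d))\<bar> \<le> C / n \<and>
     \<bar>d_TV (W_pmf n r d) (TP_pmf (W_mean n r d) (W_var n r d))\<bar> \<le> C / sqrt n)"
proof -
  let ?c = "crate r d / 8" and ?CK = "rgg.CK r d"
  define C1 where "C1 = tp_comparison.C1 ?c ?CK"
  define C2 where "C2 = tp_comparison.C2 ?c ?CK"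
  define C where "C = max (max C1 (sqrt (8 * (C1\<^sup>2 + C2\<^sup>2)))) 0"
  have C: "C1 \<le> C" "sqrt (8 * (C1\<^sup>2 + C2\<^sup>2)) \<le> C" "0 \<le> C" by (auto simp: C_def)
  have "\<forall>\<^sub>F n in sequentially. real n \<ge> 4 / crate r d"
    using eventually_ge_at_top [of "nat \<lceil>4 / crate r d\<rceil>"] by eventually_elim linarith
  then have "\<forall>\<^sub>F n in sequentially. ?c * n \<le> W_var n r d \<and> W_var n r d \<le> ?CK * n \<and>
     \<bar>d_loc (W_pmf n r d) (TP_pmf (W_mean n r d) (W_var n r d))\<bar> \<le> C / n \<and>
     \<bar>d_TV (W_pmf n r d) (TP_pmf (W_mean n r d) (W_var n r d))\<bar> \<le> C / sqrt n"
    using eventually_n_large [of r d]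
  proof eventually_elim
    case (elim n)
    interpret G: rgg r d n by unfold_locales (use assms elim in auto)
    interpret T: tp_comparison "W_pmf n r d" n "W_mean n r d" "W_var n r d" ?c ?CK
      by (rule G.comparison) (use elim in simp)
    have "C1 / n \<le> C / n" "sqrt (8 * (C1\<^sup>2 + C2\<^sup>2)) / sqrt n \<le> C / sqrt n"
      using C by (auto intro!: divide_right_mono)
    then show ?case
      using T.var_lower T.var_upper T.d_loc_le T.d_TV_le unfolding C1_def C2_def by linarith
  qed
  then show ?thesis using crate_pos [OF assms, of d] C(3)
    by (intro exI [of _ ?c] exI [of _ ?CK] exI [of _ C] conjI) auto
qed

theorem mainTheorem4:
  fixes r :: real and d :: nat
  assumes "r > 0"
  shows "(\<lambda>n. d_TV (W_pmf n r d) (TP_pmf (W_mean n r d) (W_var n r d)))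
            \<in> O(\<lambda>n. 1 / sqrt (W_var n r d)) \<and>
         (\<lambda>n. d_loc (W_pmf n r d) (TP_pmf (W_mean n r d) (W_var n r d)))
            \<in> O(\<lambda>n. (ln (sqrt (W_var n r d))) powr (3/2) / W_var n r d)"
proof -
  obtain a b C :: real where a: "a > 0" and C: "C \<ge> 0" and ev: "\<forall>\<^sub>F n in sequentially.
     a * n \<le> W_var n r d \<and> W_var n r d \<le> b * n \<and>
     \<bar>d_loc (W_pmf n r d) (TP_pmf (W_mean n r d) (W_var n r d))\<bar> \<le> C / n \<and>
     \<bar>d_TV (W_pmf n r d) (TP_pmf (W_mean n r d) (W_var n r d))\<bar> \<le> C / sqrt n"
    using rates [OF assms, of d] by (elim exE conjE) (rule that)
  \<comment> \<open>The threshold gives a variance of at least e^2, hence ln \<sigma> \<ge> 1. The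
    logarithmic factor is then at least 1, so the sharper local rate 1/n implies the stated
    one.\<close>
  have large: "\<forall>\<^sub>F n in sequentially. n \<ge> 1 \<and> real n \<ge> exp 2 / a"
    using eventually_ge_at_top [of "max 1 (nat \<lceil>exp 2 / a\<rceil>)"] by eventually_elim linarith
  show ?thesis
  proof
    show "(\<lambda>n. d_TV (W_pmf n r d) (TP_pmf (W_mean n r d) (W_var n r d))) \<in> O(\<lambda>n. 1 / sqrt (W_var n r d))"
    proof (rule bigoI [where c = "C * sqrt b"])
      show "\<forall>\<^sub>F n in sequentially. norm (d_TV (W_pmf n r d) (TP_pmf (W_mean n r d) (W_var n r d)))
          \<le> C * sqrt b * norm (1 / sqrt (W_var n r d))"
        using ev large
      proof eventually_elim
        case (elim n)
        have v: "W_var n r d > 0" using a elim mult_pos_pos [of a n] by linarith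
        have "sqrt (W_var n r d) \<le> sqrt b * sqrt n"
          using elim by (simp flip: real_sqrt_mult)
        then have "1 / sqrt n \<le> sqrt b / sqrt (W_var n r d)"
          using v elim by (simp add: field_simps)
        from mult_left_mono [OF this C] show ?case using elim v by simp
      qed
    qed
    show "(\<lambda>n. d_loc (W_pmf n r d) (TP_pmf (W_mean n r d) (W_var n r d)))
        \<in> O(\<lambda>n. (ln (sqrt (W_var n r d))) powr (3/2) / W_var n r d)"
    proof (rule bigoI [where c = "C * b"])
      show "\<forall>\<^sub>F n in sequentially. norm (d_loc (W_pmf n r d) (TP_pmf (W_mean n r d) (W_var n r d)))
          \<le> C * b * norm ((ln (sqrt (W_var n r d))) powr (3/2) / W_var n r d)"
        using ev large
      proof eventually_elim
        case (elim n)
        have v: "W_var n r d > 0" using a elim mult_pos_pos [of a n] by linarith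
        have b: "b \<ge> 0"
        proof -
          have "b * n > 0" using v elim by linarith
          then show ?thesis using elim by (simp add: zero_less_mult_iff)
        qed
        have "exp 2 \<le> a * n" using elim a by (simp add: field_simps)
        then have "exp 2 \<le> W_var n r d" using elim by linarith
        then have "ln (exp 2) \<le> ln (W_var n r d)" using v by (subst ln_le_cancel_iff) auto
        then have "1 \<le> ln (sqrt (W_var n r d))" using v by (simp add: ln_sqrt)
        then have l: "1 \<le> ln (sqrt (W_var n r d)) powr (3/2)" by (rule ge_one_powr_ge_zero) simp
        have "1 / n \<le> b / W_var n r d"
          using v elim by (simp add: field_simps)
        also have "\<dots> \<le> b * (ln (sqrt (W_var n r d)) powr (3/2) / W_var n r d)"
          using mult_left_mono [OF l, of "b / W_var n r d"] b v by simp
        finally have "C * (1 / n) \<le> C * (b * (ln (sqrt (W_var n r d)) powr (3/2) / W_var n r d))"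
          using C by (intro mult_left_mono)
        then show ?case using elim v by simp
      qed
    qed
  qed
qed

end
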